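(* Let $\Omega\subset\mathbb{R}^3$ be a bounded domain with (possibly disconnected) $C^{1,\beta}$-boundary for some $0<\beta\leq 1$. Let $M,N\in\mathbb{N}$, $0<\alpha\leq 1$, $\nu_*>0$ and suppose that $\nu=(\nu_1,\dots,\nu_M)\in C^{0,\alpha}_b(\mathbb{R}^N\times\overline{\Omega},\mathbb{R}^M)$ with $\nu_*\leq\nu_i$ for all $1\leq i\leq M$. Let $A\colon(L^2(\Omega))^M\to(L^2(\Omega))^N$ be a continuous function with the following two properties: (i) for every $\mu\in\mathbb{R}^M\subset(L^2(\Omega))^M$ there is some $0<\alpha_\mu\leq 1$ such that $A(\mu)\in(C^{0,\alpha_\mu}(\overline{\Omega}))^N$; (ii) for every $\mu\in\mathbb{R}^M$ there is some $L_\mu\in(0,\infty)$ such that $\|A(\mu+v)-A(\mu)\|_{L^2(\Omega)}\leq L_\mu\|v\|_{L^2(\Omega)}$ for all $v\in(L^2(\Omega))^M$. Take $f\in(C^{1,\beta}(\partial\Omega))^M$ and $\mu\in\mathbb{R}^M$. For $t>0$, let $F^t\in(H^1(\Omega))^M$ and $u\in(H^1(\Omega))^M$ be (any) weak solutions to the systems $$\operatorname{div}(\nu_i(A(F^t)(x),x)\nabla F^t_i(x))=0,\ 1\leq i\leq M,\quad F^t|_{\partial\Omega}=\mu+tf,$$ $$\operatorname{div}(\nu_i(A(\mu)(x),x)\nabla u_i(x))=0,\ 1\leq i\leq M,\quad u|_{\partial\Omega}=f.$$ Then, for every $1\leq i\leq M$, $$\frac{\mathcal{N}\cdot(\nu_i(A(F^t)(x),x)\nabla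 F^t_i)}{t}\to\mathcal{N}\cdot(\nu_i(A(\mu)(x),x)\nabla u_i)\quad\text{as }t\to0\text{ in }W^{-\frac12,2}(\partial\Omega).$$
   Context: $C^{0,\alpha}_b(U,\mathbb{R}^M)$ denotes the $\mathbb{R}^M$-valued $\alpha$-Hölder continuous functions on $U$ with finite $\alpha$-Hölder norm (in particular bounded). $\mathbb{R}^M$ is regarded as the subspace of constant functions in $(L^2(\Omega))^M$. $\mathcal{N}$ is the outward unit normal on $\partial\Omega$. $W^{-\frac12,2}(\partial\Omega)$ is the dual of $W^{\frac12,2}(\partial\Omega)$, and for a vector field $X\in L^2(\Omega)$ with $\operatorname{div}X\in L^2(\Omega)$, $\mathcal{N}\cdot X\in W^{-\frac12,2}(\partial\Omega)$ denotes its normal trace. Weak solutions are understood in the usual sense: for a.e.-bounded coefficient $a$, $\operatorname{div}(a\nabla w)=0$ means $\int_\Omega a\nabla w\cdot\nabla\psi\,dx=0$ for all $\psi\in H^1_0(\Omega)$; boundary values are in the sense of traces. *)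

theory Defs
  imports "HOL-Analysis.Analysis"
begin

section \<open>Hoelder functions and domains with \<open>C\<^sup>1\<^sup>,\<^sup>\<beta>\<close> boundary\<close>

definition bounded_holder ::
  "'a::metric_space set \<Rightarrow> real \<Rightarrow> ('a \<Rightarrow> 'b::real_normed_vector) set" where
  "bounded_holder S \<alpha> = {f. bounded (f ` S) \<and>
     (\<exists>C. \<forall>x\<in>S. \<forall>y\<in>S. norm (f x - f y) \<le> C * dist x y powr \<alpha>)}"

definition C1_holder :: "'a::euclidean_space set \<Rightarrow> real \<Rightarrow> ('a \<Rightarrow> real) set" where
  "C1_holder S \<beta> = {f. bounded (f ` S) \<and>
     (\<exists>D. (\<forall>x\<in>S. GDERIV f x :> D x) \<and> D \<in> bounded_holder S \<beta>)}"

text \<open>After the rotation or reflection \<open>Q\<close>, the set \<open>\<Omega>\<close> is, near \<open>p\<close>, the region above the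
  graph of \<open>\<gamma>\<close>. Only the values of \<open>\<gamma>\<close> near \<open>p\<close> matter, so taking \<open>\<gamma>\<close> in \<open>C\<^sup>1\<^sup>,\<^sup>\<beta>\<close> on the
  whole plane is no restriction.\<close>

definition graph_chart ::
  "(real^3) set \<Rightarrow> real \<Rightarrow> real^3 \<Rightarrow> (real^3 \<Rightarrow> real^3) \<Rightarrow> real \<Rightarrow> (real^2 \<Rightarrow> real) \<Rightarrow> bool" where
  "graph_chart \<Omega> \<beta> p Q r \<gamma> \<longleftrightarrow>
     0 < r \<and> orthogonal_transformation Q \<and> \<gamma> \<in> C1_holder UNIV \<beta> \<and>
     \<Omega> \<inter> ball p r = Q ` {y. \<gamma> (vector [y$1, y$2]) < y$3} \<inter> ball p r"

definition bounded_C1_holder_domain :: "real \<Rightarrow> (real^3) set \<Rightarrow> bool" where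
  "bounded_C1_holder_domain \<beta> \<Omega> \<longleftrightarrow>
     open \<Omega> \<and> connected \<Omega> \<and> bounded \<Omega> \<and> \<Omega> \<noteq> {} \<and>
     (\<forall>p\<in>frontier \<Omega>. \<exists>Q r \<gamma>. graph_chart \<Omega> \<beta> p Q r \<gamma>)"

definition graph_point :: "(real^3 \<Rightarrow> real^3) \<Rightarrow> (real^2 \<Rightarrow> real) \<Rightarrow> real^2 \<Rightarrow> real^3" where
  "graph_point Q \<gamma> z = Q (vector [z$1, z$2, \<gamma> z])"

text \<open>\<open>C\<^sup>1\<^sup>,\<^sup>\<beta>(\<partial>\<Omega>)\<close>, in local graph coordinates; values off \<open>\<partial>\<Omega>\<close> are irrelevant.\<close>

definition C1_holder_boundary :: "(real^3) set \<Rightarrow> real \<Rightarrow> (real^3 \<Rightarrow> real) set" where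
  "C1_holder_boundary \<Omega> \<beta> = {f. \<forall>p\<in>frontier \<Omega>. \<exists>Q r \<gamma>. graph_chart \<Omega> \<beta> p Q r \<gamma> \<and>
     (\<lambda>z. f (graph_point Q \<gamma> z)) \<in> C1_holder {z. graph_point Q \<gamma> z \<in> ball p r} \<beta>}"


section \<open>Square-integrable functions\<close>

text \<open>Elements of \<open>L\<^sup>2\<close> are handled through representatives; all notions below respect equality
  almost everywhere. Vector-valued functions represent \<open>(L\<^sup>2)\<^sup>M\<close>.\<close>

definition L2 :: "'a measure \<Rightarrow> ('a \<Rightarrow> 'b::euclidean_space) set" where
  "L2 M = {f \<in> borel_measurable M. integrable M (\<lambda>x. (norm (f x))\<^sup>2)}"

definition L2_norm :: "'a measure \<Rightarrow> ('a \<Rightarrow> 'b::euclidean_space) \<Rightarrow> real" where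
  "L2_norm M f = sqrt (\<integral>x. (norm (f x))\<^sup>2 \<partial>M)"

definition continuous_on_L2 ::
  "'a measure \<Rightarrow> (('a \<Rightarrow> 'b::euclidean_space) \<Rightarrow> ('a \<Rightarrow> 'c::euclidean_space)) \<Rightarrow> bool" where
  "continuous_on_L2 M A \<longleftrightarrow>
     (\<forall>v\<in>L2 M. \<forall>\<epsilon>>0. \<exists>\<delta>>0. \<forall>w\<in>L2 M.
        L2_norm M (\<lambda>x. w x - v x) < \<delta> \<longrightarrow> L2_norm M (\<lambda>x. A w x - A v x) < \<epsilon>)"


section \<open>Sobolev spaces on an open set\<close>

definition C1_with_grad :: "(real^3 \<Rightarrow> real) \<Rightarrow> (real^3 \<Rightarrow> real^3) \<Rightarrow> bool" where
  "C1_with_grad \<phi> D \<longleftrightarrow> (\<forall>x. GDERIV \<phi> x :> D x) \<and> continuous_on UNIV D"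

text \<open>Test functions are \<open>C\<^sup>1\<^sub>c(\<Omega>)\<close>, as in Brezis; this yields the same weak derivatives and the
  same \<open>H\<^sup>1\<^sub>0(\<Omega>)\<close> as \<open>C\<^sup>\<infinity>\<^sub>c(\<Omega>)\<close>.\<close>

definition test_with_grad :: "(real^3) set \<Rightarrow> (real^3 \<Rightarrow> real) \<Rightarrow> (real^3 \<Rightarrow> real^3) \<Rightarrow> bool" where
  "test_with_grad \<Omega> \<phi> D \<longleftrightarrow> C1_with_grad \<phi> D \<and>
     compact (closure {x. \<phi> x \<noteq> 0}) \<and> closure {x. \<phi> x \<noteq> 0} \<subseteq> \<Omega>"

definition is_weak_grad :: "(real^3) set \<Rightarrow> (real^3 \<Rightarrow> real) \<Rightarrow> (real^3 \<Rightarrow> real^3) \<Rightarrow> bool" where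
  "is_weak_grad \<Omega> w G \<longleftrightarrow> G \<in> L2 (lebesgue_on \<Omega>) \<and>
     (\<forall>\<phi> D. test_with_grad \<Omega> \<phi> D \<longrightarrow>
        (\<integral>x. w x *\<^sub>R D x \<partial>lebesgue_on \<Omega>) = - (\<integral>x. \<phi> x *\<^sub>R G x \<partial>lebesgue_on \<Omega>))"

definition weak_grad :: "(real^3) set \<Rightarrow> (real^3 \<Rightarrow> real) \<Rightarrow> real^3 \<Rightarrow> real^3" where
  "weak_grad \<Omega> w = (SOME G. is_weak_grad \<Omega> w G)"

definition is_weak_div :: "(real^3) set \<Rightarrow> (real^3 \<Rightarrow> real^3) \<Rightarrow> (real^3 \<Rightarrow> real) \<Rightarrow> bool" where
  "is_weak_div \<Omega> X d \<longleftrightarrow> d \<in> L2 (lebesgue_on \<Omega>) \<and>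
     (\<forall>\<phi> D. test_with_grad \<Omega> \<phi> D \<longrightarrow>
        (\<integral>x. X x \<bullet> D x \<partial>lebesgue_on \<Omega>) = - (\<integral>x. d x * \<phi> x \<partial>lebesgue_on \<Omega>))"

definition weak_div :: "(real^3) set \<Rightarrow> (real^3 \<Rightarrow> real^3) \<Rightarrow> real^3 \<Rightarrow> real" where
  "weak_div \<Omega> X = (SOME d. is_weak_div \<Omega> X d)"

definition H1 :: "(real^3) set \<Rightarrow> (real^3 \<Rightarrow> real) set" where
  "H1 \<Omega> = {w \<in> L2 (lebesgue_on \<Omega>). \<exists>G. is_weak_grad \<Omega> w G}"

definition H1_norm :: "(real^3) set \<Rightarrow> (real^3 \<Rightarrow> real) \<Rightarrow> real" where
  "H1_norm \<Omega> w =
     sqrt ((L2_norm (lebesgue_on \<Omega>) w)\<^sup>2 + (L2_norm (lebesgue_on \<Omega>) (weak_grad \<Omega> w))\<^sup>2)"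

definition H1_approx ::
  "(real^3) set \<Rightarrow> (nat \<Rightarrow> real^3 \<Rightarrow> real) \<Rightarrow> (nat \<Rightarrow> real^3 \<Rightarrow> real^3) \<Rightarrow> (real^3 \<Rightarrow> real) \<Rightarrow> bool" where
  "H1_approx \<Omega> \<phi> D w \<longleftrightarrow>
     (\<lambda>n. L2_norm (lebesgue_on \<Omega>) (\<lambda>x. \<phi> n x - w x)) \<longlonglongrightarrow> 0 \<and>
     (\<lambda>n. L2_norm (lebesgue_on \<Omega>) (\<lambda>x. D n x - weak_grad \<Omega> w x)) \<longlonglongrightarrow> 0"

definition H1_0 :: "(real^3) set \<Rightarrow> (real^3 \<Rightarrow> real) set" where
  "H1_0 \<Omega> = {w \<in> H1 \<Omega>.
     \<exists>\<phi> D. (\<forall>n. test_with_grad \<Omega> (\<phi> n) (D n)) \<and> H1_approx \<Omega> \<phi> D w}"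

definition weak_solution :: "(real^3) set \<Rightarrow> (real^3 \<Rightarrow> real) \<Rightarrow> (real^3 \<Rightarrow> real) \<Rightarrow> bool" where
  "weak_solution \<Omega> a w \<longleftrightarrow> w \<in> H1 \<Omega> \<and>
     (\<forall>\<psi>\<in>H1_0 \<Omega>.
        (\<integral>x. (a x *\<^sub>R weak_grad \<Omega> w x) \<bullet> weak_grad \<Omega> \<psi> x \<partial>lebesgue_on \<Omega>) = 0)"


section \<open>Traces\<close>

text \<open>Surface measure is two-dimensional Hausdorff measure, normalised by \<open>\<pi>/4\<close> (the area of a
  planar disc of diameter 1). The covering sets are required to be bounded because \<open>diameter\<close> is
  not meaningful on unbounded sets.\<close>

definition hausdorff2_pre :: "real \<Rightarrow> (real^3) set \<Rightarrow> ennreal" where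
  "hausdorff2_pre \<delta> S =
     (INF C \<in> {C :: nat \<Rightarrow> (real^3) set. S \<subseteq> (\<Union>n. C n) \<and> (\<forall>n. bounded (C n) \<and> diameter (C n) \<le> \<delta>)}.
        (\<Sum>n. ennreal (pi / 4 * (diameter (C n))\<^sup>2)))"

definition hausdorff2 :: "(real^3) measure" where
  "hausdorff2 = measure_of UNIV (sets borel) (\<lambda>S. SUP \<delta>\<in>{0<..}. hausdorff2_pre \<delta> S)"

definition surface :: "(real^3) set \<Rightarrow> (real^3) measure" where
  "surface \<Omega> = restrict_space hausdorff2 (frontier \<Omega>)"

text \<open>The trace operator as the closure, in \<open>H\<^sup>1(\<Omega>) \<times> L\<^sup>2(\<partial>\<Omega>)\<close>, of the restriction map on
  functions of class \<open>C\<^sup>1\<close> up to the boundary.\<close>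

definition has_trace :: "(real^3) set \<Rightarrow> (real^3 \<Rightarrow> real) \<Rightarrow> (real^3 \<Rightarrow> real) \<Rightarrow> bool" where
  "has_trace \<Omega> w g \<longleftrightarrow> w \<in> H1 \<Omega> \<and> g \<in> L2 (surface \<Omega>) \<and>
     (\<exists>\<phi> D. (\<forall>n. C1_with_grad (\<phi> n) (D n)) \<and> H1_approx \<Omega> \<phi> D w \<and>
        (\<lambda>n. \<integral>\<^sup>+x. ennreal ((\<phi> n x - g x)\<^sup>2) \<partial>surface \<Omega>) \<longlonglongrightarrow> 0)"

text \<open>\<open>W\<^sup>1\<^sup>/\<^sup>2\<^sup>,\<^sup>2(\<partial>\<Omega>)\<close> is the range of the trace operator on \<open>H\<^sup>1(\<Omega>)\<close> with its quotient norm
  (Temam; Girault and Raviart), which is equivalent to the Sobolev-Slobodeckij norm.\<close>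

definition W_half :: "(real^3) set \<Rightarrow> (real^3 \<Rightarrow> real) set" where
  "W_half \<Omega> = {g. \<exists>G. has_trace \<Omega> G g}"

definition W_half_norm :: "(real^3) set \<Rightarrow> (real^3 \<Rightarrow> real) \<Rightarrow> real" where
  "W_half_norm \<Omega> g = (INF G \<in> {G. has_trace \<Omega> G g}. H1_norm \<Omega> G)"

text \<open>Boundedness forces a functional to agree on functions that are equal almost everywhere
  on \<open>\<partial>\<Omega>\<close>.\<close>

definition W_minus_half :: "(real^3) set \<Rightarrow> ((real^3 \<Rightarrow> real) \<Rightarrow> real) set" where
  "W_minus_half \<Omega> = {l.
     (\<forall>g\<in>W_half \<Omega>. \<forall>h\<in>W_half \<Omega>. l (\<lambda>x. g x + h x) = l g + l h) \<and>
     (\<forall>c. \<forall>g\<in>W_half \<Omega>. l (\<lambda>x. c * g x) = c * l g) \<and>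
     (\<exists>C. \<forall>g\<in>W_half \<Omega>. \<bar>l g\<bar> \<le> C * W_half_norm \<Omega> g)}"

definition W_minus_half_norm :: "(real^3) set \<Rightarrow> ((real^3 \<Rightarrow> real) \<Rightarrow> real) \<Rightarrow> ennreal" where
  "W_minus_half_norm \<Omega> l = (SUP g \<in> {g \<in> W_half \<Omega>. W_half_norm \<Omega> g \<le> 1}. ennreal \<bar>l g\<bar>)"

text \<open>The normal trace with respect to the outward normal, for \<open>X\<close> and \<open>div X\<close> in \<open>L\<^sup>2(\<Omega>)\<close>,
  through Green's formula; the value does not depend on the extension \<open>G\<close> of \<open>g\<close>.\<close>

definition normal_trace :: "(real^3) set \<Rightarrow> (real^3 \<Rightarrow> real^3) \<Rightarrow> (real^3 \<Rightarrow> real) \<Rightarrow> real" where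
  "normal_trace \<Omega> X g =
     (let G = (SOME G. has_trace \<Omega> G g)
      in (\<integral>x. X x \<bullet> weak_grad \<Omega> G x + weak_div \<Omega> X x * G x \<partial>lebesgue_on \<Omega>))"

end

theory Submission
  imports Defs
begin

text \<open>The convergence is an energy estimate for the difference quotient. Fix a component, write
  \<open>a\<^sub>t\<close> and \<open>a\<^sub>0\<close> for the coefficients belonging to \<open>F\<^sup>t\<close> and to the constant \<open>\<mu>\<close>, and put
  \<open>W = F\<^sup>t - \<mu> - t u\<close>. The boundary values of \<open>W\<close> vanish, so \<open>W\<close> may be used as a test function
  in both equations. Subtracting them gives \<open>\<nu>\<^sub>0 \<parallel>\<nabla>W\<parallel> \<le> t \<parallel>(a\<^sub>t - a\<^sub>0) \<nabla>u\<parallel>\<close> in \<open>L\<^sup>2\<close>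
  (\<open>energy_estimate\<close>). Two things follow. The fluxes satisfy
  \<open>\<parallel>a\<^sub>t \<nabla>F\<^sup>t / t - a\<^sub>0 \<nabla>u\<parallel> \<le> C \<parallel>(a\<^sub>t - a\<^sub>0) \<nabla>u\<parallel>\<close>, and by the Poincare inequality
  \<open>F\<^sup>t\<close> tends to \<open>\<mu>\<close> in \<open>L\<^sup>2\<close> at rate \<open>t\<close>. The Lipschitz bound for the operator at constants then
  shows that \<open>a\<^sub>t - a\<^sub>0\<close>, which stays bounded, tends to zero in \<open>L\<^sup>2\<close>; splitting \<open>\<nabla>u\<close> at a high
  level one gets \<open>(a\<^sub>t - a\<^sub>0) \<nabla>u \<rightarrow> 0\<close> in \<open>L\<^sup>2\<close> (\<open>bounded_Hoelder_multiplier_tendsto_0\<close>).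
  Finally the normal trace of a divergence-free field \<open>X\<close> pairs with a boundary function as
  \<open>\<integral> X \<bullet> \<nabla>G\<close> for an arbitrary extension \<open>G\<close>, so its dual norm is at most the \<open>L\<^sup>2\<close> norm of \<open>X\<close>
  (\<open>normal_trace_diff_norm\<close>).

  Both the use of \<open>W\<close> as a test function and the freedom in the choice of \<open>G\<close> rest on one fact:
  a function of trace zero lies in \<open>H\<^sup>1\<^sub>0\<close> (\<open>zero_trace_imp_H1_0\<close>). Here trace zero means that the
  function is an \<open>H\<^sup>1\<close> limit of \<open>C\<^sup>1\<close> functions \<open>\<phi>\<^sub>n\<close> whose boundary values tend to zero in
  \<open>L\<^sup>2(\<partial>\<Omega>)\<close>. In a boundary chart \<open>\<phi>\<^sub>n\<close> is multiplied by a cut-off that vanishes near \<open>\<partial>\<Omega>\<close>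
  and equals one at distance \<open>\<epsilon>\<close>. The cut-off has slope of order \<open>1 / \<epsilon>\<close>, and the resulting error
  is controlled by the estimate
  \<open>\<integral>\<^bsub>strip\<^esub> \<phi>\<^sup>2 \<le> C \<epsilon> \<integral>\<^bsub>\<partial>\<Omega>\<^esub> \<phi>\<^sup>2 + 2 \<epsilon>\<^sup>2 \<integral>\<^bsub>strip\<^esub> \<bar>\<nabla>\<phi>\<bar>\<^sup>2\<close>
  on the boundary strip of width \<open>\<epsilon>\<close> (\<open>strip_estimate\<close>): first let \<open>n \<rightarrow> \<infinity>\<close>, then \<open>\<epsilon> \<rightarrow> 0\<close>.
  The strip estimate combines the fundamental theorem of calculus along segments transversal to the
  boundary with a comparison of volume and surface measure. The comparison holds because
  a covering of a boundary piece by small sets yields a covering of the strip above it by boxes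
  (\<open>lborel_le_hausdorff2\<close>); it requires that the surface measure is indeed a measure, which is
  Caratheodory's theorem on metric outer measures (\<open>measure_space_hausdorff2\<close>).\<close>

section \<open>The seminormed space of square-integrable functions\<close>

lemma L2_D:
  assumes "f \<in> L2 M"
  shows "f \<in> borel_measurable M" "integrable M (\<lambda>x. (norm (f x))\<^sup>2)"
  using assms by (auto simp: L2_def)

lemma L2_bound:
  fixes f :: "'a \<Rightarrow> 'b::euclidean_space" and g :: "'a \<Rightarrow> 'c::euclidean_space"
  assumes "g \<in> L2 M" "f \<in> borel_measurable M" "AE x in M. norm (f x) \<le> K * norm (g x)"
  shows "f \<in> L2 M"
proof -
  have "integrable M (\<lambda>x. (norm (f x))\<^sup>2)"
  proof (rule Bochner_Integration.integrable_bound)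
    show "integrable M (\<lambda>x. K\<^sup>2 * (norm (g x))\<^sup>2)" using L2_D[OF assms(1)] by simp
    show "(\<lambda>x. (norm (f x))\<^sup>2) \<in> borel_measurable M" using assms(2) by measurable
    show "AE x in M. norm ((norm (f x))\<^sup>2) \<le> norm (K\<^sup>2 * (norm (g x))\<^sup>2)"
      using assms(3)
      by eventually_elim (simp flip: power_mult_distrib, metis norm_ge_zero power_mono)
  qed
  then show ?thesis using assms(2) by (simp add: L2_def)
qed

lemma L2_add:
  assumes "f \<in> L2 M" "g \<in> L2 M"
  shows "(\<lambda>x. f x + g x) \<in> L2 M"
proof -
  have "integrable M (\<lambda>x. (norm (f x + g x))\<^sup>2)"
  proof (rule Bochner_Integration.integrable_bound)
    show "integrable M (\<lambda>x. 2 * (norm (f x))\<^sup>2 + 2 * (norm (g x))\<^sup>2)"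
      using L2_D[OF assms(1)] L2_D[OF assms(2)] by simp
    show "(\<lambda>x. (norm (f x + g x))\<^sup>2) \<in> borel_measurable M"
      using L2_D[OF assms(1)] L2_D[OF assms(2)] by measurable
    have "(norm (f x + g x))\<^sup>2 \<le> 2 * (norm (f x))\<^sup>2 + 2 * (norm (g x))\<^sup>2" for x
    proof -
      have "(norm (f x + g x))\<^sup>2 \<le> (norm (f x) + norm (g x))\<^sup>2"
        by (intro power_mono norm_triangle_ineq) auto
      also have "\<dots> \<le> 2 * (norm (f x))\<^sup>2 + 2 * (norm (g x))\<^sup>2"
        using sum_squares_bound[of "norm (f x)" "norm (g x)"]
        by (simp add: power2_sum)
      finally show ?thesis .
    qed
    then show "AE x in M. norm ((norm (f x + g x))\<^sup>2)
        \<le> norm (2 * (norm (f x))\<^sup>2 + 2 * (norm (g x))\<^sup>2)"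
      by (auto intro!: AE_I2 order_trans[OF _ abs_ge_self])
  qed
  then show ?thesis using L2_D[OF assms(1)] L2_D[OF assms(2)] by (simp add: L2_def)
qed

lemma L2_scaleR:
  assumes "f \<in> L2 M"
  shows "(\<lambda>x. c *\<^sub>R f x) \<in> L2 M"
  by (rule L2_bound[OF assms, of _ "\<bar>c\<bar>"]) (use L2_D[OF assms] in auto)

lemma L2_diff:
  assumes "f \<in> L2 M" "g \<in> L2 M"
  shows "(\<lambda>x. f x - g x) \<in> L2 M"
  using L2_add[OF assms(1) L2_scaleR[OF assms(2), of "-1"]] by simp

lemma L2_mult_bounded:
  fixes a :: "'a \<Rightarrow> real"
  assumes "f \<in> L2 M" "a \<in> borel_measurable M" "\<And>x. x \<in> space M \<Longrightarrow> \<bar>a x\<bar> \<le> K"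
  shows "(\<lambda>x. a x *\<^sub>R f x) \<in> L2 M"
  by (rule L2_bound[OF assms(1), of _ K])
     (use L2_D[OF assms(1)] assms in \<open>auto intro!: mult_right_mono AE_I2\<close>)

lemma L2_norm_fun: "f \<in> L2 M \<Longrightarrow> (\<lambda>x. norm (f x)) \<in> L2 M"
  by (auto simp: L2_def intro: borel_measurable_norm)

lemma L2_bounded:
  fixes f :: "'a \<Rightarrow> 'b::euclidean_space"
  assumes "finite_measure M" "f \<in> borel_measurable M" "\<And>x. x \<in> space M \<Longrightarrow> norm (f x) \<le> K"
  shows "f \<in> L2 M"
proof (rule L2_bound[of "\<lambda>_. 1::real" M f K])
  show "(\<lambda>_. 1::real) \<in> L2 M" using assms(1) by (simp add: L2_def finite_measure.integrable_const)
qed (use assms in \<open>auto intro!: AE_I2\<close>)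

lemma L2_norm_nonneg [simp]: "0 \<le> L2_norm M f"
  by (simp add: L2_norm_def)

lemma L2_norm_sq: "(L2_norm M f)\<^sup>2 = (\<integral>x. (norm (f x))\<^sup>2 \<partial>M)"
  by (simp add: L2_norm_def)

lemma L2_norm_zero [simp]: "L2_norm M (\<lambda>x. 0) = 0"
  by (simp add: L2_norm_def)

lemma L2_norm_scaleR: "L2_norm M (\<lambda>x. c *\<^sub>R f x) = \<bar>c\<bar> * L2_norm M f"
  by (simp add: L2_norm_def power_mult_distrib real_sqrt_mult)

lemma L2_norm_minus: "L2_norm M (\<lambda>x. f x - g x) = L2_norm M (\<lambda>x. g x - f x)"
  by (simp add: L2_norm_def norm_minus_commute)

lemma L2_norm_cong_AE:
  assumes "f \<in> L2 M" "g \<in> L2 M" "AE x in M. norm (f x) = norm (g x)"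
  shows "L2_norm M f = L2_norm M g"
  unfolding L2_norm_def
  by (intro arg_cong[where f = sqrt] integral_cong_AE)
     (use assms L2_D[OF assms(1)] L2_D[OF assms(2)] in \<open>auto elim: eventually_mono\<close>)

lemma L2_norm_mono_AE:
  fixes f :: "'a \<Rightarrow> 'b::euclidean_space" and g :: "'a \<Rightarrow> 'c::euclidean_space"
  assumes "f \<in> L2 M" "g \<in> L2 M" "AE x in M. norm (f x) \<le> K * norm (g x)" "0 \<le> K"
  shows "L2_norm M f \<le> K * L2_norm M g"
proof -
  have "(\<integral>x. (norm (f x))\<^sup>2 \<partial>M) \<le> (\<integral>x. K\<^sup>2 * (norm (g x))\<^sup>2 \<partial>M)"
  proof (rule integral_mono_AE)
    show "AE x in M. (norm (f x))\<^sup>2 \<le> K\<^sup>2 * (norm (g x))\<^sup>2"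
      using assms(3) by eventually_elim (simp add: power_mono flip: power_mult_distrib)
  qed (use L2_D[OF assms(1)] L2_D[OF assms(2)] in auto)
  then have "L2_norm M f \<le> sqrt (K\<^sup>2 * (\<integral>x. (norm (g x))\<^sup>2 \<partial>M))"
    by (simp add: L2_norm_def)
  then show ?thesis using assms(4) by (simp add: L2_norm_def real_sqrt_mult)
qed

lemma L2_Cauchy_Schwarz_norm:
  fixes f :: "'a \<Rightarrow> 'b::euclidean_space" and g :: "'a \<Rightarrow> 'c::euclidean_space"
  assumes "f \<in> L2 M" "g \<in> L2 M"
  shows "integrable M (\<lambda>x. norm (f x) * norm (g x))"
    and "(\<integral>x. norm (f x) * norm (g x) \<partial>M) \<le> L2_norm M f * L2_norm M g"
proof -
  note mf = L2_D[OF assms(1)] and mg = L2_D[OF assms(2)]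
  show int: "integrable M (\<lambda>x. norm (f x) * norm (g x))"
  proof (rule Bochner_Integration.integrable_bound)
    show "integrable M (\<lambda>x. (norm (f x))\<^sup>2 + (norm (g x))\<^sup>2)" using mf mg by simp
    show "(\<lambda>x. norm (f x) * norm (g x)) \<in> borel_measurable M" using mf mg by measurable
    have "norm (f x) * norm (g x) \<le> (norm (f x))\<^sup>2 + (norm (g x))\<^sup>2" for x
      using sum_squares_bound[of "norm (f x)" "norm (g x)"]
        mult_nonneg_nonneg[OF norm_ge_zero[of "f x"] norm_ge_zero[of "g x"]] by linarith
    then show "AE x in M. norm (norm (f x) * norm (g x)) \<le> norm ((norm (f x))\<^sup>2 + (norm (g x))\<^sup>2)"
      by (auto intro!: AE_I2 order_trans[OF _ abs_ge_self])
  qed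
  let ?I = "\<integral>x. norm (f x) * norm (g x) \<partial>M"
  have "(\<integral>\<^sup>+x. ennreal (norm (f x)) * ennreal (norm (g x)) \<partial>M)\<^sup>2
      \<le> (\<integral>\<^sup>+x. (ennreal (norm (f x)))\<^sup>2 \<partial>M) * (\<integral>\<^sup>+x. (ennreal (norm (g x)))\<^sup>2 \<partial>M)"
    by (rule Cauchy_Schwarz_nn_integral) (use mf mg in measurable)
  also have "(\<integral>\<^sup>+x. ennreal (norm (f x)) * ennreal (norm (g x)) \<partial>M) = ennreal ?I"
    using nn_integral_eq_integral[OF int] by (simp add: ennreal_mult)
  also have "(\<integral>\<^sup>+x. (ennreal (norm (f x)))\<^sup>2 \<partial>M) = ennreal ((L2_norm M f)\<^sup>2)"
    using nn_integral_eq_integral[OF mf(2)] by (simp add: ennreal_power L2_norm_sq)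
  also have "(\<integral>\<^sup>+x. (ennreal (norm (g x)))\<^sup>2 \<partial>M) = ennreal ((L2_norm M g)\<^sup>2)"
    using nn_integral_eq_integral[OF mg(2)] by (simp add: ennreal_power L2_norm_sq)
  finally have "ennreal (?I\<^sup>2) \<le> ennreal ((L2_norm M f * L2_norm M g)\<^sup>2)"
    by (simp add: ennreal_power power_mult_distrib ennreal_mult)
  then have "?I\<^sup>2 \<le> (L2_norm M f * L2_norm M g)\<^sup>2"
    by (simp add: ennreal_le_iff)
  then show "?I \<le> L2_norm M f * L2_norm M g"
    by (rule power2_le_imp_le) simp
qed

lemma L2_integrable_scaleR:
  fixes f :: "'a \<Rightarrow> real" and g :: "'a \<Rightarrow> 'c::euclidean_space"
  assumes "f \<in> L2 M" "g \<in> L2 M"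
  shows "integrable M (\<lambda>x. f x *\<^sub>R g x)"
  by (rule Bochner_Integration.integrable_bound[OF L2_Cauchy_Schwarz_norm(1)[OF assms]])
     (use L2_D[OF assms(1)] L2_D[OF assms(2)] in auto)

lemma L2_norm_integral_scaleR:
  fixes f :: "'a \<Rightarrow> real" and g :: "'a \<Rightarrow> 'c::euclidean_space"
  assumes "f \<in> L2 M" "g \<in> L2 M"
  shows "norm (\<integral>x. f x *\<^sub>R g x \<partial>M) \<le> L2_norm M f * L2_norm M g"
proof -
  have "norm (\<integral>x. f x *\<^sub>R g x \<partial>M) \<le> (\<integral>x. norm (f x) * norm (g x) \<partial>M)"
    using integral_norm_bound[of M "\<lambda>x. f x *\<^sub>R g x"] by simp
  also have "\<dots> \<le> L2_norm M f * L2_norm M g" by (rule L2_Cauchy_Schwarz_norm(2)[OF assms])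
  finally show ?thesis .
qed

lemma L2_integrable_inner:
  assumes "f \<in> L2 M" "g \<in> L2 M"
  shows "integrable M (\<lambda>x. f x \<bullet> g x)"
proof (rule Bochner_Integration.integrable_bound[OF L2_Cauchy_Schwarz_norm(1)[OF assms]])
  show "(\<lambda>x. f x \<bullet> g x) \<in> borel_measurable M"
    using L2_D[OF assms(1)] L2_D[OF assms(2)] by measurable
qed (use Cauchy_Schwarz_ineq2 in auto)

lemma L2_Cauchy_Schwarz:
  assumes "f \<in> L2 M" "g \<in> L2 M"
  shows "\<bar>\<integral>x. f x \<bullet> g x \<partial>M\<bar> \<le> L2_norm M f * L2_norm M g"
proof -
  have "\<bar>\<integral>x. f x \<bullet> g x \<partial>M\<bar> \<le> (\<integral>x. \<bar>f x \<bullet> g x\<bar> \<partial>M)"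
    by (rule integral_abs_bound)
  also have "\<dots> \<le> (\<integral>x. norm (f x) * norm (g x) \<partial>M)"
    by (rule integral_mono)
       (use L2_integrable_inner[OF assms] L2_Cauchy_Schwarz_norm(1)[OF assms]
         Cauchy_Schwarz_ineq2 in auto)
  also have "\<dots> \<le> L2_norm M f * L2_norm M g" by (rule L2_Cauchy_Schwarz_norm(2)[OF assms])
  finally show ?thesis .
qed

lemma L2_norm_triangle:
  assumes "f \<in> L2 M" "g \<in> L2 M"
  shows "L2_norm M (\<lambda>x. f x + g x) \<le> L2_norm M f + L2_norm M g"
proof (rule power2_le_imp_le)
  have "(L2_norm M (\<lambda>x. f x + g x))\<^sup>2
      = (\<integral>x. (norm (f x))\<^sup>2 + 2 * (f x \<bullet> g x) + (norm (g x))\<^sup>2 \<partial>M)"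
    unfolding L2_norm_sq by (simp add: power2_norm_eq_inner inner_add inner_commute algebra_simps)
  also have "\<dots> = (L2_norm M f)\<^sup>2 + 2 * (\<integral>x. f x \<bullet> g x \<partial>M) + (L2_norm M g)\<^sup>2"
    unfolding L2_norm_sq
    using L2_D[OF assms(1)] L2_D[OF assms(2)] L2_integrable_inner[OF assms] by simp
  also have "\<dots> \<le> (L2_norm M f + L2_norm M g)\<^sup>2"
    using L2_Cauchy_Schwarz[OF assms] by (simp add: power2_sum)
  finally show "(L2_norm M (\<lambda>x. f x + g x))\<^sup>2 \<le> (L2_norm M f + L2_norm M g)\<^sup>2" .
qed simp

lemma L2_norm_triangle_diff:
  assumes "f \<in> L2 M" "g \<in> L2 M" "h \<in> L2 M"
  shows "L2_norm M (\<lambda>x. f x - h x) \<le> L2_norm M (\<lambda>x. f x - g x) + L2_norm M (\<lambda>x. g x - h x)"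
  using L2_norm_triangle[OF L2_diff[OF assms(1,2)] L2_diff[OF assms(2,3)]] by simp

section \<open>\<open>C\<^sup>1\<close> functions, cut-offs and integration by parts\<close>

lemma C1_with_grad_D:
  assumes "C1_with_grad \<phi> D"
  shows "(\<phi> has_derivative (\<lambda>h. h \<bullet> D x)) (at x within S)" "continuous_on S D"
    "continuous_on S \<phi>" "\<phi> \<in> borel_measurable borel" "D \<in> borel_measurable borel"
proof -
  have d: "(\<phi> has_derivative (\<lambda>h. h \<bullet> D x)) (at x)" for x
    using assms by (auto simp: C1_with_grad_def gderiv_def)
  then show "(\<phi> has_derivative (\<lambda>h. h \<bullet> D x)) (at x within S)"
    using has_derivative_at_withinI by blast
  show c: "continuous_on S D" for S
    using assms continuous_on_subset by (auto simp: C1_with_grad_def)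
  show c': "continuous_on S \<phi>" for S
    by (meson continuous_at_imp_continuous_on d has_derivative_continuous)
  show "\<phi> \<in> borel_measurable borel" "D \<in> borel_measurable borel"
    using c[of UNIV] c'[of UNIV] by (simp_all add: borel_measurable_continuous_onI)
qed

lemma C1_with_gradI:
  assumes "\<And>x. (\<phi> has_derivative (\<lambda>h. h \<bullet> D x)) (at x)" "continuous_on UNIV D"
  shows "C1_with_grad \<phi> D"
  using assms by (auto simp: C1_with_grad_def gderiv_def)

lemma C1_const: "C1_with_grad (\<lambda>x. c) (\<lambda>x. 0)"
  by (rule C1_with_gradI) (auto intro!: derivative_eq_intros)

lemma C1_inner: "C1_with_grad (\<lambda>x. x \<bullet> e) (\<lambda>x. e)"
  by (rule C1_with_gradI) (auto intro!: derivative_eq_intros)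

lemma C1_add:
  assumes "C1_with_grad \<phi> D" "C1_with_grad \<psi> E"
  shows "C1_with_grad (\<lambda>x. \<phi> x + \<psi> x) (\<lambda>x. D x + E x)"
  using C1_with_grad_D[OF assms(1)] C1_with_grad_D[OF assms(2)]
  by (intro C1_with_gradI)
     (auto intro!: derivative_eq_intros continuous_intros simp: inner_add_right)

lemma C1_mult:
  assumes "C1_with_grad \<phi> D" "C1_with_grad \<psi> E"
  shows "C1_with_grad (\<lambda>x. \<phi> x * \<psi> x) (\<lambda>x. \<phi> x *\<^sub>R E x + \<psi> x *\<^sub>R D x)"
  using C1_with_grad_D[OF assms(1)] C1_with_grad_D[OF assms(2)]
  by (intro C1_with_gradI)
     (auto intro!: derivative_eq_intros continuous_intros simp: inner_add_right algebra_simps)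

lemma C1_cmult:
  assumes "C1_with_grad \<phi> D"
  shows "C1_with_grad (\<lambda>x. c * \<phi> x) (\<lambda>x. c *\<^sub>R D x)"
  using C1_mult[OF C1_const[of c] assms] by simp

lemma C1_compose:
  assumes "\<And>s. (h has_real_derivative h' s) (at s)" "continuous_on UNIV h'" "C1_with_grad \<phi> D"
  shows "C1_with_grad (\<lambda>x. h (\<phi> x)) (\<lambda>x. h' (\<phi> x) *\<^sub>R D x)"
proof (rule C1_with_gradI)
  fix x
  have "(h has_derivative (\<lambda>s. s * h' (\<phi> x))) (at (\<phi> x))"
    using assms(1)[of "\<phi> x"] by (simp add: has_field_derivative_def mult_commute_abs)
  from has_derivative_compose[OF C1_with_grad_D(1)[OF assms(3)] this]
  show "((\<lambda>x. h (\<phi> x)) has_derivative (\<lambda>v. v \<bullet> (h' (\<phi> x) *\<^sub>R D x))) (at x)"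
    by (simp add: mult.commute)
next
  show "continuous_on UNIV (\<lambda>x. h' (\<phi> x) *\<^sub>R D x)"
    using C1_with_grad_D(2,3)[OF assms(3)]
    by (intro continuous_intros continuous_on_compose2[OF assms(2)]) auto
qed

lemma C1_sum:
  assumes "finite J" "\<And>j. j \<in> J \<Longrightarrow> C1_with_grad (\<phi> j) (D j)"
  shows "C1_with_grad (\<lambda>x. \<Sum>j\<in>J. \<phi> j x) (\<lambda>x. \<Sum>j\<in>J. D j x)"
  using assms by (induction J) (auto intro: C1_const C1_add)

lemma C1_grad_eq_0:
  assumes "C1_with_grad \<phi> D" "open U" "x \<in> U" "\<And>y. y \<in> U \<Longrightarrow> \<phi> y = 0"
  shows "D x = 0"
proof -
  have "(\<phi> has_derivative (\<lambda>h. 0)) (at x)"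
    by (rule has_derivative_transform_within_open[OF has_derivative_const assms(2,3)])
       (use assms(4) in auto)
  with C1_with_grad_D(1)[OF assms(1), of x UNIV] have "(\<lambda>h. h \<bullet> D x) = (\<lambda>h. 0)"
    using has_derivative_unique by blast
  then show ?thesis by (metis inner_eq_zero_iff)
qed

text \<open>Truncated squares are \<open>C\<^sup>1\<close>; all cut-off functions below are built from them.\<close>

lemma truncated_square_deriv:
  "((\<lambda>s::real. (max 0 s)\<^sup>2) has_real_derivative 2 * max 0 s) (at s)"
proof -
  consider "s < 0" | "s = 0" | "0 < s" by linarith
  then show ?thesis
  proof cases
    case 1
    have "((\<lambda>s::real. 0) has_real_derivative 0) (at s)" by simp
    then have "((\<lambda>s::real. (max 0 s)\<^sup>2) has_real_derivative 0) (at s)"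
      by (rule has_field_derivative_transform_within_open[of _ _ _ "{..<0}"]) (use 1 in auto)
    then show ?thesis using 1 by simp
  next
    case 2
    have "((\<lambda>h::real. (max 0 h)\<^sup>2 / h) \<longlongrightarrow> 0) (at 0)"
    proof (rule Lim_null_comparison[where g = "\<lambda>h. \<bar>h\<bar>"])
      show "\<forall>\<^sub>F h in at 0. norm ((max 0 h)\<^sup>2 / h) \<le> \<bar>h::real\<bar>"
        by (rule always_eventually) (auto simp: max_def power2_eq_square)
    qed (auto intro!: tendsto_eq_intros)
    then show ?thesis using 2 by (simp add: DERIV_def)
  next
    case 3
    have "((\<lambda>s::real. s\<^sup>2) has_real_derivative 2 * s) (at s)"
      by (auto intro!: derivative_eq_intros)
    then have "((\<lambda>s::real. (max 0 s)\<^sup>2) has_real_derivative 2 * s) (at s)"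
      by (rule has_field_derivative_transform_within_open[of _ _ _ "{0<..}"]) (use 3 in auto)
    then show ?thesis using 3 by simp
  qed
qed

text \<open>A \<open>C\<^sup>1\<close> step from 0 to 1 between the arguments 1 and 2: with \<open>q(s) = max(0, s)\<^sup>2\<close> it is
  \<open>q(s - 1) / (q(s - 1) + q(2 - s))\<close>, whose denominator is positive because the two arguments add
  up to 1. The derivative is continuous and supported in \<open>[1, 2]\<close>, hence bounded.\<close>

lemma C1_step_function:
  obtains h h' :: "real \<Rightarrow> real" and B where
    "\<And>s. (h has_real_derivative h' s) (at s)" "continuous_on UNIV h'"
    "\<And>s. 0 \<le> h s" "\<And>s. h s \<le> 1" "\<And>s. s \<le> 1 \<Longrightarrow> h s = 0" "\<And>s. 2 \<le> s \<Longrightarrow> h s = 1"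
    "\<And>s. 2 \<le> s \<Longrightarrow> h' s = 0" "\<And>s. \<bar>h' s\<bar> \<le> B"
proof -
  define p where "p s = max 0 (s::real)" for s
  define q where "q s = (p s)\<^sup>2" for s
  define h where "h s = q (s - 1) / (q (s - 1) + q (2 - s))" for s
  define h' where "h' s = (2 * p (s - 1) * (q (s - 1) + q (2 - s))
      - q (s - 1) * (2 * p (s - 1) - 2 * p (2 - s))) / (q (s - 1) + q (2 - s))\<^sup>2" for s
  have dq: "(q has_real_derivative 2 * p s) (at s)" for s
    unfolding q_def p_def by (rule truncated_square_deriv)
  have pos: "0 < q (s - 1) + q (2 - s)" for s
  proof (cases "1 < s")
    case True
    then have "0 < q (s - 1)" by (simp add: q_def p_def)
    then show ?thesis by (simp add: q_def add_pos_nonneg)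
  next
    case False
    then have "0 < q (2 - s)" by (simp add: q_def p_def)
    then show ?thesis by (simp add: q_def add_nonneg_pos)
  qed
  have d: "(h has_real_derivative h' s) (at s)" for s
  proof -
    have "((\<lambda>s. q (s - 1)) has_real_derivative 2 * p (s - 1)) (at s)"
      using DERIV_shift[of q "2 * p (s - 1)" s "-1"] dq[of "s - 1"] by simp
    moreover have "((\<lambda>s. q (2 - s)) has_real_derivative 2 * p (2 - s) * (- 1)) (at s)"
      by (rule DERIV_chain2[OF dq]) (auto intro!: derivative_eq_intros)
    ultimately show ?thesis
      unfolding h_def[abs_def] h'_def using pos[of s]
      by (auto intro!: derivative_eq_intros simp: power2_eq_square)
  qed
  have cp: "continuous_on S p" for S unfolding p_def by (intro continuous_intros)
  have npz: "p (s - 1) \<noteq> 0 \<or> p (2 - s) \<noteq> 0" for s by (auto simp: p_def max_def)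
  have c: "continuous_on UNIV h'"
    unfolding h'_def q_def
    by (intro continuous_intros continuous_on_compose2[OF cp])
       (use npz in auto)
  have z: "h' s = 0" if "s \<le> 1 \<or> 2 \<le> s" for s
    using that by (auto simp: h'_def q_def p_def)
  have "bounded (h' ` {1..2})"
    by (intro compact_imp_bounded compact_continuous_image) (use c continuous_on_subset in auto)
  then obtain B where "\<forall>y\<in>h' ` {1..2}. norm y \<le> B" unfolding bounded_iff by blast
  then have B: "\<bar>h' s\<bar> \<le> B" if "s \<in> {1..2}" for s using that by auto
  have "\<bar>h' s\<bar> \<le> max B 0" for s
    using B[of s] z[of s] by (cases "s \<in> {1..2}") auto
  moreover have "h s = 1" if "2 \<le> s" for s
    using that pos[of s] by (auto simp: h_def q_def p_def)
  moreover have "h s \<le> 1" "0 \<le> h s" for s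
    using pos[of s] by (auto simp: h_def q_def)
  moreover have "h s = 0" if "s \<le> 1" for s
    using that by (auto simp: h_def q_def p_def)
  ultimately show ?thesis using that[OF d c] z by blast
qed

lemma test_with_gradI:
  assumes "C1_with_grad \<phi> D" "compact K" "K \<subseteq> \<Omega>" "\<And>x. x \<notin> K \<Longrightarrow> \<phi> x = 0"
  shows "test_with_grad \<Omega> \<phi> D"
proof -
  have "closure {x. \<phi> x \<noteq> 0} \<subseteq> K"
    using assms(2,4) by (intro closure_minimal) (auto intro: compact_imp_closed)
  moreover from this have "compact (closure {x. \<phi> x \<noteq> 0})"
    using compact_Int_closed[OF assms(2) closed_closure, of "{x. \<phi> x \<noteq> 0}"]
    by (simp add: inf.absorb2)
  ultimately show ?thesis using assms by (auto simp: test_with_grad_def)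
qed

lemma test_with_gradE:
  assumes "test_with_grad \<Omega> \<phi> D"
  obtains K where "C1_with_grad \<phi> D" "compact K" "K \<subseteq> \<Omega>"
    "\<And>x. x \<notin> K \<Longrightarrow> \<phi> x = 0" "\<And>x. x \<notin> K \<Longrightarrow> D x = 0"
proof -
  define K where "K = closure {x. \<phi> x \<noteq> 0}"
  have K: "C1_with_grad \<phi> D" "compact K" "K \<subseteq> \<Omega>"
    using assms by (simp_all add: test_with_grad_def K_def)
  have zero: "\<phi> x = 0" if "x \<notin> K" for x
    using that closure_subset[of "{x. \<phi> x \<noteq> 0}"] unfolding K_def by blast
  have "D x = 0" if "x \<notin> K" for x
  proof (rule C1_grad_eq_0[OF K(1)])
    show "open (- K)" by (simp add: K_def open_Compl)
  qed (use that zero in auto)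
  then show ?thesis using that[OF K zero] by simp
qed

lemma test_add:
  assumes "test_with_grad \<Omega> \<phi> D" "test_with_grad \<Omega> \<psi> E"
  shows "test_with_grad \<Omega> (\<lambda>x. \<phi> x + \<psi> x) (\<lambda>x. D x + E x)"
proof -
  obtain K where K: "C1_with_grad \<phi> D" "compact K" "K \<subseteq> \<Omega>"
    "\<And>x. x \<notin> K \<Longrightarrow> \<phi> x = 0" "\<And>x. x \<notin> K \<Longrightarrow> D x = 0"
    by (rule test_with_gradE[OF assms(1)]) (rule that)
  obtain K' where K': "C1_with_grad \<psi> E" "compact K'" "K' \<subseteq> \<Omega>"
    "\<And>x. x \<notin> K' \<Longrightarrow> \<psi> x = 0" "\<And>x. x \<notin> K' \<Longrightarrow> E x = 0"
    by (rule test_with_gradE[OF assms(2)]) (rule that)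
  show ?thesis
    by (rule test_with_gradI[of _ _ "K \<union> K'"]) (use K K' C1_add[OF K(1) K'(1)] in auto)
qed

lemma test_mult:
  assumes "C1_with_grad \<phi> D" "test_with_grad \<Omega> \<psi> E"
  shows "test_with_grad \<Omega> (\<lambda>x. \<phi> x * \<psi> x) (\<lambda>x. \<phi> x *\<^sub>R E x + \<psi> x *\<^sub>R D x)"
proof -
  obtain K where "C1_with_grad \<psi> E" "compact K" "K \<subseteq> \<Omega>"
    "\<And>x. x \<notin> K \<Longrightarrow> \<psi> x = 0" "\<And>x. x \<notin> K \<Longrightarrow> E x = 0"
    by (rule test_with_gradE[OF assms(2)]) (rule that)
  then show ?thesis
    by (intro test_with_gradI[of _ _ K] C1_mult[OF assms(1)]) simp_all
qed

text \<open>Finitely many balls with closures in \<open>V\<close> cover \<open>K\<close>. The sum of the bumps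
  \<open>max(0, r\<^sup>2 - \<bar>x - c\<bar>\<^sup>2)\<^sup>2\<close> over these balls is bounded below by some \<open>m > 0\<close> on \<open>K\<close>, and a step function
  applied to \<open>2/m\<close> times this sum is 1 on \<open>K\<close>.\<close>

lemma C1_Urysohn:
  fixes K :: "(real^3) set"
  assumes "compact K" "open V" "K \<subseteq> V"
  obtains \<phi> D where "test_with_grad V \<phi> D" "\<And>x. x \<in> K \<Longrightarrow> \<phi> x = 1"
    "\<And>x. 0 \<le> \<phi> x" "\<And>x. \<phi> x \<le> 1"
proof -
  obtain h h' :: "real \<Rightarrow> real" and B where h:
    "\<And>s. (h has_real_derivative h' s) (at s)" "continuous_on UNIV h'"
    "\<And>s. 0 \<le> h s" "\<And>s. h s \<le> 1" "\<And>s. s \<le> 1 \<Longrightarrow> h s = 0" "\<And>s. 2 \<le> s \<Longrightarrow> h s = 1"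
    "\<And>s. 2 \<le> s \<Longrightarrow> h' s = 0" "\<And>s. \<bar>h' s\<bar> \<le> B"
    by (rule C1_step_function) (rule that)
  have "\<forall>c\<in>K. \<exists>r>0. cball c r \<subseteq> V"
    using assms by (meson open_contains_cball subsetD)
  then obtain r where r: "\<And>c. c \<in> K \<Longrightarrow> 0 < r c \<and> cball c (r c) \<subseteq> V" by metis
  have "K \<subseteq> (\<Union>c\<in>K. ball c (r c))" using r by force
  then obtain J where J: "J \<subseteq> K" "finite J" "K \<subseteq> (\<Union>c\<in>J. ball c (r c))"
    using compactE_image[OF assms(1), of K "\<lambda>c. ball c (r c)"] by auto
  define bump where "bump c x = (max 0 ((r c)\<^sup>2 - (x - c) \<bullet> (x - c)))\<^sup>2" for c x
  define \<theta> where "\<theta> x = (\<Sum>c\<in>J. bump c x)" for x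
  have bump_nonneg: "0 \<le> bump c x" for c x by (simp add: bump_def)
  have bump0: "bump c x = 0" if "c \<in> K" "x \<notin> cball c (r c)" for c x
  proof -
    have "r c < dist c x" "0 < r c" using that r by auto
    then have "(r c)\<^sup>2 < (dist c x)\<^sup>2" by (intro power_strict_mono) auto
    then show ?thesis
      by (simp add: bump_def dist_norm norm_minus_commute[of c x] power2_norm_eq_inner)
  qed
  have bump_pos: "0 < bump c x" if "c \<in> K" "x \<in> ball c (r c)" for c x
  proof -
    have "dist c x < r c" using that by auto
    then have "(dist c x)\<^sup>2 < (r c)\<^sup>2" by (intro power_strict_mono) auto
    then show ?thesis
      by (simp add: bump_def dist_norm norm_minus_commute[of c x] power2_norm_eq_inner)
  qed
  have "C1_with_grad (\<lambda>x. (r c)\<^sup>2 - (x - c) \<bullet> (x - c)) (\<lambda>x. - 2 *\<^sub>R (x - c))" for c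
  proof (rule C1_with_gradI)
    show "((\<lambda>x. (r c)\<^sup>2 - (x - c) \<bullet> (x - c)) has_derivative (\<lambda>h. h \<bullet> (- 2 *\<^sub>R (x - c)))) (at x)" for x
      by (auto intro!: derivative_eq_intros simp: inner_commute)
  qed (intro continuous_intros)
  then have C1_bump: "C1_with_grad (bump c)
      (\<lambda>x. (2 * max 0 ((r c)\<^sup>2 - (x - c) \<bullet> (x - c))) *\<^sub>R (- 2 *\<^sub>R (x - c)))" for c
    unfolding bump_def
    by (rule C1_compose[OF truncated_square_deriv, rotated]) (intro continuous_intros)
  define D where
    "D x = (\<Sum>c\<in>J. (2 * max 0 ((r c)\<^sup>2 - (x - c) \<bullet> (x - c))) *\<^sub>R (- 2 *\<^sub>R (x - c)))" for x
  have D: "C1_with_grad \<theta> D"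
    unfolding \<theta>_def[abs_def] D_def[abs_def] by (rule C1_sum[OF J(2) C1_bump])
  have \<theta>0: "\<theta> x = 0" if "x \<notin> (\<Union>c\<in>J. cball c (r c))" for x
    unfolding \<theta>_def using that J(1) by (intro sum.neutral) (auto intro!: bump0)
  have \<theta>_pos: "0 < \<theta> x" if x: "x \<in> K" for x
  proof -
    obtain c where c: "c \<in> J" "x \<in> ball c (r c)" using J(3) x by blast
    then have "0 < bump c x" using J(1) bump_pos by blast
    then show ?thesis
      unfolding \<theta>_def by (rule sum_pos2[OF J(2) c(1)]) (rule bump_nonneg)
  qed
  obtain m where m: "0 < m" "\<And>x. x \<in> K \<Longrightarrow> m \<le> \<theta> x"
  proof (cases "K = {}")
    case True
    show ?thesis by (rule that[of 1]) (simp_all add: True)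
  next
    case False
    then obtain x where "x \<in> K" "\<forall>y\<in>K. \<theta> x \<le> \<theta> y"
      using continuous_attains_inf[OF assms(1) False C1_with_grad_D(3)[OF D]] by blast
    then show ?thesis by (intro that[of "\<theta> x"] \<theta>_pos) simp_all
  qed
  define \<phi> where "\<phi> x = h (2 / m * \<theta> x)" for x
  have "C1_with_grad \<phi> (\<lambda>x. h' (2 / m * \<theta> x) *\<^sub>R ((2 / m) *\<^sub>R D x))"
    unfolding \<phi>_def by (rule C1_compose[OF h(1,2) C1_cmult[OF D]])
  then have "test_with_grad V \<phi> (\<lambda>x. h' (2 / m * \<theta> x) *\<^sub>R ((2 / m) *\<^sub>R D x))"
  proof (rule test_with_gradI[where K = "\<Union>c\<in>J. cball c (r c)"])
    show "compact (\<Union>c\<in>J. cball c (r c))"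
      by (intro compact_UN J(2) compact_cball)
    show "(\<Union>c\<in>J. cball c (r c)) \<subseteq> V" using J(1) r by blast
    show "\<phi> x = 0" if "x \<notin> (\<Union>c\<in>J. cball c (r c))" for x
    proof -
      have "2 / m * \<theta> x \<le> 1" unfolding \<theta>0[OF that] by simp
      then show ?thesis unfolding \<phi>_def by (rule h(5))
    qed
  qed
  moreover have "\<phi> x = 1" if "x \<in> K" for x
  proof -
    have "2 / m * m \<le> 2 / m * \<theta> x" by (rule mult_left_mono[OF m(2)[OF that]]) (use m(1) in simp)
    then have "2 \<le> 2 / m * \<theta> x" using m(1) by simp
    then show ?thesis unfolding \<phi>_def by (rule h(6))
  qed
  moreover have "0 \<le> \<phi> x" for x unfolding \<phi>_def by (rule h(3))
  moreover have "\<phi> x \<le> 1" for x unfolding \<phi>_def by (rule h(4))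
  ultimately show ?thesis by (rule that)
qed

lemma compact_support_integrable:
  fixes f :: "real^3 \<Rightarrow> 'b::euclidean_space"
  assumes "compact K" "continuous_on UNIV f" "\<And>x. x \<notin> K \<Longrightarrow> f x = 0"
  shows "integrable lborel f"
proof -
  have "integrable lborel (\<lambda>x. indicator K x *\<^sub>R f x)"
    by (rule borel_integrable_compact[OF assms(1)]) (use assms(2) continuous_on_subset in auto)
  also have "(\<lambda>x. indicator K x *\<^sub>R f x) = f"
    using assms(3) by (auto simp: indicator_def)
  finally show ?thesis .
qed

lemma lborel_integral_shift:
  fixes f :: "real^3 \<Rightarrow> 'b::euclidean_space"
  assumes "f \<in> borel_measurable borel"
  shows "(\<integral>x. f (x + v) \<partial>lborel) = (\<integral>x. f x \<partial>lborel)"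
proof -
  have "(\<integral>x. f x \<partial>lborel) = (\<integral>x. f x \<partial>distr lborel borel ((+) v))"
    by (simp add: lborel_distr_plus)
  also have "\<dots> = (\<integral>x. f (v + x) \<partial>lborel)"
    using assms by (intro integral_distr) auto
  finally show ?thesis by (simp add: add.commute)
qed

text \<open>By translation invariance every difference quotient of \<open>\<psi>\<close> has integral zero, and the quotients
  converge boundedly to the directional derivative. This is the only form of the divergence theorem
  that is used for weak derivatives; boundary terms never occur.\<close>

lemma integral_grad_eq_0:
  assumes "test_with_grad UNIV \<psi> D"
  shows "(\<integral>x. D x \<partial>lborel) = 0"
proof -
  obtain K where C1: "C1_with_grad \<psi> D" and K: "compact K" "K \<subseteq> UNIV"
    "\<And>x. x \<notin> K \<Longrightarrow> \<psi> x = 0" "\<And>x. x \<notin> K \<Longrightarrow> D x = 0"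
    by (rule test_with_gradE[OF assms]) (rule that)
  note c = C1_with_grad_D[OF C1]
  have intD: "integrable lborel D" and int\<psi>: "integrable lborel \<psi>"
    by (rule compact_support_integrable[OF K(1)], rule c, rule K, assumption)+
  have "bounded K" using K(1) by (rule compact_imp_bounded)
  then obtain R where R: "K \<subseteq> cball 0 R" unfolding bounded_iff by (auto simp: subset_iff)
  obtain M where M: "\<And>x. norm (D x) \<le> M" "0 \<le> M"
  proof -
    have "bounded (D ` K)" by (intro compact_imp_bounded compact_continuous_image c K)
    then obtain M where M: "\<forall>y\<in>D ` K. norm y \<le> M" unfolding bounded_iff by blast
    have "norm (D x) \<le> max M 0" for x
      using M K(4)[of x] by (cases "x \<in> K") (auto intro: max.coboundedI1)
    then show ?thesis by (rule that) simp
  qed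
  have "(\<integral>x. v \<bullet> D x \<partial>lborel) = 0" for v
  proof -
    define t where "t n = inverse (real (Suc n))" for n
    have t: "0 < t n" "t n \<le> 1" for n by (auto simp: t_def field_simps)
    define F where "F n x = (\<psi> (x + t n *\<^sub>R v) - \<psi> x) / t n" for n x
    have F0: "(\<integral>x. F n x \<partial>lborel) = 0" for n
    proof -
      have "integrable lborel (\<lambda>x. \<psi> (x + t n *\<^sub>R v))"
      proof (rule compact_support_integrable[where K = "(\<lambda>x. x - t n *\<^sub>R v) ` K"])
        show "compact ((\<lambda>x. x - t n *\<^sub>R v) ` K)"
          by (intro compact_continuous_image continuous_intros K)
        show "continuous_on UNIV (\<lambda>x. \<psi> (x + t n *\<^sub>R v))"
          by (intro continuous_on_compose2[OF c(3)[of UNIV]] continuous_intros) auto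
        show "\<psi> (x + t n *\<^sub>R v) = 0" if "x \<notin> (\<lambda>x. x - t n *\<^sub>R v) ` K" for x
          using that by (intro K) (auto simp: image_iff algebra_simps)
      qed
      then show ?thesis
        using lborel_integral_shift[OF c(4), of "t n *\<^sub>R v"] int\<psi> by (simp add: F_def)
    qed
    have "(\<lambda>n. \<integral>x. F n x \<partial>lborel) \<longlonglongrightarrow> (\<integral>x. v \<bullet> D x \<partial>lborel)"
    proof (rule integral_dominated_convergence)
      show "(\<lambda>x. v \<bullet> D x) \<in> borel_measurable lborel" using c(5) by simp
      have [measurable]: "\<psi> \<in> borel_measurable borel" by (rule c(4))
      show "F n \<in> borel_measurable lborel" for n unfolding F_def by simp
      \<comment> \<open>The steps \<open>t n\<close> are at most 1, so all quotients live in one fixed ball, where they are bounded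
        by the mean value inequality.\<close>
      show "integrable lborel (\<lambda>x. indicator (cball 0 (R + norm v)) x *\<^sub>R (M * norm v))"
        by (rule borel_integrable_compact) auto
      show "AE x in lborel. (\<lambda>n. F n x) \<longlonglongrightarrow> v \<bullet> D x"
      proof (rule AE_I2)
        fix x
        have "((\<lambda>s. x + s *\<^sub>R v) has_derivative (\<lambda>s. s *\<^sub>R v)) (at 0)"
          by (auto intro!: derivative_eq_intros)
        moreover have "(\<psi> has_derivative (\<lambda>h. h \<bullet> D x)) (at (x + 0 *\<^sub>R v))"
          using c(1)[of x UNIV] by simp
        ultimately have "((\<lambda>s. \<psi> (x + s *\<^sub>R v)) has_derivative (\<lambda>s. (s *\<^sub>R v) \<bullet> D x)) (at 0)"
          by (rule has_derivative_compose)
        then have "((\<lambda>s. \<psi> (x + s *\<^sub>R v)) has_real_derivative v \<bullet> D x) (at 0)"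
          by (simp add: has_field_derivative_def mult_commute_abs)
        then have "(\<lambda>s. (\<psi> (x + s *\<^sub>R v) - \<psi> x) / s) \<midarrow>0\<rightarrow> v \<bullet> D x"
          by (simp add: DERIV_def)
        moreover have "filterlim t (at 0) sequentially"
          unfolding filterlim_at using LIMSEQ_inverse_real_of_nat t(1)
          by (auto simp: t_def[abs_def] simp del: of_nat_Suc)
        ultimately show "(\<lambda>n. F n x) \<longlonglongrightarrow> v \<bullet> D x"
          unfolding F_def by (rule filterlim_compose)
      qed
      show "AE x in lborel. norm (F n x) \<le> indicator (cball 0 (R + norm v)) x *\<^sub>R (M * norm v)" for n
      proof (rule AE_I2)
        fix x
        show "norm (F n x) \<le> indicator (cball 0 (R + norm v)) x *\<^sub>R (M * norm v)"
        proof (cases "x \<in> cball 0 (R + norm v)")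
          case True
          have "norm (\<psi> (x + t n *\<^sub>R v) - \<psi> x) \<le> M * norm ((x + t n *\<^sub>R v) - x)"
          proof (rule differentiable_bound[OF convex_UNIV])
            show "(\<psi> has_derivative (\<lambda>h. h \<bullet> D y)) (at y within UNIV)" for y by (rule c)
            show "onorm (\<lambda>h. h \<bullet> D y) \<le> M" for y
            proof (rule onorm_le)
              fix h
              have "norm (h \<bullet> D y) \<le> norm h * norm (D y)" by (simp add: Cauchy_Schwarz_ineq2)
              also have "\<dots> \<le> norm h * M" by (intro mult_left_mono M) auto
              finally show "norm (h \<bullet> D y) \<le> M * norm h" by (simp add: mult.commute)
            qed
          qed auto
          then show ?thesis using True t[of n] by (simp add: F_def field_simps)
        next
          case False
          have "norm (t n *\<^sub>R v) \<le> norm v" using t[of n] by (auto intro: mult_left_le_one_le)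
          then have "norm x \<le> norm (x + t n *\<^sub>R v) + norm v"
            using norm_triangle_ineq4[of "x + t n *\<^sub>R v" "t n *\<^sub>R v"] by simp
          then have "\<not> norm (x + t n *\<^sub>R v) \<le> R" using False by simp
          then have "x + t n *\<^sub>R v \<notin> K" using R by auto
          moreover have "x \<notin> K"
          proof
            assume "x \<in> K"
            then have "norm x \<le> R" using R by auto
            also have "R \<le> R + norm v" by simp
            finally show False using False by simp
          qed
          ultimately show ?thesis using False K(3) by (simp add: F_def)
        qed
      qed
    qed
    then show ?thesis by (simp add: F0 LIMSEQ_const_iff)
  qed
  then have "v \<bullet> (\<integral>x. D x \<partial>lborel) = 0" for v
    using integral_inner_right[OF intD, of v] by simp
  then show ?thesis by (metis inner_eq_zero_iff)
qed

lemma lebesgue_on_integral_supported: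
  fixes f :: "real^3 \<Rightarrow> 'b::euclidean_space"
  assumes "open \<Omega>" "f \<in> borel_measurable borel" "\<And>x. x \<notin> \<Omega> \<Longrightarrow> f x = 0"
  shows "(\<integral>x. f x \<partial>lebesgue_on \<Omega>) = (\<integral>x. f x \<partial>lborel)"
proof -
  have "(\<integral>x. f x \<partial>lebesgue_on \<Omega>) = (\<integral>x. indicator \<Omega> x *\<^sub>R f x \<partial>lebesgue)"
    using assms(1) by (subst integral_restrict_space) auto
  also have "(\<lambda>x. indicator \<Omega> x *\<^sub>R f x) = f"
    using assms(3) by (auto simp: indicator_def)
  also have "(\<integral>x. f x \<partial>lebesgue) = (\<integral>x. f x \<partial>lborel)"
    using assms(2) by (intro integral_completion) simp
  finally show ?thesis .
qed

section \<open>Weak gradients on bounded open sets\<close>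

locale bounded_open =
  fixes \<Omega> :: "(real^3) set"
  assumes open_\<Omega>: "open \<Omega>" and bounded_\<Omega>: "bounded \<Omega>"
begin

abbreviation dx :: "(real^3) measure" where "dx \<equiv> lebesgue_on \<Omega>"
abbreviation dS :: "(real^3) measure" where "dS \<equiv> surface \<Omega>"
abbreviation grad :: "(real^3 \<Rightarrow> real) \<Rightarrow> real^3 \<Rightarrow> real^3" where "grad \<equiv> weak_grad \<Omega>"

lemma \<Omega>_lebesgue [simp]: "\<Omega> \<in> sets lebesgue"
  using open_\<Omega> by auto

lemma space_lebesgue_on_\<Omega>: "x \<in> space dx \<Longrightarrow> x \<in> \<Omega>"
  by (simp add: space_restrict_space)

lemma L2_norm_mono_dx:
  fixes f :: "real^3 \<Rightarrow> 'b::euclidean_space" and g :: "real^3 \<Rightarrow> 'c::euclidean_space"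
  assumes "f \<in> L2 dx" "g \<in> L2 dx" "\<And>x. x \<in> \<Omega> \<Longrightarrow> norm (f x) \<le> K * norm (g x)" "0 \<le> K"
  shows "L2_norm dx f \<le> K * L2_norm dx g"
  by (rule L2_norm_mono_AE[OF assms(1,2) _ assms(4)])
     (use assms(3) in \<open>auto intro: AE_I2 space_lebesgue_on_\<Omega>\<close>)

lemma finite_lebesgue_on: "finite_measure dx"
proof
  show "emeasure dx (space dx) \<noteq> \<infinity>"
    using emeasure_bounded_finite[OF bounded_\<Omega>] open_\<Omega>
    by (simp add: emeasure_restrict_space space_restrict_space)
qed

lemma borel_measurable_lebesgue_on:
  "f \<in> borel_measurable borel \<Longrightarrow> f \<in> borel_measurable dx"
  by (intro measurable_restrict_space1 measurable_completion) simp

lemma L2_continuous: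
  fixes f :: "real^3 \<Rightarrow> 'b::euclidean_space"
  assumes "continuous_on UNIV f"
  shows "f \<in> L2 dx"
proof -
  have "bounded (f ` closure \<Omega>)"
    using assms bounded_\<Omega> continuous_on_subset
    by (intro compact_imp_bounded compact_continuous_image) auto
  then obtain B where B: "\<forall>y\<in>f ` closure \<Omega>. norm y \<le> B" unfolding bounded_iff by blast
  show ?thesis
  proof (rule L2_bounded[OF finite_lebesgue_on])
    show "f \<in> borel_measurable dx"
      using assms by (intro borel_measurable_lebesgue_on borel_measurable_continuous_onI)
    show "norm (f x) \<le> B" if "x \<in> space dx" for x
      using B that closure_subset by (auto simp: space_restrict_space)
  qed
qed

lemma C1_L2:
  assumes "C1_with_grad \<phi> D"
  shows "\<phi> \<in> L2 dx" "D \<in> L2 dx"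
  using C1_with_grad_D[OF assms] by (auto intro: L2_continuous)

lemma L2_imp_integrable:
  assumes "g \<in> L2 dx"
  shows "integrable dx g"
  using L2_integrable_scaleR[OF L2_continuous[of "\<lambda>_. 1::real"] assms] by simp

text \<open>Urysohn functions for an exhaustion of \<open>V\<close> by compact sets converge to the indicator of \<open>V\<close>.\<close>

lemma test_integral_0_open:
  fixes g :: "real^3 \<Rightarrow> 'b::euclidean_space"
  assumes "g \<in> L2 dx"
    "\<And>\<phi> D. test_with_grad \<Omega> \<phi> D \<Longrightarrow> (\<integral>x. \<phi> x *\<^sub>R g x \<partial>dx) = 0"
    "open V" "V \<subseteq> \<Omega>"
  shows "set_lebesgue_integral dx V g = 0"
proof -
  obtain C where C: "\<And>n. compact (C n)" "\<And>n. C n \<subseteq> V"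
    "\<And>n. C n \<subseteq> interior (C (Suc n))" "\<Union> (range C) = V"
    "\<And>K. compact K \<Longrightarrow> K \<subseteq> V \<Longrightarrow> \<exists>N. \<forall>n\<ge>N. K \<subseteq> C n"
    by (rule open_Union_compact_subsets[OF assms(3)]) (rule that)
  have "\<forall>n. \<exists>\<phi> D. test_with_grad V \<phi> D \<and> (\<forall>x\<in>C n. \<phi> x = 1) \<and> (\<forall>x. 0 \<le> \<phi> x \<and> \<phi> x \<le> 1)"
    using C1_Urysohn[OF C(1) assms(3) C(2)] by metis
  then obtain \<phi> D where \<phi>: "\<And>n. test_with_grad V (\<phi> n) (D n)"
    "\<And>n x. x \<in> C n \<Longrightarrow> \<phi> n x = 1" "\<And>n x. 0 \<le> \<phi> n x \<and> \<phi> n x \<le> 1"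
    by metis
  have test: "test_with_grad \<Omega> (\<phi> n) (D n)" for n
    using \<phi>(1)[of n] assms(4) by (auto simp: test_with_grad_def)
  have "(\<lambda>n. \<integral>x. \<phi> n x *\<^sub>R g x \<partial>dx) \<longlonglongrightarrow> (\<integral>x. indicator V x *\<^sub>R g x \<partial>dx)"
  proof (rule integral_dominated_convergence)
    have mg: "g \<in> borel_measurable dx" using assms(1) by (simp add: L2_def)
    show "(\<lambda>x. indicator V x *\<^sub>R g x) \<in> borel_measurable dx"
      by (intro borel_measurable_scaleR mg borel_measurable_lebesgue_on borel_measurable_indicator)
         (use assms(3) in simp)
    show "(\<lambda>x. \<phi> n x *\<^sub>R g x) \<in> borel_measurable dx" for n
      by (intro borel_measurable_scaleR mg borel_measurable_lebesgue_on)
         (use test[of n] C1_with_grad_D(4) in \<open>auto simp: test_with_grad_def\<close>)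
    show "integrable dx (\<lambda>x. norm (g x))"
      using L2_imp_integrable[OF assms(1)] by simp
    show "AE x in dx. norm (\<phi> n x *\<^sub>R g x) \<le> norm (g x)" for n
      using \<phi>(3)[of n] by (auto intro!: AE_I2 mult_left_le_one_le)
    show "AE x in dx. (\<lambda>n. \<phi> n x *\<^sub>R g x) \<longlonglongrightarrow> indicator V x *\<^sub>R g x"
    proof (intro AE_I2 tendsto_scaleR tendsto_const)
      fix x
      show "(\<lambda>n. \<phi> n x) \<longlonglongrightarrow> indicator V x"
      proof (cases "x \<in> V")
        case True
        then obtain N where "\<forall>n\<ge>N. {x} \<subseteq> C n" using C(5)[of "{x}"] by auto
        then have "\<forall>\<^sub>F n in sequentially. \<phi> n x = 1"
          unfolding eventually_sequentially using \<phi>(2) by blast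
        then show ?thesis using True by (simp add: tendsto_eventually)
      next
        case False
        have "\<phi> n x = 0" for n
          by (rule test_with_gradE[OF \<phi>(1)[of n]]) (use False in blast)
        then show ?thesis using False by simp
      qed
    qed
  qed
  then show ?thesis
    using assms(2)[OF test] by (simp add: LIMSEQ_const_iff set_lebesgue_integral_def)
qed

text \<open>The fundamental lemma of the calculus of variations. It makes weak gradients and weak divergences
  unique almost everywhere, so that the arbitrary representatives picked by the definitions
  of \<open>weak_grad\<close> and \<open>weak_div\<close> do not matter. The integral of \<open>g\<close> vanishes over open
  sets, therefore over Borel sets by a Dynkin argument, therefore over Lebesgue sets.\<close>

lemma test_integral_0_imp_AE_0:
  fixes g :: "real^3 \<Rightarrow> 'b::euclidean_space"
  assumes g: "g \<in> L2 dx"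
    and test: "\<And>\<phi> D. test_with_grad \<Omega> \<phi> D \<Longrightarrow> (\<integral>x. \<phi> x *\<^sub>R g x \<partial>dx) = 0"
  shows "AE x in dx. g x = 0"
proof -
  have int: "integrable dx g" using L2_imp_integrable[OF g] .
  have sets: "B \<inter> \<Omega> \<in> sets dx" if "B \<in> sets borel" for B
    using that open_\<Omega> by (auto simp: sets_restrict_space_iff)
  have si: "set_integrable dx (B \<inter> \<Omega>) g" if "B \<in> sets borel" for B
    unfolding set_integrable_def using sets[OF that] int
    by (rule integrable_mult_indicator)
  have borel: "set_lebesgue_integral dx (B \<inter> \<Omega>) g = 0" if B: "B \<in> sets borel" for B
  proof -
    have "Int_stable {S::(real^3) set. open S}" "{S::(real^3) set. open S} \<subseteq> Pow UNIV"
      "B \<in> sigma_sets UNIV {S. open S}"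
      using B by (auto simp: sets_borel Int_stable_def)
    then show ?thesis
    proof (induction rule: sigma_sets_induct_disjoint)
      fix A :: "(real^3) set" assume "A \<in> {S. open S}"
      then show "set_lebesgue_integral dx (A \<inter> \<Omega>) g = 0"
        using open_\<Omega> by (intro test_integral_0_open[OF g test]) auto
    next
      fix A :: "(real^3) set"
      assume A: "A \<in> sigma_sets UNIV {S. open S}" and IH: "set_lebesgue_integral dx (A \<inter> \<Omega>) g = 0"
      have A': "A \<in> sets borel" "UNIV - A \<in> sets borel"
        using A by (auto simp: sets_borel intro: sigma_sets.Compl)
      have "set_lebesgue_integral dx ((A \<inter> \<Omega>) \<union> ((UNIV - A) \<inter> \<Omega>)) g
          = set_lebesgue_integral dx (A \<inter> \<Omega>) g + set_lebesgue_integral dx ((UNIV - A) \<inter> \<Omega>) g"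
        by (rule set_integral_Un[OF _ si[OF A'(1)] si[OF A'(2)]]) auto
      moreover have "(A \<inter> \<Omega>) \<union> ((UNIV - A) \<inter> \<Omega>) = \<Omega>" by auto
      ultimately show "set_lebesgue_integral dx ((UNIV - A) \<inter> \<Omega>) g = 0"
        using IH test_integral_0_open[OF g test open_\<Omega>] by simp
    next
      fix A :: "nat \<Rightarrow> (real^3) set"
      assume disj: "disjoint_family A" and A: "range A \<subseteq> sigma_sets UNIV {S. open S}"
        and IH: "\<And>i. set_lebesgue_integral dx (A i \<inter> \<Omega>) g = 0"
      have A': "A i \<in> sets borel" for i using A by (auto simp: sets_borel)
      have "set_lebesgue_integral dx (\<Union>i. A i \<inter> \<Omega>) g
          = (\<Sum>i. set_lebesgue_integral dx (A i \<inter> \<Omega>) g)"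
      proof (rule lebesgue_integral_countable_add)
        show "A i \<inter> \<Omega> \<in> sets dx" for i by (rule sets[OF A'])
        show "(A i \<inter> \<Omega>) \<inter> (A j \<inter> \<Omega>) = {}" if "i \<noteq> j" for i j
          using disj that by (auto simp: disjoint_family_on_def)
        show "set_integrable dx (\<Union>i. A i \<inter> \<Omega>) g"
          using si[of "\<Union>i. A i"] A' by auto
      qed
      then show "set_lebesgue_integral dx (\<Union> (range A) \<inter> \<Omega>) g = 0"
        using IH by simp
    qed (simp add: set_lebesgue_integral_def)
  qed
  interpret finite_measure dx by (rule finite_lebesgue_on)
  show ?thesis
  proof (rule density_zero[OF int])
    fix A assume "A \<in> sets dx"
    then have A: "A \<in> sets lebesgue" "A \<subseteq> \<Omega>" by (auto simp: sets_restrict_space_iff)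
    obtain S N N' where S: "A = S \<union> N" "N \<subseteq> N'" "N' \<in> null_sets lborel" "S \<in> sets lborel"
      using A(1) by (rule sets_completionE)
    have "S \<inter> \<Omega> = S" using S A by auto
    then have 0: "set_lebesgue_integral dx S g = 0" and Sm: "S \<in> sets dx"
      using borel[of S] sets[of S] S(4) by auto
    have "N' \<inter> \<Omega> \<in> null_sets dx"
    proof -
      have "N' \<inter> \<Omega> \<in> null_sets lebesgue"
        by (rule null_set_Int2) (use S(3) in \<open>auto intro: null_sets_completionI\<close>)
      then show ?thesis by (subst null_sets_restrict_space) auto
    qed
    then have ae: "AE x in dx. x \<notin> N'"
      by (rule AE_I') (auto simp: space_restrict_space)
    have "set_lebesgue_integral dx A g = set_lebesgue_integral dx S g"
      unfolding set_lebesgue_integral_def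
    proof (rule integral_cong_AE)
      show "(\<lambda>x. indicator A x *\<^sub>R g x) \<in> borel_measurable dx"
        "(\<lambda>x. indicator S x *\<^sub>R g x) \<in> borel_measurable dx"
        using \<open>A \<in> sets dx\<close> Sm int by measurable
      show "AE x in dx. indicator A x *\<^sub>R g x = indicator S x *\<^sub>R g x"
        using ae by eventually_elim (use S(1,2) in \<open>auto simp: indicator_def\<close>)
    qed
    then show "set_lebesgue_integral dx A g = 0" using 0 by simp
  qed
qed

lemma is_weak_gradD:
  assumes "is_weak_grad \<Omega> w G" "test_with_grad \<Omega> \<phi> D"
  shows "(\<integral>x. w x *\<^sub>R D x \<partial>dx) = - (\<integral>x. \<phi> x *\<^sub>R G x \<partial>dx)"
  using assms by (simp add: is_weak_grad_def)

lemma is_weak_grad_unique: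
  assumes "is_weak_grad \<Omega> w G" "is_weak_grad \<Omega> w G'"
  shows "AE x in dx. G x = G' x"
proof -
  have G: "G \<in> L2 dx" "G' \<in> L2 dx"
    using assms by (auto simp: is_weak_grad_def)
  have "AE x in dx. G x - G' x = 0"
  proof (rule test_integral_0_imp_AE_0[OF L2_diff[OF G]])
    fix \<phi> D assume t: "test_with_grad \<Omega> \<phi> D"
    then have \<phi>: "\<phi> \<in> L2 dx" using C1_L2 by (auto simp: test_with_grad_def)
    have "(\<integral>x. \<phi> x *\<^sub>R G x \<partial>dx) = (\<integral>x. \<phi> x *\<^sub>R G' x \<partial>dx)"
      using is_weak_gradD[OF assms(1) t] is_weak_gradD[OF assms(2) t] by simp
    then show "(\<integral>x. \<phi> x *\<^sub>R (G x - G' x) \<partial>dx) = 0"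
      using L2_integrable_scaleR[OF \<phi> G(1)] L2_integrable_scaleR[OF \<phi> G(2)]
      by (simp add: scaleR_right_diff_distrib)
  qed
  then show ?thesis by simp
qed

lemma H1_D:
  assumes "w \<in> H1 \<Omega>"
  shows "w \<in> L2 dx" "is_weak_grad \<Omega> w (grad w)"
    "grad w \<in> L2 dx"
proof -
  show "w \<in> L2 dx" using assms by (simp add: H1_def)
  show 1: "is_weak_grad \<Omega> w (grad w)"
    using assms someI_ex[of "is_weak_grad \<Omega> w"] by (simp add: H1_def weak_grad_def)
  then show "grad w \<in> L2 dx" by (simp add: is_weak_grad_def)
qed

lemma H1_I:
  assumes "w \<in> L2 dx" "is_weak_grad \<Omega> w G"
  shows "w \<in> H1 \<Omega>" "AE x in dx. grad w x = G x"
proof -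
  show 1: "w \<in> H1 \<Omega>" using assms by (auto simp: H1_def)
  show "AE x in dx. grad w x = G x"
    by (rule is_weak_grad_unique[OF H1_D(2)[OF 1] assms(2)])
qed

lemma C1_is_weak_grad:
  assumes "C1_with_grad \<phi> D"
  shows "is_weak_grad \<Omega> \<phi> D"
  unfolding is_weak_grad_def
proof (intro conjI allI impI)
  show "D \<in> L2 dx" by (rule C1_L2[OF assms])
  fix \<theta> E assume t: "test_with_grad \<Omega> \<theta> E"
  obtain K where K: "C1_with_grad \<theta> E" "compact K" "K \<subseteq> \<Omega>"
    "\<And>x. x \<notin> K \<Longrightarrow> \<theta> x = 0" "\<And>x. x \<notin> K \<Longrightarrow> E x = 0"
    by (rule test_with_gradE[OF t]) (rule that)
  have "test_with_grad UNIV (\<lambda>x. \<phi> x * \<theta> x) (\<lambda>x. \<phi> x *\<^sub>R E x + \<theta> x *\<^sub>R D x)"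
    using test_mult[OF assms t] by (auto simp: test_with_grad_def)
  from integral_grad_eq_0[OF this]
  have 0: "(\<integral>x. \<phi> x *\<^sub>R E x + \<theta> x *\<^sub>R D x \<partial>lborel) = 0" .
  have "(\<integral>x. \<phi> x *\<^sub>R E x + \<theta> x *\<^sub>R D x \<partial>dx)
      = (\<integral>x. \<phi> x *\<^sub>R E x + \<theta> x *\<^sub>R D x \<partial>lborel)"
  proof (rule lebesgue_on_integral_supported[OF open_\<Omega>])
    show "(\<lambda>x. \<phi> x *\<^sub>R E x + \<theta> x *\<^sub>R D x) \<in> borel_measurable borel"
      using C1_with_grad_D(4,5)[OF assms] C1_with_grad_D(4,5)[OF K(1)] by measurable
    show "\<phi> x *\<^sub>R E x + \<theta> x *\<^sub>R D x = 0" if "x \<notin> \<Omega>" for x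
    proof -
      have "x \<notin> K" using that K(3) by blast
      then show ?thesis by (simp add: K(4,5))
    qed
  qed
  then show "(\<integral>x. \<phi> x *\<^sub>R E x \<partial>dx) = - (\<integral>x. \<theta> x *\<^sub>R D x \<partial>dx)"
    using 0 L2_integrable_scaleR[OF C1_L2(1)[OF assms] C1_L2(2)[OF K(1)]]
      L2_integrable_scaleR[OF C1_L2(1)[OF K(1)] C1_L2(2)[OF assms]]
    by (simp add: eq_neg_iff_add_eq_0)
qed

text \<open>For a unit vector \<open>e\<close>, integration by parts of \<open>\<phi>\<^sup>2\<close> against the function \<open>x \<bullet> e\<close>, which is at most
  \<open>R\<close> on \<open>\<Omega>\<close>, gives \<open>\<parallel>\<phi>\<parallel>\<^sup>2 = - 2 \<integral> (x \<bullet> e) \<phi> (D \<bullet> e) \<le> 2 R \<parallel>\<phi>\<parallel> \<parallel>D\<parallel>\<close>.\<close>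

lemma Poincare_test:
  assumes t: "test_with_grad \<Omega> \<phi> D" and R: "\<Omega> \<subseteq> cball 0 R" "0 \<le> R"
  shows "L2_norm dx \<phi> \<le> 2 * R * L2_norm dx D"
proof -
  obtain e :: "real^3" where e: "norm e = 1" using norm_axis_1 by blast
  obtain K where K: "C1_with_grad \<phi> D" "compact K" "K \<subseteq> \<Omega>"
    "\<And>x. x \<notin> K \<Longrightarrow> \<phi> x = 0" "\<And>x. x \<notin> K \<Longrightarrow> D x = 0"
    by (rule test_with_gradE[OF t]) (rule that)
  note L2\<phi> = C1_L2[OF K(1)]
  define E where "E x = \<phi> x *\<^sub>R D x + \<phi> x *\<^sub>R D x" for x
  have tE: "test_with_grad \<Omega> (\<lambda>x. \<phi> x * \<phi> x) E"
    unfolding E_def by (rule test_mult[OF K(1) t])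
  have "(\<integral>x. (x \<bullet> e) *\<^sub>R E x \<partial>dx) = - (\<integral>x. (\<phi> x * \<phi> x) *\<^sub>R e \<partial>dx)"
    by (rule is_weak_gradD[OF C1_is_weak_grad[OF C1_inner] tE])
  then have "(\<integral>x. (x \<bullet> e) *\<^sub>R E x \<partial>dx) \<bullet> e = - (\<integral>x. (\<phi> x * \<phi> x) *\<^sub>R e \<partial>dx) \<bullet> e" by simp
  moreover have "(\<integral>x. (\<phi> x * \<phi> x) *\<^sub>R e \<partial>dx) \<bullet> e = (L2_norm dx \<phi>)\<^sup>2"
  proof -
    have "(\<integral>x. \<phi> x * \<phi> x \<partial>dx) = (L2_norm dx \<phi>)\<^sup>2"
      unfolding L2_norm_sq by (simp add: power2_eq_square)
    then show ?thesis
      using e L2_D(2)[OF L2\<phi>(1)] by (simp add: power2_eq_square flip: power2_norm_eq_inner)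
  qed
  moreover have "(\<integral>x. (x \<bullet> e) *\<^sub>R E x \<partial>dx) \<bullet> e = (\<integral>x. (2 * (x \<bullet> e) * \<phi> x) *\<^sub>R D x \<partial>dx) \<bullet> e"
    by (simp add: E_def algebra_simps scaleR_2[symmetric])
  ultimately have "(L2_norm dx \<phi>)\<^sup>2 = - ((\<integral>x. (2 * (x \<bullet> e) * \<phi> x) *\<^sub>R D x \<partial>dx) \<bullet> e)"
    by simp
  also have "\<dots> \<le> norm (\<integral>x. (2 * (x \<bullet> e) * \<phi> x) *\<^sub>R D x \<partial>dx) * norm e"
    using Cauchy_Schwarz_ineq2[of "\<integral>x. (2 * (x \<bullet> e) * \<phi> x) *\<^sub>R D x \<partial>dx" e] by linarith
  also have "\<dots> \<le> L2_norm dx (\<lambda>x. 2 * (x \<bullet> e) * \<phi> x) * L2_norm dx D"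
  proof -
    have "(\<lambda>x. 2 * (x \<bullet> e) * \<phi> x) \<in> L2 dx"
      using C1_with_grad_D(3)[OF K(1)] by (intro L2_continuous continuous_intros)
    from L2_norm_integral_scaleR[OF this L2\<phi>(2)] show ?thesis using e by simp
  qed
  also have "\<dots> \<le> (2 * R * L2_norm dx \<phi>) * L2_norm dx D"
  proof (rule mult_right_mono)
    have le: "\<bar>x \<bullet> e\<bar> \<le> R" if "x \<in> \<Omega>" for x
      using Cauchy_Schwarz_ineq2[of x e] R(1) that e by fastforce
    show "L2_norm dx (\<lambda>x. 2 * (x \<bullet> e) * \<phi> x) \<le> 2 * R * L2_norm dx \<phi>"
    proof -
      have "(\<lambda>x. 2 * (x \<bullet> e) * \<phi> x) \<in> L2 dx"
        using C1_with_grad_D(3)[OF K(1)] by (intro L2_continuous continuous_intros)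
      then show ?thesis
      proof (rule L2_norm_mono_AE[OF _ L2\<phi>(1)])
        show "AE x in dx. norm (2 * (x \<bullet> e) * \<phi> x) \<le> 2 * R * norm (\<phi> x)"
        proof (rule AE_I2)
          fix x assume "x \<in> space dx"
          then show "norm (2 * (x \<bullet> e) * \<phi> x) \<le> 2 * R * norm (\<phi> x)"
            using le[of x] by (simp add: abs_mult space_restrict_space mult_right_mono)
        qed
      qed (use R(2) in simp)
    qed
  qed simp
  finally have *: "L2_norm dx \<phi> * L2_norm dx \<phi> \<le> L2_norm dx \<phi> * (2 * R * L2_norm dx D)"
    by (simp add: power2_eq_square algebra_simps)
  show ?thesis
  proof (cases "L2_norm dx \<phi> = 0")
    case True
    then show ?thesis using R(2) by simp
  next
    case False
    then have "0 < L2_norm dx \<phi>" using L2_norm_nonneg[of dx \<phi>] by linarith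
    then show ?thesis using * by (rule mult_left_le_imp_le[rotated])
  qed
qed

end

section \<open>Two-dimensional Hausdorff measure\<close>

text \<open>The set function from which \<open>hausdorff2\<close> is built. Since \<open>measure_of\<close> yields the zero measure for
  a set function that is not countably additive, this additivity on Borel sets has to be proved
  before anything can be said about \<open>hausdorff2\<close>.\<close>

definition hausdorff2_outer :: "(real^3) set \<Rightarrow> ennreal" where
  "hausdorff2_outer S = (SUP \<delta>\<in>{0<..}. hausdorff2_pre \<delta> S)"

definition fine_cover :: "real \<Rightarrow> (real^3) set \<Rightarrow> (nat \<Rightarrow> (real^3) set) \<Rightarrow> bool" where
  "fine_cover \<delta> S C \<longleftrightarrow> S \<subseteq> (\<Union>n. C n) \<and> (\<forall>n. bounded (C n) \<and> diameter (C n) \<le> \<delta>)"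

definition disc_area :: "(real^3) set \<Rightarrow> ennreal" where
  "disc_area B = ennreal (pi / 4 * (diameter B)\<^sup>2)"

lemma hausdorff2_pre_alt:
  "hausdorff2_pre \<delta> S = (INF C \<in> {C. fine_cover \<delta> S C}. \<Sum>n. disc_area (C n))"
  by (simp add: hausdorff2_pre_def fine_cover_def disc_area_def)

lemma hausdorff2_pre_le:
  "fine_cover \<delta> S C \<Longrightarrow> hausdorff2_pre \<delta> S \<le> (\<Sum>n. disc_area (C n))"
  unfolding hausdorff2_pre_alt by (rule INF_lower) simp

lemma hausdorff2_pre_greatest:
  "(\<And>C. fine_cover \<delta> S C \<Longrightarrow> u \<le> (\<Sum>n. disc_area (C n))) \<Longrightarrow> u \<le> hausdorff2_pre \<delta> S"
  unfolding hausdorff2_pre_alt by (rule INF_greatest) simp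

lemma disc_area_empty [simp]: "disc_area {} = 0"
  by (simp add: disc_area_def)

lemma hausdorff2_pre_mono: "S \<subseteq> T \<Longrightarrow> hausdorff2_pre \<delta> S \<le> hausdorff2_pre \<delta> T"
  by (rule hausdorff2_pre_greatest) (auto intro: hausdorff2_pre_le simp: fine_cover_def)

lemma hausdorff2_pre_antimono: "\<delta> \<le> \<delta>' \<Longrightarrow> hausdorff2_pre \<delta>' S \<le> hausdorff2_pre \<delta> S"
  by (rule hausdorff2_pre_greatest, rule hausdorff2_pre_le)
     (meson fine_cover_def order_trans)

lemma hausdorff2_pre_empty: "0 < \<delta> \<Longrightarrow> hausdorff2_pre \<delta> {} = 0"
  using hausdorff2_pre_le[of \<delta> "{}" "\<lambda>_. {}"] by (simp add: fine_cover_def)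

lemma ennreal_less_add_pos:
  fixes x :: ennreal
  assumes "x < top" "0 < e"
  shows "x < x + ennreal e"
  using assms by (cases x) (auto simp flip: ennreal_plus simp: ennreal_less_iff)

text \<open>As for every outer measure given by coverings: near-optimal coverings of the \<open>S i\<close>, with errors
  summing up to \<open>e\<close>, are merged into one sequence by the pairing of natural numbers.\<close>

lemma hausdorff2_pre_subadditive:
  "hausdorff2_pre \<delta> (\<Union>i. S i) \<le> (\<Sum>i::nat. hausdorff2_pre \<delta> (S i))"
proof (rule ennreal_le_epsilon)
  fix e :: real assume fin: "(\<Sum>i. hausdorff2_pre \<delta> (S i)) < top" and e: "0 < e"
  have "\<exists>C. fine_cover \<delta> (S i) C \<and>
      (\<Sum>n. disc_area (C n)) < hausdorff2_pre \<delta> (S i) + ennreal (e * (1/2) ^ Suc i)" for i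
  proof -
    have "hausdorff2_pre \<delta> (S i) < top"
      using fin ennreal_suminf_lessD[of "\<lambda>i. hausdorff2_pre \<delta> (S i)" top i] by simp
    then have "hausdorff2_pre \<delta> (S i) < hausdorff2_pre \<delta> (S i) + ennreal (e * (1/2) ^ Suc i)"
      using e by (simp add: ennreal_less_add_pos)
    then have "(INF C \<in> {C. fine_cover \<delta> (S i) C}. \<Sum>n. disc_area (C n))
        < hausdorff2_pre \<delta> (S i) + ennreal (e * (1/2) ^ Suc i)"
      by (simp add: hausdorff2_pre_alt)
    then show ?thesis unfolding INF_less_iff by blast
  qed
  then obtain C where C: "\<And>i. fine_cover \<delta> (S i) (C i)"
    "\<And>i. (\<Sum>n. disc_area (C i n)) < hausdorff2_pre \<delta> (S i) + ennreal (e * (1/2) ^ Suc i)"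
    by metis
  define B where "B k = (case prod_decode k of (i, n) \<Rightarrow> C i n)" for k
  have "fine_cover \<delta> (\<Union>i. S i) B"
    unfolding fine_cover_def
  proof (intro conjI allI subsetI)
    fix x assume "x \<in> (\<Union>i. S i)"
    then obtain i where "x \<in> S i" by blast
    then obtain n where "x \<in> C i n" using C(1)[of i] unfolding fine_cover_def by blast
    then have "x \<in> B (prod_encode (i, n))" by (simp add: B_def)
    then show "x \<in> (\<Union>k. B k)" by blast
  next
    fix k
    show "bounded (B k)" "diameter (B k) \<le> \<delta>"
      using C(1) by (auto simp: B_def fine_cover_def split: prod.split)
  qed
  then have "hausdorff2_pre \<delta> (\<Union>i. S i) \<le> (\<Sum>k. disc_area (B k))"
    by (rule hausdorff2_pre_le)
  also have "\<dots> = (\<Sum>i. \<Sum>n. disc_area (C i n))"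
    using suminf_ennreal_2dimen[of "\<lambda>i. \<Sum>n. disc_area (C i n)" "\<lambda>(i, n). disc_area (C i n)"]
    by (simp add: B_def comp_def case_prod_beta')
  also have "\<dots> \<le> (\<Sum>i. hausdorff2_pre \<delta> (S i) + ennreal (e * (1/2) ^ Suc i))"
    using C(2) by (intro suminf_le) (auto intro: less_imp_le)
  also have "\<dots> = (\<Sum>i. hausdorff2_pre \<delta> (S i)) + (\<Sum>i. ennreal (e * (1/2) ^ Suc i))"
    by (rule suminf_add[symmetric]) auto
  also have "(\<Sum>i. ennreal (e * (1/2) ^ Suc i)) = ennreal e"
  proof -
    have "(\<lambda>i. e * (1/2) ^ Suc i) sums e" using sums_mult[OF power_half_series, of e] by simp
    then show ?thesis using e by (intro suminf_ennreal_eq) auto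
  qed
  finally show "hausdorff2_pre \<delta> (\<Union>i. S i) \<le> (\<Sum>i. hausdorff2_pre \<delta> (S i)) + ennreal e" .
qed

lemma hausdorff2_pre_le_outer: "0 < \<delta> \<Longrightarrow> hausdorff2_pre \<delta> S \<le> hausdorff2_outer S"
  unfolding hausdorff2_outer_def by (rule SUP_upper) simp

lemma hausdorff2_outer_mono: "S \<subseteq> T \<Longrightarrow> hausdorff2_outer S \<le> hausdorff2_outer T"
  unfolding hausdorff2_outer_def by (intro SUP_mono) (auto intro: hausdorff2_pre_mono)

lemma hausdorff2_outer_empty [simp]: "hausdorff2_outer {} = 0"
proof -
  have "hausdorff2_outer {} \<le> 0"
    unfolding hausdorff2_outer_def by (intro SUP_least) (simp add: hausdorff2_pre_empty)
  then show ?thesis by simp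
qed

lemma hausdorff2_outer_subadditive:
  "hausdorff2_outer (\<Union>i. S i) \<le> (\<Sum>i::nat. hausdorff2_outer (S i))"
proof -
  have "hausdorff2_pre \<delta> (\<Union>i. S i) \<le> (\<Sum>i. hausdorff2_outer (S i))" if "0 < \<delta>" for \<delta>
  proof -
    have "hausdorff2_pre \<delta> (\<Union>i. S i) \<le> (\<Sum>i. hausdorff2_pre \<delta> (S i))"
      by (rule hausdorff2_pre_subadditive)
    also have "\<dots> \<le> (\<Sum>i. hausdorff2_outer (S i))"
      using that by (intro suminf_le hausdorff2_pre_le_outer) auto
    finally show ?thesis .
  qed
  then show ?thesis unfolding hausdorff2_outer_def[of "\<Union>i. S i"] by (intro SUP_least) simp
qed

lemma hausdorff2_outer_Un: "hausdorff2_outer (S \<union> T) \<le> hausdorff2_outer S + hausdorff2_outer T"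
proof -
  let ?f = "\<lambda>i::nat. if i = 0 then S else if i = 1 then T else {}"
  have "S \<union> T = (\<Union>i. ?f i)" by (auto split: if_splits)
  then have "hausdorff2_outer (S \<union> T) \<le> (\<Sum>i. hausdorff2_outer (?f i))"
    using hausdorff2_outer_subadditive[of ?f] by simp
  also have "\<dots> = (\<Sum>i\<in>{0, 1}. hausdorff2_outer (?f i))"
    by (rule suminf_finite) auto
  finally show ?thesis by simp
qed

lemma hausdorff2_outer_sequence:
  "hausdorff2_outer S = (SUP n. hausdorff2_pre (inverse (real (Suc n))) S)"
proof (rule antisym)
  show "hausdorff2_outer S \<le> (SUP n. hausdorff2_pre (inverse (real (Suc n))) S)"
    unfolding hausdorff2_outer_def
  proof (rule SUP_least)
    fix \<delta> :: real assume "\<delta> \<in> {0<..}"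
    then obtain n where "inverse (real (Suc n)) < \<delta>" using reals_Archimedean by auto
    then have "hausdorff2_pre \<delta> S \<le> hausdorff2_pre (inverse (real (Suc n))) S"
      by (intro hausdorff2_pre_antimono) simp
    also have "\<dots> \<le> (SUP n. hausdorff2_pre (inverse (real (Suc n))) S)" by (rule SUP_upper) simp
    finally show "hausdorff2_pre \<delta> S \<le> (SUP n. hausdorff2_pre (inverse (real (Suc n))) S)" .
  qed
  show "(SUP n. hausdorff2_pre (inverse (real (Suc n))) S) \<le> hausdorff2_outer S"
    by (intro SUP_least hausdorff2_pre_le_outer) simp
qed

text \<open>A covering set of diameter at most \<open>\<delta>\<close> meets at most one of \<open>A\<close> and \<open>B\<close>, so every covering of
  the union splits into a covering of \<open>A\<close> and one of \<open>B\<close>.\<close>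

lemma hausdorff2_pre_separated:
  assumes "\<And>x y. x \<in> A \<Longrightarrow> y \<in> B \<Longrightarrow> \<delta> < dist x y" "0 < \<delta>"
  shows "hausdorff2_pre \<delta> A + hausdorff2_pre \<delta> B \<le> hausdorff2_pre \<delta> (A \<union> B)"
proof (rule hausdorff2_pre_greatest)
  fix C assume C: "fine_cover \<delta> (A \<union> B) C"
  define CA where "CA n = (if C n \<inter> A \<noteq> {} then C n else {})" for n
  define CB where "CB n = (if C n \<inter> A \<noteq> {} then {} else C n)" for n
  have "fine_cover \<delta> A CA"
    unfolding fine_cover_def
  proof (intro conjI allI subsetI)
    fix x assume x: "x \<in> A"
    then obtain n where n: "x \<in> C n" using C unfolding fine_cover_def by blast
    then have "x \<in> CA n" using x by (auto simp: CA_def)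
    then show "x \<in> (\<Union>n. CA n)" by blast
  next
    fix n
    show "bounded (CA n)" "diameter (CA n) \<le> \<delta>" using C assms(2) by (auto simp: CA_def fine_cover_def)
  qed
  moreover have "fine_cover \<delta> B CB"
    unfolding fine_cover_def
  proof (intro conjI allI subsetI)
    fix y assume y: "y \<in> B"
    then obtain n where n: "y \<in> C n" using C unfolding fine_cover_def by blast
    have "C n \<inter> A = {}"
    proof (rule ccontr)
      assume "C n \<inter> A \<noteq> {}"
      then obtain x where x: "x \<in> C n" "x \<in> A" by blast
      have "bounded (C n)" "diameter (C n) \<le> \<delta>" using C by (auto simp: fine_cover_def)
      then have "dist x y \<le> \<delta>" using diameter_bounded_bound[of "C n" x y] x n by linarith
      then show False using assms(1)[OF x(2) y] by simp
    qed
    then have "y \<in> CB n" using n by (simp add: CB_def)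
    then show "y \<in> (\<Union>n. CB n)" by blast
  next
    fix n
    show "bounded (CB n)" "diameter (CB n) \<le> \<delta>" using C assms(2) by (auto simp: CB_def fine_cover_def)
  qed
  ultimately have "hausdorff2_pre \<delta> A + hausdorff2_pre \<delta> B
      \<le> (\<Sum>n. disc_area (CA n)) + (\<Sum>n. disc_area (CB n))"
    by (intro add_mono hausdorff2_pre_le)
  also have "\<dots> = (\<Sum>n. disc_area (CA n) + disc_area (CB n))" by (rule suminf_add) auto
  also have "(\<lambda>n. disc_area (CA n) + disc_area (CB n)) = (\<lambda>n. disc_area (C n))"
    by (auto simp: CA_def CB_def)
  finally show "hausdorff2_pre \<delta> A + hausdorff2_pre \<delta> B \<le> (\<Sum>n. disc_area (C n))" .
qed

lemma hausdorff2_outer_separated: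
  assumes "\<And>x y. x \<in> A \<Longrightarrow> y \<in> B \<Longrightarrow> d \<le> dist x y" "0 < d"
  shows "hausdorff2_outer A + hausdorff2_outer B \<le> hausdorff2_outer (A \<union> B)"
proof -
  have inc: "incseq (\<lambda>n. hausdorff2_pre (inverse (real (Suc n))) S)" for S
    by (intro monoI hausdorff2_pre_antimono) (simp add: field_simps)
  have "hausdorff2_outer A + hausdorff2_outer B
      = (SUP n. hausdorff2_pre (inverse (real (Suc n))) A + hausdorff2_pre (inverse (real (Suc n))) B)"
    unfolding hausdorff2_outer_sequence by (rule ennreal_SUP_add[OF inc inc, symmetric])
  also have "\<dots> \<le> hausdorff2_outer (A \<union> B)"
  proof (rule SUP_least)
    fix n
    define \<delta> where "\<delta> = min (inverse (real (Suc n))) (d / 2)"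
    have \<delta>: "0 < \<delta>" "\<delta> < d" "\<delta> \<le> inverse (real (Suc n))" using assms(2) by (auto simp: \<delta>_def)
    have "hausdorff2_pre (inverse (real (Suc n))) A + hausdorff2_pre (inverse (real (Suc n))) B
        \<le> hausdorff2_pre \<delta> A + hausdorff2_pre \<delta> B"
      by (intro add_mono hausdorff2_pre_antimono \<delta>)
    also have "\<dots> \<le> hausdorff2_pre \<delta> (A \<union> B)"
      by (rule hausdorff2_pre_separated[OF _ \<delta>(1)]) (use assms(1) \<delta>(2) in fastforce)
    also have "\<dots> \<le> hausdorff2_outer (A \<union> B)" by (rule hausdorff2_pre_le_outer[OF \<delta>(1)])
    finally show "hausdorff2_pre (inverse (real (Suc n))) A + hausdorff2_pre (inverse (real (Suc n))) B
        \<le> hausdorff2_outer (A \<union> B)" .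
  qed
  finally show ?thesis .
qed

text \<open>Caratheodory's criterion. Let \<open>Y n\<close> be the part of \<open>X\<close> at distance at least \<open>1 / (n + 1)\<close> from \<open>F\<close>
  and \<open>R n\<close> the annulus between \<open>Y n\<close> and \<open>Y (n + 1)\<close>. Annuli whose indices have the same parity are
  separated, so their outer measures add up to at most that of \<open>X\<close>; the sum over all annuli
  is thus finite and its tails tend to zero. As \<open>X - F\<close> is \<open>Y n\<close> together with the later annuli, and
  \<open>Y n\<close> is separated from \<open>F\<close>, the claim holds up to an arbitrarily small tail.\<close>

lemma hausdorff2_outer_closed_split:
  assumes "closed F"
  shows "hausdorff2_outer (X \<inter> F) + hausdorff2_outer (X - F) \<le> hausdorff2_outer X"
proof (cases "F = {}")
  case False
  define Y where "Y n = {x \<in> X. inverse (real (Suc n)) \<le> infdist x F}" for n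
  define R where "R n = Y (Suc n) - Y n" for n
  let ?H = hausdorff2_outer
  have YX: "Y n \<subseteq> X" for n by (auto simp: Y_def)
  have YS: "Y n \<subseteq> Y (Suc n)" for n
  proof
    fix x assume "x \<in> Y n"
    moreover have "inverse (real (Suc (Suc n))) \<le> inverse (real (Suc n))" by (simp add: field_simps)
    ultimately show "x \<in> Y (Suc n)" unfolding Y_def by (blast intro: order_trans)
  qed
  have Ymono: "Y m \<subseteq> Y n" if "m \<le> n" for m n
    using that by (rule lift_Suc_mono_le[of Y, OF YS])
  have UY: "X - F = (\<Union>n. Y n)"
  proof (intro equalityI subsetI)
    fix x assume x: "x \<in> X - F"
    then have "0 < infdist x F"
      using assms False in_closed_iff_infdist_zero[OF assms False, of x] infdist_nonneg[of x F]
      by (simp add: less_le)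
    then obtain n where "inverse (real (Suc n)) < infdist x F" using reals_Archimedean by blast
    then show "x \<in> (\<Union>n. Y n)" using x by (auto simp: Y_def intro!: exI[of _ n])
  next
    fix x assume "x \<in> (\<Union>n. Y n)"
    then obtain n where n: "x \<in> X" "inverse (real (Suc n)) \<le> infdist x F" by (auto simp: Y_def)
    have "x \<notin> F"
    proof
      assume "x \<in> F"
      then have "infdist x F = 0" by simp
      then show False using n(2) by (simp add: inverse_eq_divide divide_le_0_iff)
    qed
    then show "x \<in> X - F" using n by simp
  qed
  \<comment> \<open>Sets on either side of a distance annulus around \<open>F\<close> are a positive distance apart.\<close>
  have sep: "?H U + ?H V \<le> ?H (U \<union> V)" if U: "U \<subseteq> Y n" and V: "V \<subseteq> X" "V \<inter> Y (Suc n) = {}" for U V n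
  proof (rule hausdorff2_outer_separated)
    fix x y assume x: "x \<in> U" and y: "y \<in> V"
    have "inverse (real (Suc n)) \<le> infdist x F" using U x by (auto simp: Y_def)
    moreover have "infdist y F < inverse (real (Suc (Suc n)))" using V y by (force simp: Y_def not_le)
    moreover have "infdist x F \<le> infdist y F + dist x y" by (rule infdist_triangle)
    ultimately show "inverse (real (Suc n)) - inverse (real (Suc (Suc n))) \<le> dist x y" by linarith
  next
    show "0 < inverse (real (Suc n)) - inverse (real (Suc (Suc n)))"
      using less_imp_inverse_less[of "real (Suc n)" "real (Suc (Suc n))"] by simp
  qed
  have R: "R n \<subseteq> X" "R n \<inter> Y n = {}" "R n \<subseteq> Y (Suc n)" for n using YX by (auto simp: R_def)
  have parity: "(\<Sum>k<m. ?H (R (2 * k + c))) \<le> ?H (Y (2 * m + c - 1))" for m c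
  proof (induction m)
    case (Suc m)
    show ?case
    proof (cases m)
      case 0
      then show ?thesis using R(3)[of c] by (simp add: hausdorff2_outer_mono)
    next
      case (Suc l)
      then have "Suc (2 * m + c - 1) = 2 * m + c" by simp
      then have "?H (Y (2 * m + c - 1)) + ?H (R (2 * m + c)) \<le> ?H (Y (2 * m + c - 1) \<union> R (2 * m + c))"
        using R[of "2 * m + c"] by (intro sep[OF order_refl]) auto
      also have "\<dots> \<le> ?H (Y (2 * Suc m + c - 1))"
        using R(3)[of "2 * m + c"] Ymono[of "2 * m + c - 1" "Suc (2 * m + c)"]
        by (intro hausdorff2_outer_mono) auto
      finally have "?H (Y (2 * m + c - 1)) + ?H (R (2 * m + c)) \<le> ?H (Y (2 * Suc m + c - 1))" .
      then show ?thesis using Suc.IH by (simp add: order_trans[OF add_right_mono])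
    qed
  qed simp
  show ?thesis
  proof (cases "?H X = top")
    case fin: False
    have double: "(\<Sum>k<2 * m. ?H (R k)) = (\<Sum>k<m. ?H (R (2 * k + 0))) + (\<Sum>k<m. ?H (R (2 * k + 1)))" for m
      by (induction m) (simp_all add: add_ac)
    have bound: "(\<Sum>k<m. ?H (R k)) \<le> ?H X + ?H X" for m
    proof -
      have "(\<Sum>k<m. ?H (R k)) \<le> (\<Sum>k<2 * m. ?H (R k))" by (intro sum_mono2) auto
      also have "\<dots> \<le> ?H X + ?H X"
        unfolding double
        by (intro add_mono order_trans[OF parity] hausdorff2_outer_mono YX)
      finally show ?thesis .
    qed
    have total: "(\<Sum>k. ?H (R k)) < top"
    proof -
      have "(\<Sum>k. ?H (R k)) \<le> ?H X + ?H X" unfolding suminf_eq_SUP by (intro SUP_least bound)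
      also have "\<dots> < top" using fin by (simp add: less_top)
      finally show ?thesis .
    qed
    show ?thesis
    proof (rule ennreal_le_epsilon)
      fix e :: real assume e: "0 < e"
      have "(\<Sum>k. ?H (R k)) < (SUP n. (\<Sum>k<n. ?H (R k))) + ennreal e"
        using total e by (simp add: suminf_eq_SUP[symmetric] ennreal_less_add_pos)
      also have "\<dots> = (SUP n. (\<Sum>k<n. ?H (R k)) + ennreal e)" by (simp add: ennreal_SUP_add_left)
      finally obtain n where n: "(\<Sum>k. ?H (R k)) < (\<Sum>k<n. ?H (R k)) + ennreal e"
        unfolding less_SUP_iff by blast
      have "(\<Sum>k. ?H (R k)) = (\<Sum>k. ?H (R (k + n))) + (\<Sum>k<n. ?H (R k))"
        by (rule suminf_offset) (rule summableI)
      moreover have "(\<Sum>k<n. ?H (R k)) < top"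
        by (rule le_less_trans[OF _ total], rule sum_le_suminf) (rule summableI, auto)
      ultimately have "(\<Sum>k<n. ?H (R k)) + (\<Sum>k. ?H (R (k + n))) < (\<Sum>k<n. ?H (R k)) + ennreal e"
        using n by (simp add: add.commute)
      then have tail: "(\<Sum>k. ?H (R (k + n))) \<le> ennreal e"
        by (simp add: ennreal_add_left_cancel_less less_imp_le)
      have "X - F \<subseteq> Y n \<union> (\<Union>k. R (k + n))"
      proof
        fix x assume "x \<in> X - F"
        then obtain m where m: "x \<in> Y m" using UY by blast
        define l where "l = (LEAST m. x \<in> Y m)"
        have l: "x \<in> Y l" "\<And>j. j < l \<Longrightarrow> x \<notin> Y j"
          using m not_less_Least unfolding l_def by (auto intro: LeastI)
        show "x \<in> Y n \<union> (\<Union>k. R (k + n))"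
        proof (cases "l \<le> n")
          case True
          then show ?thesis using l(1) Ymono by blast
        next
          case False
          then obtain j where j: "l = Suc j" "n \<le> j" by (cases l) auto
          then have "x \<in> R (j - n + n)" using l by (simp add: R_def)
          then show ?thesis by blast
        qed
      qed
      then have "?H (X - F) \<le> ?H (Y n \<union> (\<Union>k. R (k + n)))" by (rule hausdorff2_outer_mono)
      also have "\<dots> \<le> ?H (Y n) + ?H (\<Union>k. R (k + n))" by (rule hausdorff2_outer_Un)
      also have "\<dots> \<le> ?H (Y n) + ennreal e"
        by (intro add_left_mono order_trans[OF hausdorff2_outer_subadditive tail])
      finally have "?H (X \<inter> F) + ?H (X - F) \<le> ?H (X \<inter> F) + (?H (Y n) + ennreal e)"
        by (rule add_left_mono)
      also have "\<dots> = ?H (Y n) + ?H (X \<inter> F) + ennreal e" by (simp add: add_ac)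
      also have "?H (Y n) + ?H (X \<inter> F) \<le> ?H X"
      proof -
        have "(X \<inter> F) \<inter> Y (Suc n) = {}" using UY by blast
        then have "?H (Y n) + ?H (X \<inter> F) \<le> ?H (Y n \<union> (X \<inter> F))" by (intro sep[OF order_refl]) auto
        also have "\<dots> \<le> ?H X" using YX by (intro hausdorff2_outer_mono) auto
        finally show ?thesis .
      qed
      finally show "?H (X \<inter> F) + ?H (X - F) \<le> ?H X + ennreal e" by (simp add: add_right_mono)
    qed
  qed simp
qed simp

lemma measure_space_hausdorff2: "measure_space UNIV (sets borel) hausdorff2_outer"
proof -
  interpret sigma_algebra UNIV "Pow (UNIV :: (real^3) set)" by (rule sigma_algebra_Pow)
  let ?L = "lambda_system UNIV (Pow UNIV) hausdorff2_outer"
  have "outer_measure_space (Pow UNIV) hausdorff2_outer"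
    unfolding outer_measure_space_def
    using hausdorff2_outer_mono hausdorff2_outer_subadditive
    by (auto simp: positive_def increasing_def countably_subadditive_def)
  then have ms: "measure_space UNIV ?L hausdorff2_outer" by (rule caratheodory_lemma)
  then have "sigma_algebra UNIV ?L" by (simp add: measure_space_def)
  moreover have "{S. closed S} \<subseteq> ?L"
  proof
    fix F :: "(real^3) set" assume "F \<in> {S. closed S}"
    then have F: "closed F" by simp
    have "hausdorff2_outer (X \<inter> F) + hausdorff2_outer (X - F) = hausdorff2_outer X" for X
    proof (rule antisym[OF hausdorff2_outer_closed_split[OF F]])
      show "hausdorff2_outer X \<le> hausdorff2_outer (X \<inter> F) + hausdorff2_outer (X - F)"
        using hausdorff2_outer_Un[of "X \<inter> F" "X - F"] by (simp add: Int_Diff_Un)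
    qed
    then show "F \<in> ?L" unfolding lambda_system_eq by simp
  qed
  ultimately have "sigma_sets UNIV {S. closed S} \<subseteq> ?L" by (rule sigma_algebra.sigma_sets_subset)
  then have sub: "sets borel \<subseteq> ?L" by (simp add: borel_eq_closed)
  have "sigma_algebra UNIV (sets (borel :: (real^3) measure))"
    using sets.sigma_algebra_axioms[of "borel :: (real^3) measure"] by simp
  from measure_down[OF ms this sub] show ?thesis .
qed

lemma sets_hausdorff2 [simp]: "sets hausdorff2 = sets borel"
  unfolding hausdorff2_def using sets.sigma_sets_eq[of "borel :: (real^3) measure"] by simp

lemma space_hausdorff2 [simp]: "space hausdorff2 = UNIV"
  by (simp add: hausdorff2_def)

lemma emeasure_hausdorff2:
  assumes "A \<in> sets borel"
  shows "emeasure hausdorff2 A = hausdorff2_outer A"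
proof (rule emeasure_measure_of[of hausdorff2 UNIV "sets borel" hausdorff2_outer])
  show "hausdorff2 = measure_of UNIV (sets borel) hausdorff2_outer"
    unfolding hausdorff2_def hausdorff2_outer_def[abs_def] by simp
  show "positive (sets hausdorff2) hausdorff2_outer" by (simp add: positive_def)
  show "countably_additive (sets hausdorff2) hausdorff2_outer"
    using measure_space_hausdorff2 by (simp add: measure_space_def)
qed (use assms in auto)

text \<open>Rotated so that \<open>e\<close> becomes the third axis, the union of the segments that start in \<open>B\<close> lies in a
  box with base \<open>2 d \<times> 2 d\<close> and height \<open>2 d + \<epsilon>\<close>, where \<open>d\<close> is the diameter of \<open>B\<close>.\<close>

lemma orthogonal_segment_box:
  fixes e :: "real^3"
  assumes e: "norm e = 1" and B: "bounded B" and \<epsilon>: "0 \<le> \<epsilon>"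
  obtains S where "S \<in> lmeasurable" "{c + s *\<^sub>R e | c s. c \<in> B \<and> 0 \<le> s \<and> s \<le> \<epsilon>} \<subseteq> S"
    "measure lebesgue S \<le> 4 * (diameter B)\<^sup>2 * (2 * diameter B + \<epsilon>)"
proof (cases "B = {}")
  case True
  then show ?thesis using that[of "{}"] \<epsilon> by (simp add: diameter_ge_0)
next
  case False
  then obtain c0 where c0: "c0 \<in> B" by blast
  let ?d = "diameter B"
  have d0: "0 \<le> ?d" using B by (rule diameter_ge_0)
  obtain Q :: "real^3 \<Rightarrow> real^3" where Q: "orthogonal_transformation Q" "Q (axis 3 1) = e"
    by (rule orthogonal_transformation_exists_1[of "axis 3 1 :: real^3" e])
       (use e in \<open>simp_all add: norm_axis_1\<close>)
  define K where "K = cbox (vector [-?d, -?d, -?d]) (vector [?d, ?d, ?d + \<epsilon>] :: real^3)"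
  have K: "K \<in> lmeasurable" "measure lebesgue K = 4 * ?d\<^sup>2 * (2 * ?d + \<epsilon>)"
  proof -
    have "0 \<in> K" unfolding K_def mem_box_cart forall_3 using d0 \<epsilon> by simp
    then have ne: "K \<noteq> {}" by blast
    show "K \<in> lmeasurable" by (simp add: K_def)
    have "measure lebesgue K = measure lborel K" by (simp add: K_def)
    also have "\<dots> = (\<Prod>i\<in>UNIV. (vector [?d, ?d, ?d + \<epsilon>] :: real^3) $ i
        - (vector [-?d, -?d, -?d] :: real^3) $ i)"
      unfolding K_def by (rule content_cbox_cart[OF ne[unfolded K_def]])
    also have "\<dots> = (2 * ?d) * (2 * ?d) * (2 * ?d + \<epsilon>)"
      unfolding UNIV_3 by simp
    finally show "measure lebesgue K = 4 * ?d\<^sup>2 * (2 * ?d + \<epsilon>)" by (simp add: power2_eq_square)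
  qed
  define S where "S = (+) c0 ` Q ` K"
  show ?thesis
  proof (rule that[of S])
    have "Q ` K \<in> lmeasurable" by (rule measurable_orthogonal_image[OF Q(1) K(1)])
    then show "S \<in> lmeasurable" unfolding S_def by (rule measurable_translation)
    show "measure lebesgue S \<le> 4 * ?d\<^sup>2 * (2 * ?d + \<epsilon>)"
      unfolding S_def measure_translation measure_orthogonal_image[OF Q(1) K(1)] K(2) by simp
    show "{c + s *\<^sub>R e | c s. c \<in> B \<and> 0 \<le> s \<and> s \<le> \<epsilon>} \<subseteq> S"
    proof clarify
      fix c s assume c: "c \<in> B" and s: "0 \<le> s" "s \<le> \<epsilon>"
      obtain y where y: "Q y = c - c0"
        using orthogonal_transformation_surj[OF Q(1)] by (metis surjD)
      have "norm y = norm (c - c0)" using orthogonal_transformation_norm[OF Q(1), of y] y by simp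
      also have "\<dots> \<le> ?d" using diameter_bounded_bound[OF B c c0] by (simp add: dist_norm)
      finally have "\<bar>y $ i\<bar> \<le> ?d" for i using component_le_norm_cart[of y i] by linarith
      then have yi: "y $ i \<le> ?d" "- ?d \<le> y $ i" for i by (simp_all add: abs_le_iff minus_le_iff)
      have "y + s *\<^sub>R axis 3 1 \<in> K"
        unfolding K_def mem_box_cart forall_3
        using yi s by (simp add: axis_def add_increasing2 add_mono add_increasing)
      moreover have "c0 + Q (y + s *\<^sub>R axis 3 1) = c + s *\<^sub>R e"
        using orthogonal_transformation_linear[OF Q(1)] y Q(2) by (simp add: linear_add linear_scale)
      ultimately show "c + s *\<^sub>R e \<in> S" unfolding S_def by (metis imageI)
    qed
  qed
qed

text \<open>Volume is bounded by height times surface measure. Covering \<open>E\<close> by sets of diameter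
  \<open>d \<le> \<epsilon> / 2\<close>, the box above each of them has volume at most \<open>4 d\<^sup>2 (2 \<epsilon>)\<close>, which is \<open>32 \<epsilon> / \<pi>\<close>
  times the term \<open>\<pi> d\<^sup>2 / 4\<close> that this set contributes to the Hausdorff sum.\<close>

lemma lborel_le_hausdorff2:
  fixes e :: "real^3"
  assumes e: "norm e = 1" and \<epsilon>: "0 < \<epsilon>" and T: "T \<in> sets borel"
    "T \<subseteq> {c + s *\<^sub>R e | c s. c \<in> E \<and> 0 \<le> s \<and> s \<le> \<epsilon>}"
  shows "emeasure lborel T \<le> ennreal (32 / pi * \<epsilon>) * hausdorff2_outer E"
proof -
  have "emeasure lborel T \<le> ennreal (32 / pi * \<epsilon>) * (\<Sum>n. disc_area (C n))"
    if C: "fine_cover (\<epsilon> / 2) E C" for C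
  proof -
    define seg where "seg n = {c + s *\<^sub>R e | c s. c \<in> C n \<and> 0 \<le> s \<and> s \<le> \<epsilon>}" for n
    have "\<forall>n. \<exists>S. S \<in> lmeasurable \<and> seg n \<subseteq> S \<and>
        measure lebesgue S \<le> 4 * (diameter (C n))\<^sup>2 * (2 * diameter (C n) + \<epsilon>)"
    proof
      fix n
      have b: "bounded (C n)" using C by (simp add: fine_cover_def)
      show "\<exists>S. S \<in> lmeasurable \<and> seg n \<subseteq> S \<and>
          measure lebesgue S \<le> 4 * (diameter (C n))\<^sup>2 * (2 * diameter (C n) + \<epsilon>)"
        unfolding seg_def
        by (rule orthogonal_segment_box[OF e b less_imp_le[OF \<epsilon>]]) (intro exI conjI)
    qed
    from choice[OF this] obtain S where "\<forall>n. S n \<in> lmeasurable \<and> seg n \<subseteq> S n \<and>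
        measure lebesgue (S n) \<le> 4 * (diameter (C n))\<^sup>2 * (2 * diameter (C n) + \<epsilon>)"
      by (rule exE)
    then have S: "\<And>n. S n \<in> lmeasurable" "\<And>n. seg n \<subseteq> S n"
      "\<And>n. measure lebesgue (S n) \<le> 4 * (diameter (C n))\<^sup>2 * (2 * diameter (C n) + \<epsilon>)"
      by simp_all
    have "emeasure lborel T = emeasure lebesgue T" using T(1) by simp
    also have "\<dots> \<le> emeasure lebesgue (\<Union>n. S n)"
    proof (rule emeasure_mono)
      show "T \<subseteq> (\<Union>n. S n)"
      proof
        fix x assume "x \<in> T"
        then obtain c s where x: "x = c + s *\<^sub>R e" "c \<in> E" "0 \<le> s" "s \<le> \<epsilon>" using T(2) by blast
        then obtain n where "c \<in> C n" using C unfolding fine_cover_def by blast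
        then have "x \<in> seg n" using x unfolding seg_def by blast
        then have "x \<in> S n" using S(2)[of n] by blast
        then show "x \<in> (\<Union>n. S n)" by blast
      qed
      show "(\<Union>n. S n) \<in> sets lebesgue" using S(1) by (intro sets.countable_UN) auto
    qed
    also have "\<dots> \<le> (\<Sum>n. emeasure lebesgue (S n))"
      using S(1) by (intro emeasure_subadditive_countably) auto
    also have "\<dots> \<le> (\<Sum>n. ennreal (32 / pi * \<epsilon>) * disc_area (C n))"
    proof (intro suminf_le)
      fix n
      have d: "2 * diameter (C n) \<le> \<epsilon>"
        using C unfolding fine_cover_def by (simp add: mult.commute)
      have "measure lebesgue (S n) \<le> 4 * (diameter (C n))\<^sup>2 * (2 * diameter (C n) + \<epsilon>)" by (rule S(3))
      also have "\<dots> \<le> 4 * (diameter (C n))\<^sup>2 * (2 * \<epsilon>)"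
        by (rule mult_left_mono) (use d in simp_all)
      also have "\<dots> = 32 / pi * \<epsilon> * (pi / 4 * (diameter (C n))\<^sup>2)" by simp
      finally have "ennreal (measure lebesgue (S n)) \<le> ennreal (32 / pi * \<epsilon>) * disc_area (C n)"
        unfolding disc_area_def using \<epsilon> by (simp add: ennreal_mult[symmetric] ennreal_leI)
      then show "emeasure lebesgue (S n) \<le> ennreal (32 / pi * \<epsilon>) * disc_area (C n)"
        by (simp only: emeasure_eq_ennreal_measure[OF fmeasurableD2[OF S(1)]])
    qed auto
    also have "\<dots> = ennreal (32 / pi * \<epsilon>) * (\<Sum>n. disc_area (C n))" by simp
    finally show ?thesis .
  qed
  then have "emeasure lborel T / ennreal (32 / pi * \<epsilon>) \<le> hausdorff2_pre (\<epsilon> / 2) E"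
    using \<epsilon> by (intro hausdorff2_pre_greatest divide_le_posI_ennreal) (simp_all add: mult.commute)
  also have "\<dots> \<le> hausdorff2_outer E" using \<epsilon> by (intro hausdorff2_pre_le_outer) simp
  finally have "ennreal (32 / pi * \<epsilon>) * (emeasure lborel T / ennreal (32 / pi * \<epsilon>))
      \<le> ennreal (32 / pi * \<epsilon>) * hausdorff2_outer E" by (rule mult_left_mono) simp
  then show ?thesis using \<epsilon> by (simp add: ennreal_times_divide mult_divide_eq_ennreal mult.commute[of "ennreal _"])
qed

section \<open>Boundary charts and the strip estimate\<close>

text \<open>What the estimates use of a boundary chart: a direction \<open>e\<close> transversal to the boundary
  and a height function \<open>\<rho>\<close> with unit slope along \<open>e\<close>. For the region above the graph of \<open>\<gamma>\<close> it
  is \<open>\<rho>(y) = y\<^sub>3 - \<gamma>(y\<^sub>1, y\<^sub>2)\<close> in rotated coordinates.\<close>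

definition straight_chart ::
  "(real^3) set \<Rightarrow> real^3 \<Rightarrow> real \<Rightarrow> real^3 \<Rightarrow> (real^3 \<Rightarrow> real) \<Rightarrow> (real^3 \<Rightarrow> real^3) \<Rightarrow> bool" where
  "straight_chart \<Omega> p r e \<rho> D \<longleftrightarrow>
     0 < r \<and> norm e = 1 \<and> C1_with_grad \<rho> D \<and> bounded (range D) \<and>
     (\<forall>x s. \<rho> (x + s *\<^sub>R e) = \<rho> x + s) \<and> \<Omega> \<inter> ball p r = {x. 0 < \<rho> x} \<inter> ball p r"

abbreviation strip :: "real^3 \<Rightarrow> real \<Rightarrow> (real^3 \<Rightarrow> real) \<Rightarrow> real \<Rightarrow> (real^3) set" where
  "strip p r \<rho> \<epsilon> \<equiv> {x \<in> ball p r. 0 < \<rho> x \<and> \<rho> x < \<epsilon>}"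

lemma open_strip:
  assumes "C1_with_grad \<rho> D"
  shows "open (strip p r \<rho> \<epsilon>)"
proof -
  have "strip p r \<rho> \<epsilon> = ball p r \<inter> (\<rho> -` {0<..<\<epsilon>})" by auto
  moreover have "open (\<rho> -` {0<..<\<epsilon>})" by (rule open_vimage[OF _ C1_with_grad_D(3)[OF assms]]) simp
  ultimately show ?thesis by auto
qed

lemma bounded_holder_continuous_on:
  assumes "D \<in> bounded_holder S \<beta>" "0 < \<beta>"
  shows "continuous_on S D"
  unfolding continuous_on_def
proof
  fix x assume x: "x \<in> S"
  obtain C where C: "\<And>x y. x \<in> S \<Longrightarrow> y \<in> S \<Longrightarrow> norm (D x - D y) \<le> C * dist x y powr \<beta>"
    using assms(1) unfolding bounded_holder_def by blast
  have "((\<lambda>y. D y - D x) \<longlongrightarrow> 0) (at x within S)"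
  proof (rule Lim_null_comparison)
    show "\<forall>\<^sub>F y in at x within S. norm (D y - D x) \<le> C * dist y x powr \<beta>"
      using C[OF _ x] by (auto simp: eventually_at_filter)
    have "((\<lambda>y. dist y x) \<longlongrightarrow> 0) (at x within S)"
      by (auto intro!: tendsto_eq_intros)
    then have "((\<lambda>y. dist y x powr \<beta>) \<longlongrightarrow> 0) (at x within S)"
      by (rule tendsto_zero_powrI[OF _ tendsto_const _ assms(2)]) simp
    then show "((\<lambda>y. C * dist y x powr \<beta>) \<longlongrightarrow> 0) (at x within S)"
      using tendsto_mult_left[of "\<lambda>y. dist y x powr \<beta>" 0 _ C] by simp
  qed
  then show "(D \<longlongrightarrow> D x) (at x within S)" by (simp add: LIM_zero_iff)
qed

lemma graph_chart_imp_straight_chart: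
  assumes "graph_chart \<Omega> \<beta> p Q r \<gamma>" "0 < \<beta>"
  obtains e \<rho> D where "straight_chart \<Omega> p r e \<rho> D"
proof -
  have Q: "orthogonal_transformation Q" and r: "0 < r"
    and \<Omega>: "\<Omega> \<inter> ball p r = Q ` {y. \<gamma> (vector [y$1, y$2]) < y$3} \<inter> ball p r"
    using assms(1) by (auto simp: graph_chart_def)
  obtain D\<gamma> where D\<gamma>: "\<And>z. GDERIV \<gamma> z :> D\<gamma> z" "D\<gamma> \<in> bounded_holder UNIV \<beta>"
    using assms(1) unfolding graph_chart_def C1_holder_def by auto
  define e where "e = Q (axis 3 1)"
  define L :: "real^3 \<Rightarrow> real^2" where "L x = vector [x \<bullet> Q (axis 1 1), x \<bullet> Q (axis 2 1)]" for x
  define \<rho> where "\<rho> x = x \<bullet> e - \<gamma> (L x)" for x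
  define D where "D x = e - (D\<gamma> (L x) $ 1 *\<^sub>R Q (axis 1 1) + D\<gamma> (L x) $ 2 *\<^sub>R Q (axis 2 1))" for x
  have coord: "Q y \<bullet> Q (axis i 1) = y $ i" for y i
    using Q by (simp add: orthogonal_transformation_def inner_axis)
  have normQ: "norm (Q (axis i 1)) = 1" for i
    using orthogonal_transformation_norm[OF Q] by (simp add: norm_axis_1)
  have inner2: "x \<bullet> y = x $ 1 * y $ 1 + x $ 2 * y $ 2" for x y :: "real^2"
    by (simp add: inner_vec_def sum_2)
  have "linear L"
    by (rule linearI) (simp_all add: L_def vec_eq_iff forall_2 inner_add_left)
  then have bL: "bounded_linear L" by (rule linear_conv_bounded_linear[THEN iffD1])
  have cD\<gamma>: "continuous_on UNIV D\<gamma>" using D\<gamma>(2) assms(2) by (rule bounded_holder_continuous_on)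
  have cL: "continuous_on UNIV L" using bL by (rule bounded_linear.continuous_on[OF _ continuous_on_id])
  have "C1_with_grad \<rho> D"
  proof (rule C1_with_gradI)
    fix x
    have "(L has_derivative L) (at x)" using bL by (rule bounded_linear_imp_has_derivative)
    moreover have "(\<gamma> has_derivative (\<lambda>h. h \<bullet> D\<gamma> (L x))) (at (L x))"
      using D\<gamma>(1)[of "L x"] by (simp add: gderiv_def)
    ultimately have "((\<lambda>x. \<gamma> (L x)) has_derivative (\<lambda>h. L h \<bullet> D\<gamma> (L x))) (at x)"
      by (rule has_derivative_compose)
    then have "(\<rho> has_derivative (\<lambda>h. h \<bullet> e - L h \<bullet> D\<gamma> (L x))) (at x)"
      unfolding \<rho>_def by (intro derivative_intros) 
    also have "(\<lambda>h. h \<bullet> e - L h \<bullet> D\<gamma> (L x)) = (\<lambda>h. h \<bullet> D x)"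
      by (simp add: fun_eq_iff L_def D_def inner2 inner_diff_right inner_add_right mult.commute)
    finally show "(\<rho> has_derivative (\<lambda>h. h \<bullet> D x)) (at x)" .
  next
    have "continuous_on UNIV (\<lambda>x. D\<gamma> (L x))"
      by (rule continuous_on_compose2[OF cD\<gamma> cL]) simp
    then show "continuous_on UNIV D"
      unfolding D_def by (intro continuous_intros)
  qed
  moreover have "bounded (range D)"
  proof -
    have "bounded (range D\<gamma>)" using D\<gamma>(2) by (simp add: bounded_holder_def)
    then obtain B where B: "\<forall>y\<in>range D\<gamma>. norm y \<le> B" unfolding bounded_iff by blast
    have "norm (D x) \<le> 1 + (B + B)" for x
    proof -
      have "\<bar>D\<gamma> (L x) $ i\<bar> \<le> B" for i
        using B component_le_norm_cart[of "D\<gamma> (L x)" i] by (meson order_trans rangeI)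
      then have "norm (D\<gamma> (L x) $ i *\<^sub>R Q (axis j 1)) \<le> B" for i j by (simp add: normQ)
      then have "norm (D\<gamma> (L x) $ 1 *\<^sub>R Q (axis 1 1) + D\<gamma> (L x) $ 2 *\<^sub>R Q (axis 2 1)) \<le> B + B"
        by (intro norm_triangle_mono)
      moreover have "norm e = 1" unfolding e_def by (rule normQ)
      ultimately show ?thesis unfolding D_def using norm_triangle_ineq4 by (smt (verit))
    qed
    then show ?thesis unfolding bounded_iff by blast
  qed
  moreover have "\<rho> (x + s *\<^sub>R e) = \<rho> x + s" for x s
  proof -
    have "e \<bullet> Q (axis 1 1) = 0" "e \<bullet> Q (axis 2 1) = 0" "e \<bullet> e = 1"
      unfolding e_def coord by (simp_all add: axis_def)
    then show ?thesis by (simp add: \<rho>_def L_def inner_add_left)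
  qed
  moreover have "Q ` {y. \<gamma> (vector [y$1, y$2]) < y$3} = {x. 0 < \<rho> x}"
  proof -
    have \<rho>Q: "\<rho> (Q y) = y $ 3 - \<gamma> (vector [y$1, y$2])" for y
      by (simp add: \<rho>_def L_def e_def coord)
    have "surj Q" using Q by (rule orthogonal_transformation_surj)
    then show ?thesis by (auto simp: \<rho>Q image_iff) (metis \<rho>Q surjD diff_gt_0_iff_gt)
  qed
  moreover have "norm e = 1" unfolding e_def by (rule normQ)
  ultimately have "straight_chart \<Omega> p r e \<rho> D"
    using r \<Omega> unfolding straight_chart_def by simp
  then show ?thesis by (rule that)
qed

lemma straight_chart_foot:
  assumes "straight_chart \<Omega> p r e \<rho> D" "open \<Omega>" "x \<in> ball p r" "\<rho> x = 0"
  shows "x \<in> frontier \<Omega>"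
proof -
  have ch: "norm e = 1" "\<And>x s. \<rho> (x + s *\<^sub>R e) = \<rho> x + s" "\<Omega> \<inter> ball p r = {x. 0 < \<rho> x} \<inter> ball p r"
    using assms(1) by (auto simp: straight_chart_def)
  have "x \<notin> \<Omega>" using ch(3) assms(3,4) by force
  moreover have "x \<in> closure \<Omega>"
    unfolding closure_approachable
  proof (intro allI impI)
    fix \<epsilon> :: real assume \<epsilon>: "0 < \<epsilon>"
    obtain \<delta> where \<delta>: "0 < \<delta>" "ball x \<delta> \<subseteq> ball p r"
      using assms(3) open_ball open_contains_ball by blast
    define s where "s = min \<epsilon> \<delta> / 2"
    have s: "0 < s" "s < \<epsilon>" "s < \<delta>" using \<epsilon> \<delta> by (auto simp: s_def)
    then have "x + s *\<^sub>R e \<in> ball p r" using \<delta>(2) ch(1) by (auto simp: dist_norm subset_iff)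
    then have "x + s *\<^sub>R e \<in> \<Omega>" using ch(2,3) assms(4) s(1) by auto
    moreover have "dist (x + s *\<^sub>R e) x < \<epsilon>" using s ch(1) by (simp add: dist_norm)
    ultimately show "\<exists>y\<in>\<Omega>. dist y x < \<epsilon>" by blast
  qed
  ultimately show ?thesis using assms(2) by (simp add: frontier_def interior_open)
qed

text \<open>The foot point \<open>x - \<rho>(x) e\<close> moves \<open>x\<close> to the boundary. By \<open>lborel_le_hausdorff2\<close> the image of
  volume under this map is at most \<open>32 \<epsilon> / \<pi>\<close> times surface measure on all Borel sets, and an inequality of
  measures carries over to integrals.\<close>

lemma nn_integral_foot_le_surface:
  fixes h :: "real^3 \<Rightarrow> ennreal"
  assumes e: "norm e = 1" and \<epsilon>: "0 < \<epsilon>" and \<rho>: "\<rho> \<in> borel_measurable borel"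
    and h: "h \<in> borel_measurable borel" and T: "T \<in> sets borel"
    and foot: "\<And>x. x \<in> T \<Longrightarrow> 0 \<le> \<rho> x \<and> \<rho> x \<le> \<epsilon> \<and> x - \<rho> x *\<^sub>R e \<in> frontier \<Omega>"
  shows "(\<integral>\<^sup>+x. h (x - \<rho> x *\<^sub>R e) * indicator T x \<partial>lborel)
    \<le> ennreal (32 / pi * \<epsilon>) * (\<integral>\<^sup>+x. h x \<partial>surface \<Omega>)"
proof -
  define c where "c = ennreal (32 / pi * \<epsilon>)"
  define \<pi> where "\<pi> x = x - \<rho> x *\<^sub>R e" for x
  have \<pi>: "\<pi> \<in> borel_measurable borel" unfolding \<pi>_def using \<rho> by measurable
  have fr: "frontier \<Omega> \<in> sets borel" by (simp add: frontier_def)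
  define N where "N = distr (density lborel (indicator T)) borel \<pi>"
  define N' where "N' = scale_measure c (density hausdorff2 (indicator (frontier \<Omega>)))"
  have sets: "sets N = sets N'" by (simp add: N_def N'_def)
  have "emeasure N A \<le> emeasure N' A" if "A \<in> sets N" for A
  proof -
    have A: "A \<in> sets borel" using that by (simp add: N_def)
    define B where "B = \<pi> -` A \<inter> T"
    have B: "B \<in> sets borel" using measurable_sets[OF \<pi> A] T by (simp add: B_def sets.Int)
    have "emeasure N A = emeasure (density lborel (indicator T)) (\<pi> -` A)"
      unfolding N_def using A \<pi> by (subst emeasure_distr) auto
    also have "\<dots> = (\<integral>\<^sup>+x. indicator T x * indicator (\<pi> -` A) x \<partial>lborel)"
      using measurable_sets[OF \<pi> A] T by (subst emeasure_density) auto
    also have "\<dots> = (\<integral>\<^sup>+x. indicator B x \<partial>lborel)"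
      by (intro nn_integral_cong) (auto simp: B_def indicator_def)
    also have "\<dots> = emeasure lborel B" using B by simp
    also have "\<dots> \<le> c * hausdorff2_outer (A \<inter> frontier \<Omega>)"
      unfolding c_def
    proof (rule lborel_le_hausdorff2[OF e \<epsilon> B])
      show "B \<subseteq> {c + s *\<^sub>R e |c s. c \<in> A \<inter> frontier \<Omega> \<and> 0 \<le> s \<and> s \<le> \<epsilon>}"
      proof
        fix x assume x: "x \<in> B"
        then have "x = \<pi> x + \<rho> x *\<^sub>R e" "\<pi> x \<in> A \<inter> frontier \<Omega>" "0 \<le> \<rho> x" "\<rho> x \<le> \<epsilon>"
          using foot[of x] by (auto simp: B_def \<pi>_def)
        then show "x \<in> {c + s *\<^sub>R e |c s. c \<in> A \<inter> frontier \<Omega> \<and> 0 \<le> s \<and> s \<le> \<epsilon>}" by blast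
      qed
    qed
    also have "hausdorff2_outer (A \<inter> frontier \<Omega>) = (\<integral>\<^sup>+x. indicator (frontier \<Omega>) x * indicator A x \<partial>hausdorff2)"
    proof -
      have "(\<integral>\<^sup>+x. indicator (frontier \<Omega>) x * indicator A x \<partial>hausdorff2)
          = (\<integral>\<^sup>+x. indicator (A \<inter> frontier \<Omega>) x \<partial>hausdorff2)"
        by (intro nn_integral_cong) (auto simp: indicator_def)
      also have "\<dots> = hausdorff2_outer (A \<inter> frontier \<Omega>)"
        using A fr by (simp add: emeasure_hausdorff2)
      finally show ?thesis by simp
    qed
    also have "c * \<dots> = emeasure N' A"
    proof -
      have "indicator (frontier \<Omega>) \<in> borel_measurable hausdorff2"
        by (rule borel_measurable_indicator) (simp add: fr)
      then show ?thesis unfolding N'_def using A by (subst emeasure_scale_measure, subst emeasure_density) auto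
    qed
    finally show ?thesis .
  qed
  then have "N \<le> N'" using le_measure[OF sets] by blast
  have "(\<integral>\<^sup>+x. h (\<pi> x) * indicator T x \<partial>lborel) = (\<integral>\<^sup>+x. h x \<partial>N)"
    unfolding N_def using \<pi> h T
    by (subst nn_integral_distr) (auto simp: nn_integral_density mult.commute measurable_compose[OF \<pi> h])
  also have "\<dots> \<le> (\<integral>\<^sup>+x. h x \<partial>N')" by (rule nn_integral_mono_measure[OF sets \<open>N \<le> N'\<close>])
  also have "\<dots> = c * (\<integral>\<^sup>+x. h x * indicator (frontier \<Omega>) x \<partial>hausdorff2)"
  proof -
    have h': "h \<in> borel_measurable (density hausdorff2 (indicator (frontier \<Omega>)))"
      "h \<in> borel_measurable hausdorff2" "indicator (frontier \<Omega>) \<in> borel_measurable hausdorff2"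
      using h fr by (simp_all cong: measurable_cong_sets)
    show ?thesis
      unfolding N'_def nn_integral_scale_measure[OF h'(1)] nn_integral_density[OF h'(3,2)]
      by (simp add: mult.commute)
  qed
  also have "(\<integral>\<^sup>+x. h x * indicator (frontier \<Omega>) x \<partial>hausdorff2) = (\<integral>\<^sup>+x. h x \<partial>surface \<Omega>)"
    unfolding surface_def using fr by (subst nn_integral_restrict_space) auto
  finally show ?thesis by (simp add: c_def \<pi>_def)
qed

lemma FTC_square_bound:
  fixes f f' :: "real \<Rightarrow> real"
  assumes "a \<le> b" "\<And>s. (f has_real_derivative f' s) (at s)" "continuous_on UNIV f'"
  shows "ennreal ((f b - f a)\<^sup>2) \<le> ennreal (b - a) * (\<integral>\<^sup>+s. ennreal ((f' s)\<^sup>2) * indicator {a..b} s \<partial>lborel)"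
proof -
  have m: "f' \<in> borel_measurable borel" using assms(3) by (rule borel_measurable_continuous_onI)
  have ftc: "(\<integral>s. f' s * indicator {a..b} s \<partial>lborel) = f b - f a"
    by (rule integral_FTC_Icc_real[OF assms(1)])
       (use assms(2,3) in \<open>auto simp: continuous_on_eq_continuous_at\<close>)
  have int: "integrable lborel (\<lambda>s. f' s * indicator {a..b} s)"
    using borel_integrable_compact[of "{a..b}" f'] continuous_on_subset[OF assms(3)]
    by (simp add: mult.commute)
  have "ennreal \<bar>f b - f a\<bar> \<le> (\<integral>\<^sup>+s. ennreal (norm (f' s * indicator {a..b} s)) \<partial>lborel)"
    using integral_norm_bound_ennreal[OF int] unfolding ftc by simp
  also have "\<dots> = (\<integral>\<^sup>+s. indicator {a..b} s * (ennreal \<bar>f' s\<bar> * indicator {a..b} s) \<partial>lborel)"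
    by (intro nn_integral_cong) (auto simp: indicator_def)
  finally have "(ennreal \<bar>f b - f a\<bar>)\<^sup>2
      \<le> (\<integral>\<^sup>+s. indicator {a..b} s * (ennreal \<bar>f' s\<bar> * indicator {a..b} s) \<partial>lborel)\<^sup>2"
    by (intro power_mono) auto
  also have "\<dots> \<le> (\<integral>\<^sup>+s. (indicator {a..b} s)\<^sup>2 \<partial>lborel) * (\<integral>\<^sup>+s. (ennreal \<bar>f' s\<bar> * indicator {a..b} s)\<^sup>2 \<partial>lborel)"
    by (rule Cauchy_Schwarz_nn_integral) (use m in measurable)
  also have "(\<integral>\<^sup>+s. (indicator {a..b} s)\<^sup>2 \<partial>lborel) = (\<integral>\<^sup>+s. indicator {a..b} s \<partial>lborel)"
    by (intro nn_integral_cong) (auto simp: indicator_def)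
  also have "(\<integral>\<^sup>+s. indicator {a..b} s \<partial>lborel) = ennreal (b - a)"
    using assms(1) by simp
  also have "(\<integral>\<^sup>+s. (ennreal \<bar>f' s\<bar> * indicator {a..b} s)\<^sup>2 \<partial>lborel)
      = (\<integral>\<^sup>+s. ennreal ((f' s)\<^sup>2) * indicator {a..b} s \<partial>lborel)"
    by (intro nn_integral_cong) (auto simp: indicator_def ennreal_power)
  finally show ?thesis by (simp add: ennreal_power)
qed

lemma nn_integral_translate:
  fixes g :: "real^3 \<Rightarrow> ennreal"
  assumes "g \<in> borel_measurable borel"
  shows "(\<integral>\<^sup>+x. g (x - v) \<partial>lborel) = (\<integral>\<^sup>+x. g x \<partial>lborel)"
proof -
  have "(\<integral>\<^sup>+x. g x \<partial>lborel) = (\<integral>\<^sup>+x. g x \<partial>distr lborel borel ((+) (- v)))"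
    by (simp add: lborel_distr_plus)
  also have "\<dots> = (\<integral>\<^sup>+x. g (- v + x) \<partial>lborel)"
    using assms by (intro nn_integral_distr) auto
  finally show ?thesis by (simp add: add.commute)
qed

text \<open>On the segment from \<open>x\<close> to its foot point, \<open>\<phi>(x)\<^sup>2\<close> is at most twice the squared boundary
  value plus \<open>2 \<epsilon>\<close> times the integral of \<open>\<bar>D\<bar>\<^sup>2\<close> over the segment. Integrated over the strip, the first term is
  a surface integral by \<open>nn_integral_foot_le_surface\<close>; in the second, Tonelli's theorem and
  translation invariance produce one more factor \<open>\<epsilon>\<close>. The hypothesis on \<open>\<epsilon>\<close> keeps
  the segments inside the chart.\<close>

lemma strip_estimate:
  assumes ch: "straight_chart \<Omega> p r e \<rho> D\<rho>" and \<Omega>: "open \<Omega>" and K: "closed K" "K \<subseteq> ball p r"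
    and \<epsilon>: "0 < \<epsilon>" "\<And>x s. x \<in> K \<Longrightarrow> 0 \<le> s \<Longrightarrow> s \<le> \<epsilon> \<Longrightarrow> x - s *\<^sub>R e \<in> ball p r"
    and \<phi>: "C1_with_grad \<phi> D" "\<And>x. x \<notin> K \<Longrightarrow> \<phi> x = 0"
  defines "S \<equiv> strip p r \<rho> \<epsilon>"
  shows "(\<integral>\<^sup>+x. ennreal ((\<phi> x)\<^sup>2) * indicator S x \<partial>lborel)
    \<le> ennreal (64 / pi * \<epsilon>) * (\<integral>\<^sup>+x. ennreal ((\<phi> x)\<^sup>2) \<partial>surface \<Omega>)
      + ennreal (2 * \<epsilon>\<^sup>2) * (\<integral>\<^sup>+x. ennreal ((norm (D x))\<^sup>2) * indicator S x \<partial>lborel)"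
proof -
  have e: "norm e = 1" and \<rho>C1: "C1_with_grad \<rho> D\<rho>"
    and \<rho>e: "\<And>x s. \<rho> (x + s *\<^sub>R e) = \<rho> x + s"
    using ch by (auto simp: straight_chart_def)
  have \<rho>m: "\<rho> \<in> borel_measurable borel" and \<rho>e': "\<rho> (x - s *\<^sub>R e) = \<rho> x - s" for x s
    using C1_with_grad_D(4)[OF \<rho>C1] \<rho>e[of x "-s"] by auto
  note c\<phi> = C1_with_grad_D[OF \<phi>(1)]
  have "open S" unfolding S_def by (rule open_strip[OF \<rho>C1])
  then have Sb: "S \<in> sets borel" by simp
  define T where "T = S \<inter> K"
  have Tb: "T \<in> sets borel" using Sb K(1) by (simp add: T_def)
  define g where "g x = ennreal ((norm (D x))\<^sup>2) * indicator S x" for x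
  have gm: "g \<in> borel_measurable borel" unfolding g_def using c\<phi>(5) Sb by measurable
  define I where "I x = (\<integral>\<^sup>+s. indicator {0..\<epsilon>} s * g (x - s *\<^sub>R e) \<partial>lborel)" for x
  have pw: "ennreal ((\<phi> x)\<^sup>2) * indicator S x \<le> 2 * (ennreal ((\<phi> (x - \<rho> x *\<^sub>R e))\<^sup>2) * indicator T x)
      + ennreal (2 * \<epsilon>) * I x" for x
  proof (cases "x \<in> T")
    case True
    then have x: "x \<in> K" "0 < \<rho> x" "\<rho> x < \<epsilon>" by (auto simp: T_def S_def)
    define f where "f s = \<phi> (x - s *\<^sub>R e)" for s
    define f' where "f' s = - (e \<bullet> D (x - s *\<^sub>R e))" for s
    have d: "(f has_real_derivative f' s) (at s)" for s
    proof -
      have "((\<lambda>s. x - s *\<^sub>R e) has_derivative (\<lambda>t. - (t *\<^sub>R e))) (at s)"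
        by (auto intro!: derivative_eq_intros)
      from has_derivative_compose[OF this c\<phi>(1)]
      have "(f has_derivative (\<lambda>t. t * f' s)) (at s)"
        unfolding f_def f'_def by (simp add: inner_commute)
      then show ?thesis by (simp add: has_field_derivative_def mult_commute_abs)
    qed
    have cf': "continuous_on UNIV f'"
      unfolding f'_def by (intro continuous_intros continuous_on_compose2[OF c\<phi>(2)[of UNIV]]) auto
    have ineq: "ennreal ((f (\<rho> x) - f 0)\<^sup>2)
        \<le> ennreal (\<rho> x - 0) * (\<integral>\<^sup>+s. ennreal ((f' s)\<^sup>2) * indicator {0..\<rho> x} s \<partial>lborel)"
      by (rule FTC_square_bound[OF _ d cf']) (use x in simp)
    also have "\<dots> \<le> ennreal \<epsilon> * I x"
    proof (rule mult_mono)
      show "(\<integral>\<^sup>+s. ennreal ((f' s)\<^sup>2) * indicator {0..\<rho> x} s \<partial>lborel)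
          \<le> I x"
        unfolding I_def
      proof (rule nn_integral_mono_AE)
        show "AE s in lborel. ennreal ((f' s)\<^sup>2) * indicator {0..\<rho> x} s
            \<le> indicator {0..\<epsilon>} s * g (x - s *\<^sub>R e)"
          \<comment> \<open>The foot point itself lies on the boundary and not in \<open>S\<close>; it is a single parameter value.\<close>
          using AE_lborel_singleton[of "\<rho> x"]
        proof eventually_elim
          case (elim s)
          show ?case
          proof (cases "s \<in> {0..\<rho> x}")
            case True
            then have s: "0 \<le> s" "s < \<rho> x" "s \<le> \<epsilon>" using elim x by auto
            then have "x - s *\<^sub>R e \<in> S" using \<epsilon>(2)[OF x(1), of s] x by (simp add: S_def \<rho>e')
            moreover have "(f' s)\<^sup>2 \<le> (norm (D (x - s *\<^sub>R e)))\<^sup>2"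
              unfolding f'_def
              using Cauchy_Schwarz_ineq2[of e "D (x - s *\<^sub>R e)"] e
              by (simp add: abs_le_square_iff[symmetric])
            ultimately show ?thesis using True s by (simp add: g_def ennreal_leI)
          qed simp
        qed
      qed
    qed (use x in \<open>auto intro: ennreal_leI\<close>)
    finally have *: "ennreal ((f (\<rho> x) - f 0)\<^sup>2)
        \<le> ennreal \<epsilon> * I x" .
    have "(\<phi> x)\<^sup>2 \<le> 2 * (f (\<rho> x))\<^sup>2 + 2 * (f (\<rho> x) - f 0)\<^sup>2"
    proof -
      have "0 \<le> (2 * f (\<rho> x) - f 0)\<^sup>2" by simp
      then show ?thesis by (simp add: f_def power2_eq_square algebra_simps)
    qed
    then have "ennreal ((\<phi> x)\<^sup>2) \<le> ennreal (2 * (f (\<rho> x))\<^sup>2 + 2 * (f (\<rho> x) - f 0)\<^sup>2)" by (rule ennreal_leI)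
    also have "\<dots> = 2 * ennreal ((f (\<rho> x))\<^sup>2) + 2 * ennreal ((f (\<rho> x) - f 0)\<^sup>2)"
      by (simp add: ennreal_mult ennreal_plus)
    also have "\<dots> \<le> 2 * ennreal ((f (\<rho> x))\<^sup>2)
        + 2 * (ennreal \<epsilon> * I x)"
      by (intro add_left_mono mult_left_mono *) simp
    finally show ?thesis using True \<epsilon>(1)
      by (simp add: f_def T_def ennreal_mult mult.assoc)
  next
    case False
    then show ?thesis using \<phi>(2)[of x] by (cases "x \<in> S") (auto simp: T_def)
  qed
  have gm2: "(\<lambda>(x, s). indicator {0..\<epsilon>} s * g (x - s *\<^sub>R e)) \<in> borel_measurable (lborel \<Otimes>\<^sub>M lborel)"
    using gm by measurable
  have Im: "I \<in> borel_measurable lborel"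
    using lborel.borel_measurable_nn_integral[OF gm2] unfolding I_def[abs_def] by simp
  have "(\<integral>\<^sup>+x. ennreal ((\<phi> x)\<^sup>2) * indicator S x \<partial>lborel)
      \<le> (\<integral>\<^sup>+x. 2 * (ennreal ((\<phi> (x - \<rho> x *\<^sub>R e))\<^sup>2) * indicator T x)
        + ennreal (2 * \<epsilon>) * I x \<partial>lborel)"
    by (intro nn_integral_mono pw)
  also have "\<dots> = (\<integral>\<^sup>+x. 2 * (ennreal ((\<phi> (x - \<rho> x *\<^sub>R e))\<^sup>2) * indicator T x) \<partial>lborel)
      + (\<integral>\<^sup>+x. ennreal (2 * \<epsilon>) * I x \<partial>lborel)"
  proof (rule nn_integral_add)
    show "(\<lambda>x. 2 * (ennreal ((\<phi> (x - \<rho> x *\<^sub>R e))\<^sup>2) * indicator T x)) \<in> borel_measurable lborel"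
      using c\<phi>(4) \<rho>m Tb by measurable
    show "(\<lambda>x. ennreal (2 * \<epsilon>) * I x) \<in> borel_measurable lborel"
      using Im by simp
  qed
  also have "(\<integral>\<^sup>+x. 2 * (ennreal ((\<phi> (x - \<rho> x *\<^sub>R e))\<^sup>2) * indicator T x) \<partial>lborel)
      = 2 * (\<integral>\<^sup>+x. ennreal ((\<phi> (x - \<rho> x *\<^sub>R e))\<^sup>2) * indicator T x \<partial>lborel)"
    by (rule nn_integral_cmult) (use c\<phi>(4) \<rho>m Tb in measurable)
  also have "(\<integral>\<^sup>+x. ennreal (2 * \<epsilon>) * I x \<partial>lborel)
      = ennreal (2 * \<epsilon>) * (\<integral>\<^sup>+x. I x \<partial>lborel)"
    by (rule nn_integral_cmult) (use Im in simp)
  also have "(\<integral>\<^sup>+x. I x \<partial>lborel)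
      = (\<integral>\<^sup>+s. (\<integral>\<^sup>+x. indicator {0..\<epsilon>} s * g (x - s *\<^sub>R e) \<partial>lborel) \<partial>lborel)"
    unfolding I_def by (rule lborel_pair.Fubini'[OF gm2, symmetric])
  also have "\<dots> = (\<integral>\<^sup>+s. indicator {0..\<epsilon>} s * (\<integral>\<^sup>+x. g x \<partial>lborel) \<partial>lborel)"
  proof (intro nn_integral_cong)
    fix s :: real
    have "(\<integral>\<^sup>+x. indicator {0..\<epsilon>} s * g (x - s *\<^sub>R e) \<partial>lborel)
        = indicator {0..\<epsilon>} s * (\<integral>\<^sup>+x. g (x - s *\<^sub>R e) \<partial>lborel)"
      by (rule nn_integral_cmult) (use gm in measurable)
    then show "(\<integral>\<^sup>+x. indicator {0..\<epsilon>} s * g (x - s *\<^sub>R e) \<partial>lborel)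
        = indicator {0..\<epsilon>} s * (\<integral>\<^sup>+x. g x \<partial>lborel)"
      by (simp only: nn_integral_translate[OF gm])
  qed
  also have "\<dots> = ennreal \<epsilon> * (\<integral>\<^sup>+x. g x \<partial>lborel)"
    using \<epsilon>(1) by (subst nn_integral_multc) auto
  also have "2 * (\<integral>\<^sup>+x. ennreal ((\<phi> (x - \<rho> x *\<^sub>R e))\<^sup>2) * indicator T x \<partial>lborel)
      + ennreal (2 * \<epsilon>) * (ennreal \<epsilon> * (\<integral>\<^sup>+x. g x \<partial>lborel))
      \<le> 2 * (ennreal (32 / pi * \<epsilon>) * (\<integral>\<^sup>+x. ennreal ((\<phi> x)\<^sup>2) \<partial>surface \<Omega>))
      + ennreal (2 * \<epsilon>) * (ennreal \<epsilon> * (\<integral>\<^sup>+x. g x \<partial>lborel))"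
  proof (intro add_right_mono mult_left_mono nn_integral_foot_le_surface[OF e \<epsilon>(1) \<rho>m _ Tb])
    show "(\<lambda>x. ennreal ((\<phi> x)\<^sup>2)) \<in> borel_measurable borel" using c\<phi>(4) by measurable
    fix x assume "x \<in> T"
    then have x: "x \<in> K" "0 < \<rho> x" "\<rho> x < \<epsilon>" by (auto simp: T_def S_def)
    then have "x - \<rho> x *\<^sub>R e \<in> frontier \<Omega>"
      by (intro straight_chart_foot[OF ch \<Omega> \<epsilon>(2)]) (auto simp: \<rho>e')
    then show "0 \<le> \<rho> x \<and> \<rho> x \<le> \<epsilon> \<and> x - \<rho> x *\<^sub>R e \<in> frontier \<Omega>" using x by simp
  qed simp
  also have "\<dots> = ennreal (64 / pi * \<epsilon>) * (\<integral>\<^sup>+x. ennreal ((\<phi> x)\<^sup>2) \<partial>surface \<Omega>)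
      + ennreal (2 * \<epsilon>\<^sup>2) * (\<integral>\<^sup>+x. g x \<partial>lborel)"
  proof -
    have "ennreal 2 * ennreal (32 / pi * \<epsilon>) = ennreal (2 * (32 / pi * \<epsilon>))"
      by (rule ennreal_mult[symmetric]) (use \<epsilon>(1) in simp_all)
    then have 1: "2 * ennreal (32 / pi * \<epsilon>) = ennreal (64 / pi * \<epsilon>)" by simp
    have "ennreal (2 * \<epsilon>) * ennreal \<epsilon> = ennreal ((2 * \<epsilon>) * \<epsilon>)"
      by (rule ennreal_mult[symmetric]) (use \<epsilon>(1) in simp_all)
    then have 2: "ennreal (2 * \<epsilon>) * ennreal \<epsilon> = ennreal (2 * \<epsilon>\<^sup>2)"
      by (simp add: power2_eq_square mult.assoc)
    show ?thesis unfolding mult.assoc[symmetric] 1 2 ..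
  qed
  finally show ?thesis by (simp add: g_def)
qed

section \<open>Limits of \<open>C\<^sup>1\<close> functions with vanishing boundary values\<close>

lemma nn_integral_surface_bounded_mult:
  assumes "\<And>x. x \<in> frontier \<Omega> \<Longrightarrow> \<bar>\<zeta> x\<bar> \<le> B" "0 \<le> B" "\<phi> \<in> borel_measurable borel"
  shows "(\<integral>\<^sup>+x. ennreal ((\<zeta> x * \<phi> x)\<^sup>2) \<partial>surface \<Omega>)
    \<le> ennreal (B\<^sup>2) * (\<integral>\<^sup>+x. ennreal ((\<phi> x)\<^sup>2) \<partial>surface \<Omega>)"
proof -
  have sp: "space (surface \<Omega>) = frontier \<Omega>" by (simp add: surface_def space_restrict_space)
  have m: "\<phi> \<in> borel_measurable (surface \<Omega>)"
    unfolding surface_def using assms(3)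
    by (intro measurable_restrict_space1) (simp cong: measurable_cong_sets)
  have "(\<integral>\<^sup>+x. ennreal ((\<zeta> x * \<phi> x)\<^sup>2) \<partial>surface \<Omega>)
      \<le> (\<integral>\<^sup>+x. ennreal (B\<^sup>2) * ennreal ((\<phi> x)\<^sup>2) \<partial>surface \<Omega>)"
  proof (rule nn_integral_mono)
    fix x assume "x \<in> space (surface \<Omega>)"
    then have "\<bar>\<zeta> x\<bar>\<^sup>2 \<le> B\<^sup>2" using assms(1)[of x] sp by (intro power_mono) auto
    then have "(\<zeta> x * \<phi> x)\<^sup>2 \<le> B\<^sup>2 * (\<phi> x)\<^sup>2"
      by (simp add: power_mult_distrib mult_right_mono)
    then show "ennreal ((\<zeta> x * \<phi> x)\<^sup>2) \<le> ennreal (B\<^sup>2) * ennreal ((\<phi> x)\<^sup>2)"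
      by (simp add: ennreal_mult[symmetric] ennreal_leI)
  qed
  also have "\<dots> = ennreal (B\<^sup>2) * (\<integral>\<^sup>+x. ennreal ((\<phi> x)\<^sup>2) \<partial>surface \<Omega>)"
    by (rule nn_integral_cmult) (use m in measurable)
  finally show ?thesis .
qed

context bounded_open
begin

lemma L2_norm_eq_nn_integral:
  fixes f :: "real^3 \<Rightarrow> 'b::euclidean_space"
  assumes "f \<in> L2 dx" "\<And>x. x \<notin> \<Omega> \<Longrightarrow> f x = 0"
  shows "ennreal ((L2_norm dx f)\<^sup>2) = (\<integral>\<^sup>+x. ennreal ((norm (f x))\<^sup>2) \<partial>lborel)"
proof -
  have "ennreal ((L2_norm dx f)\<^sup>2) = (\<integral>\<^sup>+x. ennreal ((norm (f x))\<^sup>2) \<partial>dx)"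
    unfolding L2_norm_sq using L2_D(2)[OF assms(1)] by (intro nn_integral_eq_integral[symmetric]) auto
  also have "\<dots> = (\<integral>\<^sup>+x. ennreal ((norm (f x))\<^sup>2) * indicator \<Omega> x \<partial>lebesgue)"
    by (rule nn_integral_restrict_space) simp
  also have "\<dots> = (\<integral>\<^sup>+x. ennreal ((norm (f x))\<^sup>2) \<partial>lebesgue)"
    by (intro nn_integral_cong) (auto simp: indicator_def assms(2))
  also have "\<dots> = (\<integral>\<^sup>+x. ennreal ((norm (f x))\<^sup>2) \<partial>lborel)" by (rule nn_integral_completion)
  finally show ?thesis .
qed

text \<open>The closure of the test functions in \<open>H\<^sup>1\<close>, with the gradient as a separate argument: the
  gradient of a product with a cut-off is then an explicit expression instead of a weak gradient that is determined
  only almost everywhere. The same applies to \<open>C1_limit\<close>.\<close>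

definition in_test_closure :: "(real^3 \<Rightarrow> real) \<Rightarrow> (real^3 \<Rightarrow> real^3) \<Rightarrow> bool" where
  "in_test_closure w G \<longleftrightarrow> w \<in> L2 dx \<and> G \<in> L2 dx \<and>
     (\<forall>\<delta>>0. \<exists>\<psi> E. test_with_grad \<Omega> \<psi> E \<and>
        L2_norm dx (\<lambda>x. \<psi> x - w x) < \<delta> \<and>
        L2_norm dx (\<lambda>x. E x - G x) < \<delta>)"

lemma in_test_closure_add:
  assumes "in_test_closure w G" "in_test_closure w' G'"
  shows "in_test_closure (\<lambda>x. w x + w' x) (\<lambda>x. G x + G' x)"
  unfolding in_test_closure_def
proof (intro conjI allI impI)
  note a = assms[unfolded in_test_closure_def]
  show "(\<lambda>x. w x + w' x) \<in> L2 dx" "(\<lambda>x. G x + G' x) \<in> L2 dx"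
    using a by (auto intro: L2_add)
  fix \<delta> :: real assume "0 < \<delta>"
  then have d2: "0 < \<delta> / 2" by simp
  obtain \<psi> E where 1: "test_with_grad \<Omega> \<psi> E" "L2_norm dx (\<lambda>x. \<psi> x - w x) < \<delta> / 2"
    "L2_norm dx (\<lambda>x. E x - G x) < \<delta> / 2" using a(1) d2 by blast
  obtain \<psi>' E' where 2: "test_with_grad \<Omega> \<psi>' E'" "L2_norm dx (\<lambda>x. \<psi>' x - w' x) < \<delta> / 2"
    "L2_norm dx (\<lambda>x. E' x - G' x) < \<delta> / 2" using a(2) d2 by blast
  have C1: "C1_with_grad \<psi> E" "C1_with_grad \<psi>' E'" using 1(1) 2(1) by (auto simp: test_with_grad_def)
  have split: "L2_norm dx (\<lambda>x. (f x + f' x) - (h x + h' x)) < \<delta>"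
    if "f \<in> L2 dx" "f' \<in> L2 dx" "h \<in> L2 dx" "h' \<in> L2 dx"
      "L2_norm dx (\<lambda>x. f x - h x) < \<delta> / 2" "L2_norm dx (\<lambda>x. f' x - h' x) < \<delta> / 2"
    for f f' h h' :: "real^3 \<Rightarrow> 'b::euclidean_space"
  proof -
    have "L2_norm dx (\<lambda>x. (f x - h x) + (f' x - h' x)) < \<delta>"
      using L2_norm_triangle[OF L2_diff[OF that(1,3)] L2_diff[OF that(2,4)]] that(5,6) by linarith
    then show ?thesis by (simp add: algebra_simps)
  qed
  show "\<exists>\<psi> E. test_with_grad \<Omega> \<psi> E \<and>
      L2_norm dx (\<lambda>x. \<psi> x - (w x + w' x)) < \<delta> \<and>
      L2_norm dx (\<lambda>x. E x - (G x + G' x)) < \<delta>"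
    using test_add[OF 1(1) 2(1)] a
      split[OF C1_L2(1)[OF C1(1)] C1_L2(1)[OF C1(2)] _ _ 1(2) 2(2)]
      split[OF C1_L2(2)[OF C1(1)] C1_L2(2)[OF C1(2)] _ _ 1(3) 2(3)]
    by (intro exI[of _ "\<lambda>x. \<psi> x + \<psi>' x"] exI[of _ "\<lambda>x. E x + E' x"]) simp
qed

definition C1_limit :: "(nat \<Rightarrow> real^3 \<Rightarrow> real) \<Rightarrow> (nat \<Rightarrow> real^3 \<Rightarrow> real^3) \<Rightarrow>
    (real^3 \<Rightarrow> real) \<Rightarrow> (real^3 \<Rightarrow> real^3) \<Rightarrow> bool" where
  "C1_limit \<phi> D w G \<longleftrightarrow> (\<forall>n. C1_with_grad (\<phi> n) (D n)) \<and>
     w \<in> L2 dx \<and> G \<in> L2 dx \<and>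
     (\<lambda>n. L2_norm dx (\<lambda>x. \<phi> n x - w x)) \<longlonglongrightarrow> 0 \<and>
     (\<lambda>n. L2_norm dx (\<lambda>x. D n x - G x)) \<longlonglongrightarrow> 0"

lemma C1_limit_test:
  assumes "C1_limit \<phi> D w G" "\<And>n. test_with_grad \<Omega> (\<phi> n) (D n)"
  shows "in_test_closure w G"
  unfolding in_test_closure_def
proof (intro conjI allI impI)
  show "w \<in> L2 dx" "G \<in> L2 dx" using assms(1) by (auto simp: C1_limit_def)
  fix \<delta> :: real assume \<delta>: "0 < \<delta>"
  have "\<forall>\<^sub>F n in sequentially. L2_norm dx (\<lambda>x. \<phi> n x - w x) < \<delta>
      \<and> L2_norm dx (\<lambda>x. D n x - G x) < \<delta>"
    using assms(1) \<delta> unfolding C1_limit_def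
    by (intro eventually_conj order_tendstoD(2)[of _ 0]) auto
  then obtain n where "L2_norm dx (\<lambda>x. \<phi> n x - w x) < \<delta>
      \<and> L2_norm dx (\<lambda>x. D n x - G x) < \<delta>"
    unfolding eventually_sequentially by blast
  then show "\<exists>\<psi> E. test_with_grad \<Omega> \<psi> E \<and>
        L2_norm dx (\<lambda>x. \<psi> x - w x) < \<delta> \<and>
        L2_norm dx (\<lambda>x. E x - G x) < \<delta>" using assms(2) by blast
qed

lemma C1_bounded_on_closure:
  assumes "C1_with_grad \<zeta> Z"
  obtains B where "0 \<le> B" "\<And>x. x \<in> closure \<Omega> \<Longrightarrow> \<bar>\<zeta> x\<bar> \<le> B" "\<And>x. x \<in> closure \<Omega> \<Longrightarrow> norm (Z x) \<le> B"
proof -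
  have "bounded (\<zeta> ` closure \<Omega>)" "bounded (Z ` closure \<Omega>)"
    using C1_with_grad_D(2,3)[OF assms] bounded_\<Omega>
    by (intro compact_imp_bounded compact_continuous_image; simp)+
  then obtain B1 B2 where B: "\<forall>y\<in>\<zeta> ` closure \<Omega>. norm y \<le> B1" "\<forall>y\<in>Z ` closure \<Omega>. norm y \<le> B2"
    unfolding bounded_iff by blast
  show ?thesis
  proof (rule that[of "max 0 (max B1 B2)"])
    show "\<bar>\<zeta> x\<bar> \<le> max 0 (max B1 B2)" if "x \<in> closure \<Omega>" for x
    proof -
      have "norm (\<zeta> x) \<le> B1" using B(1) that by blast
      then show ?thesis by simp
    qed
    show "norm (Z x) \<le> max 0 (max B1 B2)" if "x \<in> closure \<Omega>" for x
    proof -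
      have "norm (Z x) \<le> B2" using B(2) that by blast
      then show ?thesis by simp
    qed
  qed simp
qed

lemma C1_limit_mult:
  assumes "C1_with_grad \<zeta> Z" "C1_limit \<phi> D w G"
  shows "C1_limit (\<lambda>n x. \<zeta> x * \<phi> n x) (\<lambda>n x. \<zeta> x *\<^sub>R D n x + \<phi> n x *\<^sub>R Z x)
      (\<lambda>x. \<zeta> x * w x) (\<lambda>x. \<zeta> x *\<^sub>R G x + w x *\<^sub>R Z x)"
proof -
  have C1: "\<And>n. C1_with_grad (\<phi> n) (D n)" and w: "w \<in> L2 dx" and G: "G \<in> L2 dx"
    and lim: "(\<lambda>n. L2_norm dx (\<lambda>x. \<phi> n x - w x)) \<longlonglongrightarrow> 0" "(\<lambda>n. L2_norm dx (\<lambda>x. D n x - G x)) \<longlonglongrightarrow> 0"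
    using assms(2) by (auto simp: C1_limit_def)
  obtain B where B: "0 \<le> B" "\<And>x. x \<in> closure \<Omega> \<Longrightarrow> \<bar>\<zeta> x\<bar> \<le> B" "\<And>x. x \<in> closure \<Omega> \<Longrightarrow> norm (Z x) \<le> B"
    by (rule C1_bounded_on_closure[OF assms(1)]) (rule that)
  have B\<Omega>: "\<bar>\<zeta> x\<bar> \<le> B" "norm (Z x) \<le> B" if "x \<in> space dx" for x
    using B(2,3) space_lebesgue_on_\<Omega>[OF that] closure_subset by blast+
  have \<zeta>m: "\<zeta> \<in> borel_measurable dx" and Zm: "Z \<in> borel_measurable dx"
    using C1_with_grad_D(4,5)[OF assms(1)] by (auto intro: borel_measurable_lebesgue_on)
  have mult\<zeta>: "(\<lambda>x. \<zeta> x *\<^sub>R f x) \<in> L2 dx" if "f \<in> L2 dx" for f :: "real^3 \<Rightarrow> 'b::euclidean_space"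
    by (rule L2_mult_bounded[OF that \<zeta>m B\<Omega>(1)])
  have multZ: "(\<lambda>x. f x *\<^sub>R Z x) \<in> L2 dx" if "f \<in> L2 dx" for f :: "real^3 \<Rightarrow> real"
  proof (rule L2_bound[OF that, of _ B])
    show "(\<lambda>x. f x *\<^sub>R Z x) \<in> borel_measurable dx" using L2_D(1)[OF that] Zm by measurable
    show "AE x in dx. norm (f x *\<^sub>R Z x) \<le> B * norm (f x)"
      using B\<Omega>(2) by (intro AE_I2) (simp add: mult.commute[of B] mult_left_mono)
  qed
  have norm\<zeta>: "L2_norm dx (\<lambda>x. \<zeta> x *\<^sub>R f x) \<le> B * L2_norm dx f" if "f \<in> L2 dx"
    for f :: "real^3 \<Rightarrow> 'b::euclidean_space"
    by (rule L2_norm_mono_AE[OF mult\<zeta>[OF that] that]) (use B\<Omega>(1) B(1) in \<open>auto intro!: AE_I2 mult_right_mono\<close>)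
  have normZ: "L2_norm dx (\<lambda>x. f x *\<^sub>R Z x) \<le> B * L2_norm dx f" if "f \<in> L2 dx" for f :: "real^3 \<Rightarrow> real"
  proof (rule L2_norm_mono_AE[OF multZ[OF that] that])
    show "AE x in dx. norm (f x *\<^sub>R Z x) \<le> B * norm (f x)"
      using B\<Omega>(2) by (intro AE_I2) (simp add: mult.commute[of B] mult_left_mono)
  qed (rule B(1))
  have d1: "(\<lambda>x. \<phi> n x - w x) \<in> L2 dx" and d2: "(\<lambda>x. D n x - G x) \<in> L2 dx" for n
    using C1_L2[OF C1] w G by (auto intro: L2_diff)
  show ?thesis
    unfolding C1_limit_def
  proof (intro conjI allI)
    show "C1_with_grad (\<lambda>x. \<zeta> x * \<phi> n x) (\<lambda>x. \<zeta> x *\<^sub>R D n x + \<phi> n x *\<^sub>R Z x)" for n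
      by (rule C1_mult[OF assms(1) C1])
    show "(\<lambda>x. \<zeta> x * w x) \<in> L2 dx" using mult\<zeta>[OF w] by simp
    show "(\<lambda>x. \<zeta> x *\<^sub>R G x + w x *\<^sub>R Z x) \<in> L2 dx" by (rule L2_add[OF mult\<zeta>[OF G] multZ[OF w]])
    show "(\<lambda>n. L2_norm dx (\<lambda>x. \<zeta> x * \<phi> n x - \<zeta> x * w x)) \<longlonglongrightarrow> 0"
    proof (rule Lim_null_comparison)
      show "\<forall>\<^sub>F n in sequentially. norm (L2_norm dx (\<lambda>x. \<zeta> x * \<phi> n x - \<zeta> x * w x))
          \<le> B * L2_norm dx (\<lambda>x. \<phi> n x - w x)"
        using norm\<zeta>[OF d1] by (intro always_eventually) (simp add: right_diff_distrib)
      show "(\<lambda>n. B * L2_norm dx (\<lambda>x. \<phi> n x - w x)) \<longlonglongrightarrow> 0"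
        using tendsto_mult_left[OF lim(1), of B] by simp
    qed
    show "(\<lambda>n. L2_norm dx (\<lambda>x. (\<zeta> x *\<^sub>R D n x + \<phi> n x *\<^sub>R Z x) - (\<zeta> x *\<^sub>R G x + w x *\<^sub>R Z x))) \<longlonglongrightarrow> 0"
    proof (rule Lim_null_comparison)
      have "L2_norm dx (\<lambda>x. (\<zeta> x *\<^sub>R D n x + \<phi> n x *\<^sub>R Z x) - (\<zeta> x *\<^sub>R G x + w x *\<^sub>R Z x))
          \<le> B * L2_norm dx (\<lambda>x. D n x - G x) + B * L2_norm dx (\<lambda>x. \<phi> n x - w x)" for n
      proof -
        have "(\<lambda>x. (\<zeta> x *\<^sub>R D n x + \<phi> n x *\<^sub>R Z x) - (\<zeta> x *\<^sub>R G x + w x *\<^sub>R Z x))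
            = (\<lambda>x. \<zeta> x *\<^sub>R (D n x - G x) + (\<phi> n x - w x) *\<^sub>R Z x)"
          by (simp add: fun_eq_iff algebra_simps)
        then show ?thesis
          using L2_norm_triangle[OF mult\<zeta>[OF d2[of n]] multZ[OF d1[of n]]] norm\<zeta>[OF d2[of n]] normZ[OF d1[of n]]
          by simp
      qed
      then show "\<forall>\<^sub>F n in sequentially. norm (L2_norm dx (\<lambda>x. (\<zeta> x *\<^sub>R D n x + \<phi> n x *\<^sub>R Z x) - (\<zeta> x *\<^sub>R G x + w x *\<^sub>R Z x)))
          \<le> B * L2_norm dx (\<lambda>x. D n x - G x) + B * L2_norm dx (\<lambda>x. \<phi> n x - w x)"
        by (intro always_eventually) simp
      show "(\<lambda>n. B * L2_norm dx (\<lambda>x. D n x - G x) + B * L2_norm dx (\<lambda>x. \<phi> n x - w x)) \<longlonglongrightarrow> 0"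
        using tendsto_add[OF tendsto_mult_left[OF lim(2), of B] tendsto_mult_left[OF lim(1), of B]] by simp
    qed
  qed
qed

definition surface_null :: "(nat \<Rightarrow> real^3 \<Rightarrow> real) \<Rightarrow> bool" where
  "surface_null \<phi> \<longleftrightarrow> (\<lambda>n. \<integral>\<^sup>+x. ennreal ((\<phi> n x)\<^sup>2) \<partial>dS) \<longlonglongrightarrow> 0"

lemma surface_null_mult:
  assumes "C1_with_grad \<zeta> Z" "surface_null \<phi>" "\<And>n. C1_with_grad (\<phi> n) (D n)"
  shows "surface_null (\<lambda>n x. \<zeta> x * \<phi> n x)"
proof -
  obtain B where B: "0 \<le> B" "\<And>x. x \<in> closure \<Omega> \<Longrightarrow> \<bar>\<zeta> x\<bar> \<le> B" "\<And>x. x \<in> closure \<Omega> \<Longrightarrow> norm (Z x) \<le> B"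
    by (rule C1_bounded_on_closure[OF assms(1)]) (rule that)
  have "(\<lambda>n. ennreal (B\<^sup>2) * (\<integral>\<^sup>+x. ennreal ((\<phi> n x)\<^sup>2) \<partial>dS)) \<longlonglongrightarrow> ennreal (B\<^sup>2) * 0"
    using assms(2) unfolding surface_null_def by (intro ennreal_tendsto_cmult) auto
  then have lim: "(\<lambda>n. ennreal (B\<^sup>2) * (\<integral>\<^sup>+x. ennreal ((\<phi> n x)\<^sup>2) \<partial>dS)) \<longlonglongrightarrow> 0"
    by simp
  have up: "\<forall>\<^sub>F n in sequentially. (\<integral>\<^sup>+x. ennreal ((\<zeta> x * \<phi> n x)\<^sup>2) \<partial>dS)
      \<le> ennreal (B\<^sup>2) * (\<integral>\<^sup>+x. ennreal ((\<phi> n x)\<^sup>2) \<partial>dS)"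
    using B C1_with_grad_D(4)[OF assms(3)]
    by (intro always_eventually allI nn_integral_surface_bounded_mult) (auto simp: frontier_def)
  show ?thesis
    unfolding surface_null_def by (rule tendsto_sandwich[OF _ up tendsto_const lim]) simp
qed

text \<open>The strip estimate after taking square roots, in the form in which errors can be added up.\<close>

lemma strip_L2_estimate:
  assumes ch: "straight_chart \<Omega> p r e \<rho> D\<rho>" and K: "closed K" "K \<subseteq> ball p r"
    and \<epsilon>: "0 < \<epsilon>" "\<And>x s. x \<in> K \<Longrightarrow> 0 \<le> s \<Longrightarrow> s \<le> \<epsilon> \<Longrightarrow> x - s *\<^sub>R e \<in> ball p r"
    and \<phi>: "C1_with_grad \<phi> D" "\<And>x. x \<notin> K \<Longrightarrow> \<phi> x = 0"
    and S: "S = strip p r \<rho> \<epsilon>"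
    and \<sigma>: "(\<integral>\<^sup>+x. ennreal ((\<phi> x)\<^sup>2) \<partial>dS) = ennreal \<sigma>" "0 \<le> \<sigma>"
  shows "L2_norm dx (\<lambda>x. indicator S x *\<^sub>R \<phi> x)
    \<le> sqrt (64 / pi * \<epsilon> * \<sigma>) + 2 * \<epsilon> * L2_norm dx (\<lambda>x. indicator S x *\<^sub>R D x)"
proof -
  let ?a = "L2_norm dx (\<lambda>x. indicator S x *\<^sub>R \<phi> x)" and ?b = "L2_norm dx (\<lambda>x. indicator S x *\<^sub>R D x)"
  have \<rho>C1: "C1_with_grad \<rho> D\<rho>" and \<Omega>eq: "\<Omega> \<inter> ball p r = {x. 0 < \<rho> x} \<inter> ball p r"
    using ch by (auto simp: straight_chart_def)
  have S\<Omega>: "S \<subseteq> \<Omega>" using \<Omega>eq S by blast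
  have "open S" unfolding S by (rule open_strip[OF \<rho>C1])
  then have Sm: "(indicator S :: real^3 \<Rightarrow> real) \<in> borel_measurable dx"
    by (intro borel_measurable_lebesgue_on borel_measurable_indicator) simp
  have L2: "(\<lambda>x. indicator S x *\<^sub>R f x) \<in> L2 dx" if "f \<in> L2 dx" for f :: "real^3 \<Rightarrow> 'b::euclidean_space"
    by (rule L2_mult_bounded[OF that Sm, of 1]) (simp add: indicator_def)
  have a: "ennreal (?a\<^sup>2) = (\<integral>\<^sup>+x. ennreal ((\<phi> x)\<^sup>2) * indicator S x \<partial>lborel)"
  proof -
    have "ennreal (?a\<^sup>2) = (\<integral>\<^sup>+x. ennreal ((norm (indicator S x *\<^sub>R \<phi> x))\<^sup>2) \<partial>lborel)"
      by (rule L2_norm_eq_nn_integral[OF L2[OF C1_L2(1)[OF \<phi>(1)]]]) (use S\<Omega> in \<open>auto simp: indicator_def\<close>)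
    also have "\<dots> = (\<integral>\<^sup>+x. ennreal ((\<phi> x)\<^sup>2) * indicator S x \<partial>lborel)"
      by (intro nn_integral_cong) (auto simp: indicator_def)
    finally show ?thesis .
  qed
  have b: "ennreal (?b\<^sup>2) = (\<integral>\<^sup>+x. ennreal ((norm (D x))\<^sup>2) * indicator S x \<partial>lborel)"
  proof -
    have "ennreal (?b\<^sup>2) = (\<integral>\<^sup>+x. ennreal ((norm (indicator S x *\<^sub>R D x))\<^sup>2) \<partial>lborel)"
      by (rule L2_norm_eq_nn_integral[OF L2[OF C1_L2(2)[OF \<phi>(1)]]]) (use S\<Omega> in \<open>auto simp: indicator_def\<close>)
    also have "\<dots> = (\<integral>\<^sup>+x. ennreal ((norm (D x))\<^sup>2) * indicator S x \<partial>lborel)"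
      by (intro nn_integral_cong) (auto simp: indicator_def)
    finally show ?thesis .
  qed
  have "ennreal (?a\<^sup>2) \<le> ennreal (64 / pi * \<epsilon>) * ennreal \<sigma> + ennreal (2 * \<epsilon>\<^sup>2) * ennreal (?b\<^sup>2)"
    unfolding a b \<sigma>(1)[symmetric] unfolding S
    by (rule strip_estimate[OF ch open_\<Omega> K]) (use \<epsilon> \<phi> in auto)
  also have "ennreal (64 / pi * \<epsilon>) * ennreal \<sigma> = ennreal (64 / pi * \<epsilon> * \<sigma>)"
    by (rule ennreal_mult[symmetric]) (use \<epsilon>(1) \<sigma>(2) in simp_all)
  also have "ennreal (2 * \<epsilon>\<^sup>2) * ennreal (?b\<^sup>2) = ennreal (2 * \<epsilon>\<^sup>2 * ?b\<^sup>2)"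
    by (rule ennreal_mult[symmetric]) simp_all
  also have "ennreal (64 / pi * \<epsilon> * \<sigma>) + ennreal (2 * \<epsilon>\<^sup>2 * ?b\<^sup>2)
      = ennreal (64 / pi * \<epsilon> * \<sigma> + 2 * \<epsilon>\<^sup>2 * ?b\<^sup>2)"
    by (rule ennreal_plus[symmetric]) (use \<epsilon>(1) \<sigma>(2) in simp_all)
  finally have "?a\<^sup>2 \<le> 64 / pi * \<epsilon> * \<sigma> + 2 * \<epsilon>\<^sup>2 * ?b\<^sup>2"
    using \<epsilon>(1) \<sigma>(2) by (simp add: ennreal_le_iff del: ennreal_plus)
  also have "\<dots> \<le> (sqrt (64 / pi * \<epsilon> * \<sigma>) + 2 * \<epsilon> * ?b)\<^sup>2"
  proof -
    have "0 \<le> 64 / pi * \<epsilon> * \<sigma>" using \<epsilon>(1) \<sigma>(2) by simp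
    then have "(sqrt (64 / pi * \<epsilon> * \<sigma>))\<^sup>2 = 64 / pi * \<epsilon> * \<sigma>" by (rule real_sqrt_pow2)
    moreover have "0 \<le> 2 * sqrt (64 / pi * \<epsilon> * \<sigma>) * (2 * \<epsilon> * ?b)" using \<epsilon>(1) \<sigma>(2) by simp
    moreover have "0 \<le> 2 * \<epsilon>\<^sup>2 * ?b\<^sup>2" by simp
    ultimately show ?thesis by (simp add: power2_sum power_mult_distrib)
  qed
  finally show ?thesis by (rule power2_le_imp_le) (use \<epsilon>(1) \<sigma>(2) in simp)
qed

text \<open>The strips decrease to the empty set as \<open>\<epsilon> \<rightarrow> 0\<close>, so dominated convergence applies.\<close>

lemma thin_strip_L2_null:
  assumes "straight_chart \<Omega> p r e \<rho> D\<rho>" "G \<in> L2 dx" "0 < \<eta>" "0 < \<epsilon>0"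
  obtains \<epsilon> where "0 < \<epsilon>" "\<epsilon> \<le> \<epsilon>0"
    "L2_norm dx (\<lambda>x. indicator (strip p r \<rho> \<epsilon>) x *\<^sub>R G x) < \<eta>"
proof -
  define t where "t n = inverse (real (Suc n))" for n
  define S where "S \<epsilon> = strip p r \<rho> \<epsilon>" for \<epsilon>
  have \<rho>C1: "C1_with_grad \<rho> D\<rho>" using assms(1) by (auto simp: straight_chart_def)
  have Sm: "(indicator (S \<epsilon>) :: real^3 \<Rightarrow> real) \<in> borel_measurable dx" for \<epsilon>
    unfolding S_def using open_strip[OF \<rho>C1]
    by (intro borel_measurable_lebesgue_on borel_measurable_indicator) simp
  have t0: "t \<longlonglongrightarrow> 0" unfolding t_def by (rule LIMSEQ_inverse_real_of_nat)
  have "(\<lambda>n. \<integral>x. (norm (indicator (S (t n)) x *\<^sub>R G x))\<^sup>2 \<partial>dx) \<longlonglongrightarrow> (\<integral>x. 0 \<partial>dx)"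
  proof (rule integral_dominated_convergence)
    show "integrable dx (\<lambda>x. (norm (G x))\<^sup>2)" by (rule L2_D(2)[OF assms(2)])
    show "(\<lambda>x. (norm (indicator (S (t n)) x *\<^sub>R G x))\<^sup>2) \<in> borel_measurable dx" for n
      using Sm[of "t n"] L2_D(1)[OF assms(2)] by measurable
    show "AE x in dx. norm ((norm (indicator (S (t n)) x *\<^sub>R G x))\<^sup>2) \<le> (norm (G x))\<^sup>2" for n
      by (intro AE_I2) (simp add: indicator_def)
    show "AE x in dx. (\<lambda>n. (norm (indicator (S (t n)) x *\<^sub>R G x))\<^sup>2) \<longlonglongrightarrow> 0"
    proof (intro AE_I2)
      fix x
      have "\<forall>\<^sub>F n in sequentially. x \<notin> S (t n)"
      proof (cases "0 < \<rho> x")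
        case True
        have "\<forall>\<^sub>F n in sequentially. t n < \<rho> x" by (rule order_tendstoD(2)[OF t0 True])
        then show ?thesis by eventually_elim (simp add: S_def)
      qed (simp add: S_def)
      then have "\<forall>\<^sub>F n in sequentially. (norm (indicator (S (t n)) x *\<^sub>R G x))\<^sup>2 = 0"
        by eventually_elim simp
      then show "(\<lambda>n. (norm (indicator (S (t n)) x *\<^sub>R G x))\<^sup>2) \<longlonglongrightarrow> 0" by (rule tendsto_eventually)
    qed
  qed simp
  then have "(\<lambda>n. L2_norm dx (\<lambda>x. indicator (S (t n)) x *\<^sub>R G x)) \<longlonglongrightarrow> 0"
    unfolding L2_norm_def using tendsto_real_sqrt by fastforce
  then have "\<forall>\<^sub>F n in sequentially. L2_norm dx (\<lambda>x. indicator (S (t n)) x *\<^sub>R G x) < \<eta> \<and> t n < \<epsilon>0"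
    by (intro eventually_conj order_tendstoD(2)[OF _ assms(3)] order_tendstoD(2)[OF t0 assms(4)])
  then obtain n where "L2_norm dx (\<lambda>x. indicator (S (t n)) x *\<^sub>R G x) < \<eta>" "t n < \<epsilon>0"
    unfolding eventually_sequentially by blast
  then show ?thesis by (intro that[of "t n"]) (auto simp: t_def S_def)
qed

end

section \<open>Functions of trace zero\<close>

context bounded_open
begin

text \<open>Let \<open>\<kappa>\<close> be the \<open>C\<^sup>1\<close> cut-off that depends on the height \<open>\<rho>\<close> only, is 0 for \<open>\<rho> \<le> \<epsilon>/2\<close> and 1 for
  \<open>\<rho> \<ge> \<epsilon>\<close>. Then \<open>\<kappa> \<phi>\<^sub>n\<close> is a test function. Its gradient differs from that of \<open>\<phi>\<^sub>n\<close> only in the strip, by at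
  most \<open>\<bar>D\<^sub>n\<bar> + (2 B B' / \<epsilon>) \<bar>\<phi>\<^sub>n\<bar>\<close>, where \<open>B\<close> bounds the gradient of \<open>\<rho>\<close> and \<open>B'\<close> the slope of the step function. There the strip estimate replaces the norm of \<open>\<phi>\<^sub>n\<close> by
  \<open>2 \<epsilon>\<close> times that of \<open>D\<^sub>n\<close>, up to a term that tends to zero with the boundary values. The factor
  \<open>1 / \<epsilon>\<close> cancels, and what remains in the limit is a multiple of the norm of \<open>G\<close> over
  the strip, which is small for small \<open>\<epsilon>\<close>.\<close>

lemma chart_in_test_closure:
  assumes ch: "straight_chart \<Omega> p r e \<rho> D\<rho>" and lim: "C1_limit \<phi> D w G" and sn: "surface_null \<phi>"
    and K: "compact K" "K \<subseteq> ball p r" "\<And>n x. x \<notin> K \<Longrightarrow> \<phi> n x = 0"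
  shows "in_test_closure w G"
  unfolding in_test_closure_def
proof (intro conjI allI impI)
  show w: "w \<in> L2 dx" and G: "G \<in> L2 dx" using lim by (auto simp: C1_limit_def)
  fix \<delta> :: real assume \<delta>: "0 < \<delta>"
  have C1: "\<And>n. C1_with_grad (\<phi> n) (D n)"
    and lim\<phi>: "(\<lambda>n. L2_norm dx (\<lambda>x. \<phi> n x - w x)) \<longlonglongrightarrow> 0"
    and limD: "(\<lambda>n. L2_norm dx (\<lambda>x. D n x - G x)) \<longlonglongrightarrow> 0"
    using lim by (auto simp: C1_limit_def)
  have e: "norm e = 1" and \<rho>C1: "C1_with_grad \<rho> D\<rho>" and bD\<rho>: "bounded (range D\<rho>)"
    and \<Omega>eq: "\<Omega> \<inter> ball p r = {x. 0 < \<rho> x} \<inter> ball p r"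
    using ch by (auto simp: straight_chart_def)
  have Kcl: "closed K" using K(1) by (rule compact_imp_closed)
  have D0: "D n x = 0" if "x \<notin> K" for n x
    by (rule C1_grad_eq_0[OF C1, of "- K"]) (use that K(3) Kcl in auto)
  obtain B where B: "0 \<le> B" "\<And>x. norm (D\<rho> x) \<le> B"
  proof -
    obtain B where "\<forall>y\<in>range D\<rho>. norm y \<le> B" using bD\<rho> unfolding bounded_iff by blast
    then have B: "norm (D\<rho> x) \<le> B" for x by blast
    from norm_ge_zero[of "D\<rho> 0"] B[of 0] have "0 \<le> B" by linarith
    then show ?thesis using B by (rule that)
  qed
  obtain h h' :: "real \<Rightarrow> real" and B' where h:
    "\<And>s. (h has_real_derivative h' s) (at s)" "continuous_on UNIV h'"
    "\<And>s. 0 \<le> h s" "\<And>s. h s \<le> 1" "\<And>s. s \<le> 1 \<Longrightarrow> h s = 0" "\<And>s. 2 \<le> s \<Longrightarrow> h s = 1"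
    "\<And>s. 2 \<le> s \<Longrightarrow> h' s = 0" "\<And>s. \<bar>h' s\<bar> \<le> B'"
    by (rule C1_step_function) (rule that)
  have B'0: "0 \<le> B'" using h(8)[of 0] by linarith
  obtain \<epsilon>0 where \<epsilon>0: "0 < \<epsilon>0" "\<And>x s. x \<in> K \<Longrightarrow> 0 \<le> s \<Longrightarrow> s \<le> \<epsilon>0 \<Longrightarrow> x - s *\<^sub>R e \<in> ball p r"
  proof -
    obtain d where d: "0 < d" "(\<Union>x\<in>K. cball x d) \<subseteq> ball p r"
      by (rule compact_subset_open_imp_cball_epsilon_subset[OF K(1) open_ball K(2)])
    show ?thesis
    proof (rule that[OF d(1)])
      fix x s assume x: "x \<in> K" "0 \<le> s" "s \<le> d"
      then have "x - s *\<^sub>R e \<in> cball x d" using e by (simp add: dist_norm)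
      then show "x - s *\<^sub>R e \<in> ball p r" using d(2) x(1) by blast
    qed
  qed
  \<comment> \<open>\<open>c\<close> dominates both coefficients of \<open>g\<close> in the limits below: \<open>2 \<epsilon> \<le> 2\<close> for the functions
    and \<open>1 + (2 B B' / \<epsilon>) (2 \<epsilon>) = 1 + 4 B B'\<close> for the gradients.\<close>
  define c where "c = 2 + 4 * B * B'"
  have c: "2 \<le> c" using B(1) B'0 by (simp add: c_def)
  have "0 < \<delta> / c" "0 < min \<epsilon>0 1" using \<delta> c \<epsilon>0(1) by simp_all
  then obtain \<epsilon> where \<epsilon>: "0 < \<epsilon>" "\<epsilon> \<le> min \<epsilon>0 1"
    "L2_norm dx (\<lambda>x. indicator (strip p r \<rho> \<epsilon>) x *\<^sub>R G x) < \<delta> / c"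
    by (rule thin_strip_L2_null[OF ch G])
  define S where "S = strip p r \<rho> \<epsilon>"
  define g where "g = L2_norm dx (\<lambda>x. indicator S x *\<^sub>R G x)"
  have g: "0 \<le> g" "c * g < \<delta>" using \<epsilon>(3) c by (auto simp: g_def S_def field_simps)
  have Sm: "(indicator S :: real^3 \<Rightarrow> real) \<in> borel_measurable dx"
    unfolding S_def using open_strip[OF \<rho>C1]
    by (intro borel_measurable_lebesgue_on borel_measurable_indicator) simp
  have L2S: "(\<lambda>x. indicator S x *\<^sub>R f x) \<in> L2 dx" if "f \<in> L2 dx" for f :: "real^3 \<Rightarrow> 'b::euclidean_space"
    by (rule L2_mult_bounded[OF that Sm, of 1]) (simp add: indicator_def)
  define \<sigma> where "\<sigma> n = enn2real (\<integral>\<^sup>+x. ennreal ((\<phi> n x)\<^sup>2) \<partial>dS)" for n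
  have \<sigma>0: "\<sigma> \<longlonglongrightarrow> 0"
    unfolding \<sigma>_def using sn unfolding surface_null_def by (intro tendsto_enn2real) auto
  have \<sigma>fin: "\<forall>\<^sub>F n in sequentially. (\<integral>\<^sup>+x. ennreal ((\<phi> n x)\<^sup>2) \<partial>dS) < top"
    using sn unfolding surface_null_def by (rule order_tendstoD(2)) simp
  define a where "a n = L2_norm dx (\<lambda>x. indicator S x *\<^sub>R \<phi> n x)" for n
  define b where "b n = L2_norm dx (\<lambda>x. indicator S x *\<^sub>R D n x)" for n
  define q where "q n = sqrt (64 / pi * \<epsilon> * \<sigma> n)" for n
  have q0: "q \<longlonglongrightarrow> 0"
    unfolding q_def using tendsto_real_sqrt[OF tendsto_mult_left[OF \<sigma>0, of "64 / pi * \<epsilon>"]] by simp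
  have ab: "\<forall>\<^sub>F n in sequentially. a n \<le> q n + 2 * \<epsilon> * b n"
    using \<sigma>fin
  proof eventually_elim
    case (elim n)
    show ?case
      unfolding a_def b_def q_def
    proof (rule strip_L2_estimate[OF ch Kcl K(2) \<epsilon>(1) _ C1 _ S_def])
      show "(\<integral>\<^sup>+x. ennreal ((\<phi> n x)\<^sup>2) \<partial>dS) = ennreal (\<sigma> n)"
        unfolding \<sigma>_def using elim by simp
      show "x - s *\<^sub>R e \<in> ball p r" if "x \<in> K" "0 \<le> s" "s \<le> \<epsilon>" for x s
        using \<epsilon>0(2)[OF that(1,2)] that(3) \<epsilon>(2) by simp
    qed (use K(3) in \<open>simp_all add: \<sigma>_def\<close>)
  qed
  have bg: "b n \<le> L2_norm dx (\<lambda>x. D n x - G x) + g" for n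
  proof -
    have d: "(\<lambda>x. D n x - G x) \<in> L2 dx" by (rule L2_diff[OF C1_L2(2)[OF C1] G])
    have "b n = L2_norm dx (\<lambda>x. indicator S x *\<^sub>R (D n x - G x) + indicator S x *\<^sub>R G x)"
      by (simp add: b_def flip: scaleR_add_right)
    also have "\<dots> \<le> L2_norm dx (\<lambda>x. indicator S x *\<^sub>R (D n x - G x)) + g"
      unfolding g_def by (rule L2_norm_triangle[OF L2S[OF d] L2S[OF G]])
    also have "L2_norm dx (\<lambda>x. indicator S x *\<^sub>R (D n x - G x)) \<le> 1 * L2_norm dx (\<lambda>x. D n x - G x)"
      by (rule L2_norm_mono_AE[OF L2S[OF d] d]) (auto simp: indicator_def)
    finally show ?thesis by simp
  qed
  define \<kappa> where "\<kappa> x = h (2 / \<epsilon> * \<rho> x)" for x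
  define X where "X x = h' (2 / \<epsilon> * \<rho> x) *\<^sub>R ((2 / \<epsilon>) *\<^sub>R D\<rho> x)" for x
  have \<kappa>C1: "C1_with_grad \<kappa> X"
    unfolding \<kappa>_def X_def by (rule C1_compose[OF h(1,2) C1_cmult[OF \<rho>C1]])
  define \<psi> where "\<psi> n x = \<kappa> x * \<phi> n x" for n x
  define E where "E n x = \<kappa> x *\<^sub>R D n x + \<phi> n x *\<^sub>R X x" for n x
  have \<psi>C1: "C1_with_grad (\<psi> n) (E n)" for n
    unfolding \<psi>_def E_def by (rule C1_mult[OF \<kappa>C1 C1])
  have test: "test_with_grad \<Omega> (\<psi> n) (E n)" for n
  proof (rule test_with_gradI[OF \<psi>C1])
    have "closed (\<rho> -` {\<epsilon> / 2..})"
      by (rule closed_vimage[OF _ C1_with_grad_D(3)[OF \<rho>C1]]) simp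
    then show "compact (K \<inter> \<rho> -` {\<epsilon> / 2..})" using K(1) by (rule compact_Int_closed[rotated])
    show "K \<inter> \<rho> -` {\<epsilon> / 2..} \<subseteq> \<Omega>"
    proof
      fix x assume "x \<in> K \<inter> \<rho> -` {\<epsilon> / 2..}"
      then have "x \<in> {x. 0 < \<rho> x} \<inter> ball p r" using \<epsilon>(1) K(2) by auto
      then show "x \<in> \<Omega>" using \<Omega>eq by blast
    qed
    show "\<psi> n x = 0" if "x \<notin> K \<inter> \<rho> -` {\<epsilon> / 2..}" for x
    proof (cases "x \<in> K")
      case True
      then have "\<rho> x \<le> \<epsilon> / 2" using that by simp
      then have "2 / \<epsilon> * \<rho> x \<le> 1" using \<epsilon>(1) by (simp add: field_simps)
      then show ?thesis unfolding \<psi>_def \<kappa>_def by (simp add: h(5))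
    qed (simp add: \<psi>_def K(3))
  qed
  have outside: "\<kappa> x = 1 \<and> X x = 0" if "x \<in> \<Omega>" "x \<in> K" "x \<notin> S" for x
  proof -
    have "x \<in> {x. 0 < \<rho> x} \<inter> ball p r" using that \<Omega>eq K(2) by blast
    then have "\<epsilon> \<le> \<rho> x" using that(3) by (auto simp: S_def not_less)
    then have "2 \<le> 2 / \<epsilon> * \<rho> x" using \<epsilon>(1) by (simp add: field_simps)
    then show ?thesis by (simp add: \<kappa>_def X_def h(6,7))
  qed
  have d\<psi>: "L2_norm dx (\<lambda>x. \<psi> n x - \<phi> n x) \<le> a n" for n
  proof -
    have "L2_norm dx (\<lambda>x. \<psi> n x - \<phi> n x) \<le> 1 * L2_norm dx (\<lambda>x. indicator S x *\<^sub>R \<phi> n x)"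
    proof (rule L2_norm_mono_dx[OF L2_diff[OF C1_L2(1)[OF \<psi>C1] C1_L2(1)[OF C1]] L2S[OF C1_L2(1)[OF C1]]])
      fix x assume x: "x \<in> \<Omega>"
      show "norm (\<psi> n x - \<phi> n x) \<le> 1 * norm (indicator S x *\<^sub>R \<phi> n x)"
      proof (cases "x \<in> K \<and> x \<in> S")
        case True
        have "\<psi> n x - \<phi> n x = (\<kappa> x - 1) * \<phi> n x" by (simp add: \<psi>_def left_diff_distrib)
        moreover have "\<bar>\<kappa> x - 1\<bar> \<le> 1"
          using h(3)[of "2 / \<epsilon> * \<rho> x"] h(4)[of "2 / \<epsilon> * \<rho> x"] unfolding \<kappa>_def by linarith
        ultimately show ?thesis using True by (simp add: abs_mult mult_left_le_one_le)
      next
        case False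
        then have "\<psi> n x = \<phi> n x"
          using outside[OF x] K(3)[of x n] by (cases "x \<in> K") (auto simp: \<psi>_def)
        then show ?thesis by simp
      qed
    qed simp
    then show ?thesis by (simp add: a_def)
  qed
  have dE: "L2_norm dx (\<lambda>x. E n x - D n x) \<le> b n + (2 * B * B' / \<epsilon>) * a n" for n
  proof -
    have L2': "(\<lambda>x. indicator S x *\<^sub>R D n x) \<in> L2 dx" "(\<lambda>x. indicator S x *\<^sub>R \<phi> n x) \<in> L2 dx"
      by (rule L2S[OF C1_L2(2)[OF C1]], rule L2S[OF C1_L2(1)[OF C1]])
    have nn: "(\<lambda>x. norm (indicator S x *\<^sub>R D n x)) \<in> L2 dx"
      "(\<lambda>x. (2 * B * B' / \<epsilon>) *\<^sub>R norm (indicator S x *\<^sub>R \<phi> n x)) \<in> L2 dx"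
      by (rule L2_norm_fun[OF L2'(1)], rule L2_scaleR[OF L2_norm_fun[OF L2'(2)]])
    have "L2_norm dx (\<lambda>x. E n x - D n x) \<le> 1 * L2_norm dx (\<lambda>x. norm (indicator S x *\<^sub>R D n x)
        + (2 * B * B' / \<epsilon>) *\<^sub>R norm (indicator S x *\<^sub>R \<phi> n x))"
    proof (rule L2_norm_mono_dx[OF L2_diff[OF C1_L2(2)[OF \<psi>C1] C1_L2(2)[OF C1]] L2_add[OF nn]])
      fix x assume x: "x \<in> \<Omega>"
      have pos: "0 \<le> 2 * B * B' / \<epsilon>" using B(1) B'0 \<epsilon>(1) by simp
      show "norm (E n x - D n x) \<le> 1 * norm (norm (indicator S x *\<^sub>R D n x)
        + (2 * B * B' / \<epsilon>) *\<^sub>R norm (indicator S x *\<^sub>R \<phi> n x))"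
      proof (cases "x \<in> K \<and> x \<in> S")
        case True
        have "E n x - D n x = (\<kappa> x - 1) *\<^sub>R D n x + \<phi> n x *\<^sub>R X x"
          by (simp add: E_def algebra_simps)
        then have "norm (E n x - D n x) \<le> norm ((\<kappa> x - 1) *\<^sub>R D n x) + norm (\<phi> n x *\<^sub>R X x)"
          by (metis norm_triangle_ineq)
        also have "norm ((\<kappa> x - 1) *\<^sub>R D n x) \<le> norm (D n x)"
        proof -
          have "\<bar>\<kappa> x - 1\<bar> \<le> 1"
            using h(3)[of "2 / \<epsilon> * \<rho> x"] h(4)[of "2 / \<epsilon> * \<rho> x"] unfolding \<kappa>_def by linarith
          then show ?thesis by (simp add: mult_left_le_one_le)
        qed
        also have "norm (\<phi> n x *\<^sub>R X x) \<le> (2 * B * B' / \<epsilon>) * \<bar>\<phi> n x\<bar>"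
        proof -
          have "norm (X x) = \<bar>h' (2 / \<epsilon> * \<rho> x)\<bar> * (2 / \<epsilon> * norm (D\<rho> x))"
            unfolding X_def norm_scaleR using \<epsilon>(1) by simp
          also have "\<dots> \<le> B' * (2 / \<epsilon> * B)"
            using \<epsilon>(1) by (intro mult_mono h(8) mult_left_mono B(2)) (simp_all add: B'0)
          finally have "\<bar>\<phi> n x\<bar> * norm (X x) \<le> \<bar>\<phi> n x\<bar> * (B' * (2 / \<epsilon> * B))"
            by (intro mult_left_mono) auto
          then show ?thesis by (simp add: mult_ac)
        qed
        finally have "norm (E n x - D n x) \<le> norm (D n x) + (2 * B * B' / \<epsilon>) * \<bar>\<phi> n x\<bar>" by simp
        moreover have "0 \<le> norm (D n x) + (2 * B * B' / \<epsilon>) * \<bar>\<phi> n x\<bar>"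
          by (intro add_nonneg_nonneg mult_nonneg_nonneg pos) simp_all
        ultimately show ?thesis using True by simp
      next
        case False
        then have "E n x - D n x = 0"
          using outside[OF x] K(3)[of x n] D0[of x n] by (cases "x \<in> K") (auto simp: E_def)
        then show ?thesis by simp
      qed
    qed simp
    also have "\<dots> \<le> L2_norm dx (\<lambda>x. norm (indicator S x *\<^sub>R D n x))
        + L2_norm dx (\<lambda>x. (2 * B * B' / \<epsilon>) *\<^sub>R norm (indicator S x *\<^sub>R \<phi> n x))"
      using L2_norm_triangle[OF nn] by simp
    also have "L2_norm dx (\<lambda>x. norm (indicator S x *\<^sub>R D n x)) = b n"
      by (simp add: b_def L2_norm_def)
    also have "L2_norm dx (\<lambda>x. (2 * B * B' / \<epsilon>) *\<^sub>R norm (indicator S x *\<^sub>R \<phi> n x)) = (2 * B * B' / \<epsilon>) * a n"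
    proof -
      have "L2_norm dx (\<lambda>x. norm (indicator S x *\<^sub>R \<phi> n x)) = a n" by (simp add: a_def L2_norm_def)
      moreover have "\<bar>2 * B * B' / \<epsilon>\<bar> = 2 * B * B' / \<epsilon>" using B(1) B'0 \<epsilon>(1) by simp
      ultimately show ?thesis unfolding L2_norm_scaleR by simp
    qed
    finally show ?thesis .
  qed
  define err where "err n = L2_norm dx (\<lambda>x. D n x - G x) + g" for n
  have err: "err \<longlonglongrightarrow> g" unfolding err_def using tendsto_add[OF limD tendsto_const[of g]] by simp
  have "(\<lambda>n. L2_norm dx (\<lambda>x. \<phi> n x - w x) + (q n + 2 * \<epsilon> * err n)) \<longlonglongrightarrow> 0 + (0 + 2 * \<epsilon> * g)"
    by (intro tendsto_add tendsto_mult_left lim\<phi> q0 err)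
  moreover have "0 + (0 + 2 * \<epsilon> * g) < \<delta>"
  proof -
    have "2 * \<epsilon> \<le> c" using \<epsilon>(2) c by simp
    then have "2 * \<epsilon> * g \<le> c * g" using g(1) by (rule mult_right_mono)
    then show ?thesis using g(2) by simp
  qed
  ultimately have ev1: "\<forall>\<^sub>F n in sequentially. L2_norm dx (\<lambda>x. \<phi> n x - w x) + (q n + 2 * \<epsilon> * err n) < \<delta>"
    by (rule order_tendstoD(2))
  have "(\<lambda>n. L2_norm dx (\<lambda>x. D n x - G x) + (err n + (2 * B * B' / \<epsilon>) * (q n + 2 * \<epsilon> * err n)))
      \<longlonglongrightarrow> 0 + (g + (2 * B * B' / \<epsilon>) * (0 + 2 * \<epsilon> * g))"
    by (intro tendsto_add tendsto_mult_left limD q0 err)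
  moreover have "0 + (g + (2 * B * B' / \<epsilon>) * (0 + 2 * \<epsilon> * g)) < \<delta>"
  proof -
    have "g + (2 * B * B' / \<epsilon>) * (2 * \<epsilon> * g) = (1 + 4 * B * B') * g"
      using \<epsilon>(1) by (simp add: field_simps)
    also have "\<dots> \<le> c * g" using g(1) by (intro mult_right_mono) (simp_all add: c_def)
    finally show ?thesis using g(2) by simp
  qed
  ultimately have ev2: "\<forall>\<^sub>F n in sequentially. L2_norm dx (\<lambda>x. D n x - G x)
      + (err n + (2 * B * B' / \<epsilon>) * (q n + 2 * \<epsilon> * err n)) < \<delta>"
    by (rule order_tendstoD(2))
  have "\<forall>\<^sub>F n in sequentially. L2_norm dx (\<lambda>x. \<psi> n x - w x) < \<delta> \<and> L2_norm dx (\<lambda>x. E n x - G x) < \<delta>"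
    using ev1 ev2 ab
  proof eventually_elim
    case (elim n)
    have a: "a n \<le> q n + 2 * \<epsilon> * err n"
    proof -
      have "2 * \<epsilon> * b n \<le> 2 * \<epsilon> * err n" using bg[of n] \<epsilon>(1) by (simp add: err_def)
      then show ?thesis using elim(3) by linarith
    qed
    have "L2_norm dx (\<lambda>x. \<psi> n x - w x) \<le> L2_norm dx (\<lambda>x. \<psi> n x - \<phi> n x) + L2_norm dx (\<lambda>x. \<phi> n x - w x)"
      by (rule L2_norm_triangle_diff[OF C1_L2(1)[OF \<psi>C1] C1_L2(1)[OF C1] w])
    also have "\<dots> < \<delta>" using d\<psi>[of n] a elim(1) by linarith
    finally have 1: "L2_norm dx (\<lambda>x. \<psi> n x - w x) < \<delta>" .
    have "(2 * B * B' / \<epsilon>) * a n \<le> (2 * B * B' / \<epsilon>) * (q n + 2 * \<epsilon> * err n)"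
      using B(1) B'0 \<epsilon>(1) by (intro mult_left_mono a) simp
    then have "L2_norm dx (\<lambda>x. E n x - D n x) \<le> err n + (2 * B * B' / \<epsilon>) * (q n + 2 * \<epsilon> * err n)"
      using dE[of n] bg[of n] unfolding err_def by linarith
    moreover have "L2_norm dx (\<lambda>x. E n x - G x) \<le> L2_norm dx (\<lambda>x. E n x - D n x) + L2_norm dx (\<lambda>x. D n x - G x)"
      by (rule L2_norm_triangle_diff[OF C1_L2(2)[OF \<psi>C1] C1_L2(2)[OF C1] G])
    ultimately have "L2_norm dx (\<lambda>x. E n x - G x) < \<delta>" using elim(2) by linarith
    with 1 show ?case ..
  qed
  then obtain n where "L2_norm dx (\<lambda>x. \<psi> n x - w x) < \<delta> \<and> L2_norm dx (\<lambda>x. E n x - G x) < \<delta>"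
    unfolding eventually_sequentially by blast
  then show "\<exists>\<psi> E. test_with_grad \<Omega> \<psi> E \<and> L2_norm dx (\<lambda>x. \<psi> x - w x) < \<delta> \<and>
      L2_norm dx (\<lambda>x. E x - G x) < \<delta>" using test by blast
qed

lemma C1_complement: "C1_with_grad \<zeta> Z \<Longrightarrow> C1_with_grad (\<lambda>x. 1 - \<zeta> x) (\<lambda>x. - Z x)"
  using C1_add[OF C1_const[of 1] C1_cmult[of \<zeta> Z "-1"]] by simp

lemma in_test_closure_split:
  assumes "in_test_closure (\<lambda>x. \<zeta> x * w x) (\<lambda>x. \<zeta> x *\<^sub>R G x + w x *\<^sub>R Z x)"
    "in_test_closure (\<lambda>x. (1 - \<zeta> x) * w x) (\<lambda>x. (1 - \<zeta> x) *\<^sub>R G x + w x *\<^sub>R (- Z x))"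
  shows "in_test_closure w G"
  using in_test_closure_add[OF assms] by (simp add: algebra_simps)

text \<open>Induction over the charts that are still needed. A cut-off \<open>\<zeta>\<close> that is 1 on the half-sized ball of a
  chart splits \<open>w\<close> into \<open>\<zeta> w\<close>, which lives in that chart, and \<open>(1 - \<zeta>) w\<close>, whose approximants vanish on the
  half-sized ball as well, so that the remaining charts suffice. When no chart is left,
  the approximants vanish on \<open>\<Omega>\<close>.\<close>

lemma finite_charts_in_test_closure:
  assumes "finite J" "\<And>p. p \<in> J \<Longrightarrow> \<exists>e \<rho> D\<rho>. straight_chart \<Omega> p (r p) e \<rho> D\<rho>"
    "C1_limit \<phi> D w G" "surface_null \<phi>"
    "\<And>n x. x \<in> \<Omega> \<Longrightarrow> x \<notin> (\<Union>p\<in>J. ball p (r p / 2)) \<Longrightarrow> \<phi> n x = 0"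
  shows "in_test_closure w G"
  using assms
proof (induction J arbitrary: \<phi> D w G)
  case empty
  have C1: "\<And>n. C1_with_grad (\<phi> n) (D n)" using empty(2) by (auto simp: C1_limit_def)
  have \<phi>0: "\<phi> n x = 0" if "x \<in> \<Omega>" for n x using empty(4)[OF that] by simp
  have D0: "D n x = 0" if "x \<in> \<Omega>" for n x
    by (rule C1_grad_eq_0[OF C1 open_\<Omega> that]) (rule \<phi>0)
  have "L2_norm dx (\<lambda>x. \<phi> n x - w x) = L2_norm dx (\<lambda>x. 0 - w x)"
    "L2_norm dx (\<lambda>x. D n x - G x) = L2_norm dx (\<lambda>x. 0 - G x)" for n
    unfolding L2_norm_def using \<phi>0 D0
    by (auto intro!: arg_cong[where f = sqrt] Bochner_Integration.integral_cong simp: space_restrict_space)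
  then have "C1_limit (\<lambda>n x. 0) (\<lambda>n x. 0) w G"
    using empty(2) C1_const[of 0] unfolding C1_limit_def by simp
  moreover have "test_with_grad \<Omega> (\<lambda>x. 0) (\<lambda>x. 0)"
    by (rule test_with_gradI[OF C1_const, of "{}"]) auto
  ultimately show ?case by (intro C1_limit_test[of "\<lambda>n x. 0" "\<lambda>n x. 0"]) auto
next
  case (insert p J)
  obtain e \<rho> D\<rho> where ch: "straight_chart \<Omega> p (r p) e \<rho> D\<rho>" using insert.prems(1)[of p] by blast
  then have r: "0 < r p" by (simp add: straight_chart_def)
  have C1: "\<And>n. C1_with_grad (\<phi> n) (D n)" using insert.prems(2) by (auto simp: C1_limit_def)
  have "cball p (r p / 2) \<subseteq> ball p (r p)" using r by auto
  then obtain \<zeta> Z where \<zeta>: "test_with_grad (ball p (r p)) \<zeta> Z" "\<And>x. x \<in> cball p (r p / 2) \<Longrightarrow> \<zeta> x = 1"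
    "\<And>x. 0 \<le> \<zeta> x" "\<And>x. \<zeta> x \<le> 1"
    by (rule C1_Urysohn[OF compact_cball open_ball]) (rule that)
  obtain K where K: "C1_with_grad \<zeta> Z" "compact K" "K \<subseteq> ball p (r p)"
    "\<And>x. x \<notin> K \<Longrightarrow> \<zeta> x = 0" "\<And>x. x \<notin> K \<Longrightarrow> Z x = 0"
    by (rule test_with_gradE[OF \<zeta>(1)]) (rule that)
  have "in_test_closure (\<lambda>x. \<zeta> x * w x) (\<lambda>x. \<zeta> x *\<^sub>R G x + w x *\<^sub>R Z x)"
    by (rule chart_in_test_closure[OF ch C1_limit_mult[OF K(1) insert.prems(2)]
          surface_null_mult[OF K(1) insert.prems(3) C1] K(2,3)]) (simp add: K(4))
  moreover have "in_test_closure (\<lambda>x. (1 - \<zeta> x) * w x) (\<lambda>x. (1 - \<zeta> x) *\<^sub>R G x + w x *\<^sub>R (- Z x))"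
  proof (rule insert.IH)
    show "\<exists>e \<rho> D\<rho>. straight_chart \<Omega> q (r q) e \<rho> D\<rho>" if "q \<in> J" for q using insert.prems(1) that by blast
    show "C1_limit (\<lambda>n x. (1 - \<zeta> x) * \<phi> n x) (\<lambda>n x. (1 - \<zeta> x) *\<^sub>R D n x + \<phi> n x *\<^sub>R (- Z x))
        (\<lambda>x. (1 - \<zeta> x) * w x) (\<lambda>x. (1 - \<zeta> x) *\<^sub>R G x + w x *\<^sub>R (- Z x))"
      by (rule C1_limit_mult[OF C1_complement[OF K(1)] insert.prems(2)])
    show "surface_null (\<lambda>n x. (1 - \<zeta> x) * \<phi> n x)"
      by (rule surface_null_mult[OF C1_complement[OF K(1)] insert.prems(3) C1])
    show "(1 - \<zeta> x) * \<phi> n x = 0" if "x \<in> \<Omega>" "x \<notin> (\<Union>p\<in>J. ball p (r p / 2))" for n x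
    proof (cases "x \<in> ball p (r p / 2)")
      case True
      then have "\<zeta> x = 1" by (intro \<zeta>(2)) auto
      then show ?thesis by simp
    next
      case False
      then have "\<phi> n x = 0" using that by (intro insert.prems(4)) auto
      then show ?thesis by simp
    qed
  qed
  ultimately show ?case by (rule in_test_closure_split)
qed

lemma in_test_closure_imp_H1_0:
  assumes "w \<in> H1 \<Omega>" "in_test_closure w (grad w)"
  shows "w \<in> H1_0 \<Omega>"
proof -
  have "\<forall>n. \<exists>p. test_with_grad \<Omega> (fst p) (snd p) \<and>
      L2_norm dx (\<lambda>x. fst p x - w x) < inverse (real (Suc n)) \<and>
      L2_norm dx (\<lambda>x. snd p x - grad w x) < inverse (real (Suc n))"
  proof
    fix n
    have "0 < inverse (real (Suc n))" by simp
    then obtain \<psi> E where "test_with_grad \<Omega> \<psi> E \<and>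
        L2_norm dx (\<lambda>x. \<psi> x - w x) < inverse (real (Suc n)) \<and>
        L2_norm dx (\<lambda>x. E x - grad w x) < inverse (real (Suc n))"
      using assms(2) unfolding in_test_closure_def by blast
    then show "\<exists>p. test_with_grad \<Omega> (fst p) (snd p) \<and>
      L2_norm dx (\<lambda>x. fst p x - w x) < inverse (real (Suc n)) \<and>
      L2_norm dx (\<lambda>x. snd p x - grad w x) < inverse (real (Suc n))"
      by (intro exI[of _ "(\<psi>, E)"]) simp
  qed
  from choice[OF this] obtain P where P: "\<forall>n. test_with_grad \<Omega> (fst (P n)) (snd (P n)) \<and>
      L2_norm dx (\<lambda>x. fst (P n) x - w x) < inverse (real (Suc n)) \<and>
      L2_norm dx (\<lambda>x. snd (P n) x - grad w x) < inverse (real (Suc n))"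
    by (rule exE)
  have "(\<lambda>n. L2_norm dx (\<lambda>x. fst (P n) x - w x)) \<longlonglongrightarrow> 0"
    by (rule Lim_null_comparison[OF _ LIMSEQ_inverse_real_of_nat])
       (use P in \<open>auto intro!: always_eventually less_imp_le\<close>)
  moreover have "(\<lambda>n. L2_norm dx (\<lambda>x. snd (P n) x - grad w x)) \<longlonglongrightarrow> 0"
    by (rule Lim_null_comparison[OF _ LIMSEQ_inverse_real_of_nat])
       (use P in \<open>auto intro!: always_eventually less_imp_le\<close>)
  ultimately show ?thesis
    unfolding H1_0_def H1_approx_def using assms(1) P
    by (auto intro!: exI[of _ "\<lambda>n. fst (P n)"] exI[of _ "\<lambda>n. snd (P n)"])
qed

text \<open>The half-sized balls of finitely many charts cover the boundary, and the rest of the closure of \<open>\<Omega>\<close> is a compact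
  subset of \<open>\<Omega>\<close>. A test function \<open>\<kappa>\<close> that is 1 on this set splits off an interior part;
  the part that remains is treated by \<open>finite_charts_in_test_closure\<close>.\<close>

lemma zero_trace_imp_H1_0:
  assumes charts: "\<And>p. p \<in> frontier \<Omega> \<Longrightarrow> \<exists>r e \<rho> D\<rho>. straight_chart \<Omega> p r e \<rho> D\<rho>"
    and w: "w \<in> H1 \<Omega>" and lim: "C1_limit \<phi> D w (grad w)" and sn: "surface_null \<phi>"
  shows "w \<in> H1_0 \<Omega>"
proof (rule in_test_closure_imp_H1_0[OF w])
  obtain r where r: "\<And>p. p \<in> frontier \<Omega> \<Longrightarrow> \<exists>e \<rho> D\<rho>. straight_chart \<Omega> p (r p) e \<rho> D\<rho>"
    using charts by metis
  have rpos: "0 < r p" if "p \<in> frontier \<Omega>" for p using r[OF that] by (auto simp: straight_chart_def)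
  have "compact (frontier \<Omega>)" using bounded_\<Omega> by (rule compact_frontier_bounded)
  moreover have "open (ball p (r p / 2))" for p by simp
  moreover have "frontier \<Omega> \<subseteq> (\<Union>p\<in>frontier \<Omega>. ball p (r p / 2))" using rpos by force
  ultimately obtain J where J: "J \<subseteq> frontier \<Omega>" "finite J" "frontier \<Omega> \<subseteq> (\<Union>p\<in>J. ball p (r p / 2))"
    by (rule compactE_image[of "frontier \<Omega>" "frontier \<Omega>" "\<lambda>p. ball p (r p / 2)"])
  define U where "U = (\<Union>p\<in>J. ball p (r p / 2))"
  have C1: "\<And>n. C1_with_grad (\<phi> n) (D n)" using lim by (auto simp: C1_limit_def)
  have K0: "compact (closure \<Omega> - U)" "closure \<Omega> - U \<subseteq> \<Omega>"
  proof -
    have "open U" unfolding U_def by blast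
    then show "compact (closure \<Omega> - U)" using bounded_\<Omega> by (simp add: compact_diff)
    show "closure \<Omega> - U \<subseteq> \<Omega>"
      using J(3) open_\<Omega> unfolding U_def frontier_def by (auto simp: interior_open)
  qed
  obtain \<kappa> X where \<kappa>: "test_with_grad \<Omega> \<kappa> X" "\<And>x. x \<in> closure \<Omega> - U \<Longrightarrow> \<kappa> x = 1"
    "\<And>x. 0 \<le> \<kappa> x" "\<And>x. \<kappa> x \<le> 1"
    by (rule C1_Urysohn[OF K0(1) open_\<Omega> K0(2)]) (rule that)
  have \<kappa>C1: "C1_with_grad \<kappa> X" using \<kappa>(1) by (simp add: test_with_grad_def)
  have "test_with_grad \<Omega> (\<lambda>x. \<kappa> x * \<phi> n x) (\<lambda>x. \<kappa> x *\<^sub>R D n x + \<phi> n x *\<^sub>R X x)" for n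
    using test_mult[OF C1[of n] \<kappa>(1)] by (simp add: mult.commute add.commute)
  then have "in_test_closure (\<lambda>x. \<kappa> x * w x) (\<lambda>x. \<kappa> x *\<^sub>R grad w x + w x *\<^sub>R X x)"
    by (rule C1_limit_test[OF C1_limit_mult[OF \<kappa>C1 lim]])
  moreover have "in_test_closure (\<lambda>x. (1 - \<kappa> x) * w x) (\<lambda>x. (1 - \<kappa> x) *\<^sub>R grad w x + w x *\<^sub>R (- X x))"
  proof (rule finite_charts_in_test_closure[OF J(2) _ C1_limit_mult[OF C1_complement[OF \<kappa>C1] lim]
        surface_null_mult[OF C1_complement[OF \<kappa>C1] sn C1]])
    show "\<exists>e \<rho> D\<rho>. straight_chart \<Omega> p (r p) e \<rho> D\<rho>" if "p \<in> J" for p using r J(1) that by blast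
    show "(1 - \<kappa> x) * \<phi> n x = 0" if "x \<in> \<Omega>" "x \<notin> (\<Union>p\<in>J. ball p (r p / 2))" for n x
    proof -
      have "x \<in> closure \<Omega> - U" using that closure_subset unfolding U_def by blast
      then show ?thesis using \<kappa>(2) by simp
    qed
  qed
  ultimately show "in_test_closure w (grad w)" by (rule in_test_closure_split)
qed

end

section \<open>Normal traces of divergence-free fields\<close>

lemma L2_norm_lincomb_le:
  assumes "f \<in> L2 M" "g \<in> L2 M"
  shows "L2_norm M (\<lambda>x. a *\<^sub>R f x + b *\<^sub>R g x) \<le> \<bar>a\<bar> * L2_norm M f + \<bar>b\<bar> * L2_norm M g"
  using L2_norm_triangle[OF L2_scaleR[OF assms(1), of a] L2_scaleR[OF assms(2), of b]]
  by (simp add: L2_norm_scaleR)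

lemma L2_vec:
  fixes f :: "'a \<Rightarrow> real^'m"
  assumes "\<And>i. (\<lambda>x. f x $ i) \<in> L2 M"
  shows "f \<in> L2 M" "L2_norm M f \<le> (\<Sum>i\<in>UNIV. L2_norm M (\<lambda>x. f x $ i))"
proof -
  have sum: "(\<lambda>x. \<Sum>i\<in>I. \<bar>f x $ i\<bar>) \<in> L2 M \<and>
      L2_norm M (\<lambda>x. \<Sum>i\<in>I. \<bar>f x $ i\<bar>) \<le> (\<Sum>i\<in>I. L2_norm M (\<lambda>x. f x $ i))" if "finite I" for I
    using that
  proof induction
    case empty
    show ?case by (simp add: L2_def)
  next
    case (insert i I)
    have i: "(\<lambda>x. \<bar>f x $ i\<bar>) \<in> L2 M" using L2_norm_fun[OF assms[of i]] by simp
    have "L2_norm M (\<lambda>x. \<bar>f x $ i\<bar>) = L2_norm M (\<lambda>x. f x $ i)" by (simp add: L2_norm_def)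
    then show ?case
      using insert L2_add[OF i] L2_norm_triangle[OF i, of "\<lambda>x. \<Sum>i\<in>I. \<bar>f x $ i\<bar>"] by auto
  qed
  have le: "norm (f x) \<le> 1 * norm (\<Sum>i\<in>UNIV. \<bar>f x $ i\<bar>)" for x
    using norm_le_l1_cart[of "f x"] by (simp add: sum_nonneg)
  have m: "f \<in> borel_measurable M"
    unfolding borel_measurable_euclidean_space[of f M]
    using L2_D(1)[OF assms] by (auto simp: Basis_vec_def inner_axis)
  show 1: "f \<in> L2 M"
    by (rule L2_bound[of "\<lambda>x. \<Sum>i\<in>UNIV. \<bar>f x $ i\<bar>" M f 1]) (use sum[of UNIV] m le in auto)
  have "L2_norm M f \<le> 1 * L2_norm M (\<lambda>x. \<Sum>i\<in>UNIV. \<bar>f x $ i\<bar>)"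
    by (rule L2_norm_mono_AE[OF 1]) (use sum[of UNIV] le in auto)
  then show "L2_norm M f \<le> (\<Sum>i\<in>UNIV. L2_norm M (\<lambda>x. f x $ i))" using sum[of UNIV] by simp
qed

locale chart_domain = bounded_open +
  assumes charts: "\<And>p. p \<in> frontier \<Omega> \<Longrightarrow> \<exists>r e \<rho> D\<rho>. straight_chart \<Omega> p r e \<rho> D\<rho>"
begin

lemma is_weak_grad_lincomb:
  assumes w: "w \<in> L2 dx" "is_weak_grad \<Omega> w G"
    and v: "v \<in> L2 dx" "is_weak_grad \<Omega> v H"
  shows "is_weak_grad \<Omega> (\<lambda>x. a * w x + b * v x + c) (\<lambda>x. a *\<^sub>R G x + b *\<^sub>R H x)"
  unfolding is_weak_grad_def
proof (intro conjI allI impI)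
  have G: "G \<in> L2 dx" "H \<in> L2 dx" using w(2) v(2) by (auto simp: is_weak_grad_def)
  show "(\<lambda>x. a *\<^sub>R G x + b *\<^sub>R H x) \<in> L2 dx" by (intro L2_add L2_scaleR G)
  fix \<theta> E assume t: "test_with_grad \<Omega> \<theta> E"
  then have "C1_with_grad \<theta> E" by (simp add: test_with_grad_def)
  note \<theta> = C1_L2[OF this]
  have one: "(\<lambda>_. 1::real) \<in> L2 dx" by (rule L2_continuous) simp
  have "(\<integral>x. 1 *\<^sub>R E x \<partial>dx) = - (\<integral>x. \<theta> x *\<^sub>R 0 \<partial>dx)"
    by (rule is_weak_gradD[OF C1_is_weak_grad[OF C1_const] t])
  then have E0: "(\<integral>x. E x \<partial>dx) = 0" by simp
  have "(\<integral>x. (a * w x + b * v x + c) *\<^sub>R E x \<partial>dx)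
      = (\<integral>x. a *\<^sub>R (w x *\<^sub>R E x) + b *\<^sub>R (v x *\<^sub>R E x) + c *\<^sub>R E x \<partial>dx)"
    by (simp add: scaleR_add_left)
  also have "\<dots> = a *\<^sub>R (\<integral>x. w x *\<^sub>R E x \<partial>dx) + b *\<^sub>R (\<integral>x. v x *\<^sub>R E x \<partial>dx) + c *\<^sub>R (\<integral>x. E x \<partial>dx)"
    using L2_integrable_scaleR[OF w(1) \<theta>(2)] L2_integrable_scaleR[OF v(1) \<theta>(2)] L2_imp_integrable[OF \<theta>(2)]
    by (simp del: scaleR_scaleR)
  also have "\<dots> = - (a *\<^sub>R (\<integral>x. \<theta> x *\<^sub>R G x \<partial>dx) + b *\<^sub>R (\<integral>x. \<theta> x *\<^sub>R H x \<partial>dx))"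
    by (simp add: is_weak_gradD[OF w(2) t] is_weak_gradD[OF v(2) t] E0)
  also have "\<dots> = - (\<integral>x. a *\<^sub>R (\<theta> x *\<^sub>R G x) + b *\<^sub>R (\<theta> x *\<^sub>R H x) \<partial>dx)"
    using L2_integrable_scaleR[OF \<theta>(1) G(1)] L2_integrable_scaleR[OF \<theta>(1) G(2)]
    by (simp del: scaleR_scaleR)
  also have "\<dots> = - (\<integral>x. \<theta> x *\<^sub>R (a *\<^sub>R G x + b *\<^sub>R H x) \<partial>dx)"
    by (simp add: scaleR_add_right mult.commute)
  finally show "(\<integral>x. (a * w x + b * v x + c) *\<^sub>R E x \<partial>dx)
      = - (\<integral>x. \<theta> x *\<^sub>R (a *\<^sub>R G x + b *\<^sub>R H x) \<partial>dx)" .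
qed

lemma H1_lincomb:
  assumes "w \<in> H1 \<Omega>" "v \<in> H1 \<Omega>"
  shows "(\<lambda>x. a * w x + b * v x + c) \<in> H1 \<Omega>"
    "AE x in dx. grad (\<lambda>x. a * w x + b * v x + c) x
        = a *\<^sub>R grad w x + b *\<^sub>R grad v x"
proof -
  have "(\<lambda>x. a *\<^sub>R w x + b *\<^sub>R v x + c) \<in> L2 dx"
    by (intro L2_add L2_scaleR H1_D(1) assms L2_continuous continuous_on_const)
  then have L2: "(\<lambda>x. a * w x + b * v x + c) \<in> L2 dx" by simp
  note 1 = H1_I[OF L2 is_weak_grad_lincomb[OF H1_D(1,2)[OF assms(1)] H1_D(1,2)[OF assms(2)]]]
  show "(\<lambda>x. a * w x + b * v x + c) \<in> H1 \<Omega>" by (rule 1(1))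
  show "AE x in dx. grad (\<lambda>x. a * w x + b * v x + c) x
        = a *\<^sub>R grad w x + b *\<^sub>R grad v x" by (rule 1(2))
qed

lemma L2_surface_measurable:
  assumes "\<phi> \<in> borel_measurable borel"
  shows "\<phi> \<in> borel_measurable dS"
  unfolding surface_def using assms
  by (intro measurable_restrict_space1) (simp cong: measurable_cong_sets)

text \<open>The constant \<open>c\<close> enters through the approximants, whose boundary values are exact. It is not treated as a
  function with a trace of its own, since constants have a trace only once \<open>\<partial>\<Omega>\<close> is
  known to have finite surface measure.\<close>

lemma trace_lincomb:
  fixes a b c :: real
  assumes w: "has_trace \<Omega> w g" and v: "has_trace \<Omega> v k"
  defines "W \<equiv> \<lambda>x. a * w x + b * v x + c"
  obtains \<phi> D where "C1_limit \<phi> D W (grad W)"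
    "(\<lambda>n. \<integral>\<^sup>+x. ennreal ((\<phi> n x - (a * g x + b * k x + c))\<^sup>2) \<partial>dS) \<longlonglongrightarrow> 0"
proof -
  obtain \<phi> D where \<phi>: "\<And>n. C1_with_grad (\<phi> n) (D n)" "H1_approx \<Omega> \<phi> D w"
    "(\<lambda>n. \<integral>\<^sup>+x. ennreal ((\<phi> n x - g x)\<^sup>2) \<partial>dS) \<longlonglongrightarrow> 0"
    using w unfolding has_trace_def by blast
  obtain \<psi> E where \<psi>: "\<And>n. C1_with_grad (\<psi> n) (E n)" "H1_approx \<Omega> \<psi> E v"
    "(\<lambda>n. \<integral>\<^sup>+x. ennreal ((\<psi> n x - k x)\<^sup>2) \<partial>dS) \<longlonglongrightarrow> 0"
    using v unfolding has_trace_def by blast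
  have H1: "w \<in> H1 \<Omega>" "v \<in> H1 \<Omega>" and gk: "g \<in> L2 dS" "k \<in> L2 dS"
    using w v by (auto simp: has_trace_def)
  note Wgrad = H1_lincomb[OF H1, of a b c, folded W_def]
  define \<eta> where "\<eta> n x = a * \<phi> n x + b * \<psi> n x + c" for n x
  define K where "K n x = a *\<^sub>R D n x + b *\<^sub>R E n x" for n x
  have C1: "C1_with_grad (\<eta> n) (K n)" for n
    using C1_add[OF C1_add[OF C1_cmult[OF \<phi>(1)[of n], of a] C1_cmult[OF \<psi>(1)[of n], of b]] C1_const[of c]]
    by (simp add: \<eta>_def[abs_def] K_def[abs_def])
  have null: "(\<lambda>n. \<bar>a\<bar> * p n + \<bar>b\<bar> * q n) \<longlonglongrightarrow> 0" if "p \<longlonglongrightarrow> 0" "q \<longlonglongrightarrow> 0" for p q :: "nat \<Rightarrow> real"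
    using tendsto_add[OF tendsto_mult_left[OF that(1), of "\<bar>a\<bar>"] tendsto_mult_left[OF that(2), of "\<bar>b\<bar>"]] by simp
  have lim: "C1_limit \<eta> K W (grad W)"
    unfolding C1_limit_def
  proof (intro conjI allI C1 H1_D[OF Wgrad(1)])
    show "(\<lambda>n. L2_norm dx (\<lambda>x. \<eta> n x - W x)) \<longlonglongrightarrow> 0"
    proof (rule Lim_null_comparison)
      have "L2_norm dx (\<lambda>x. \<eta> n x - W x)
          \<le> \<bar>a\<bar> * L2_norm dx (\<lambda>x. \<phi> n x - w x) + \<bar>b\<bar> * L2_norm dx (\<lambda>x. \<psi> n x - v x)" for n
        using L2_norm_lincomb_le[OF L2_diff[OF C1_L2(1)[OF \<phi>(1)[of n]] H1_D(1)[OF H1(1)]]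
            L2_diff[OF C1_L2(1)[OF \<psi>(1)[of n]] H1_D(1)[OF H1(2)]], of a b]
        by (simp add: \<eta>_def W_def algebra_simps)
      then show "\<forall>\<^sub>F n in sequentially. norm (L2_norm dx (\<lambda>x. \<eta> n x - W x))
          \<le> \<bar>a\<bar> * L2_norm dx (\<lambda>x. \<phi> n x - w x) + \<bar>b\<bar> * L2_norm dx (\<lambda>x. \<psi> n x - v x)"
        by (intro always_eventually) simp
    qed (use \<phi>(2) \<psi>(2) in \<open>auto simp: H1_approx_def intro: null\<close>)
    show "(\<lambda>n. L2_norm dx (\<lambda>x. K n x - grad W x)) \<longlonglongrightarrow> 0"
    proof (rule Lim_null_comparison)
      have "L2_norm dx (\<lambda>x. K n x - grad W x)
          \<le> \<bar>a\<bar> * L2_norm dx (\<lambda>x. D n x - grad w x) + \<bar>b\<bar> * L2_norm dx (\<lambda>x. E n x - grad v x)" for n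
      proof -
        have d: "(\<lambda>x. D n x - grad w x) \<in> L2 dx" "(\<lambda>x. E n x - grad v x) \<in> L2 dx"
          by (rule L2_diff[OF C1_L2(2)[OF \<phi>(1)] H1_D(3)[OF H1(1)]],
              rule L2_diff[OF C1_L2(2)[OF \<psi>(1)] H1_D(3)[OF H1(2)]])
        have "L2_norm dx (\<lambda>x. K n x - grad W x)
            = L2_norm dx (\<lambda>x. a *\<^sub>R (D n x - grad w x) + b *\<^sub>R (E n x - grad v x))"
        proof (rule L2_norm_cong_AE)
          show "(\<lambda>x. K n x - grad W x) \<in> L2 dx"
            by (rule L2_diff[OF C1_L2(2)[OF C1] H1_D(3)[OF Wgrad(1)]])
          show "(\<lambda>x. a *\<^sub>R (D n x - grad w x) + b *\<^sub>R (E n x - grad v x)) \<in> L2 dx"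
            by (intro L2_add L2_scaleR d)
          show "AE x in dx. norm (K n x - grad W x)
              = norm (a *\<^sub>R (D n x - grad w x) + b *\<^sub>R (E n x - grad v x))"
            using Wgrad(2) by eventually_elim (simp add: K_def algebra_simps)
        qed
        then show ?thesis using L2_norm_lincomb_le[OF d, of a b] by simp
      qed
      then show "\<forall>\<^sub>F n in sequentially. norm (L2_norm dx (\<lambda>x. K n x - grad W x))
          \<le> \<bar>a\<bar> * L2_norm dx (\<lambda>x. D n x - grad w x) + \<bar>b\<bar> * L2_norm dx (\<lambda>x. E n x - grad v x)"
        by (intro always_eventually) simp
    qed (use \<phi>(2) \<psi>(2) in \<open>auto simp: H1_approx_def intro: null\<close>)
  qed
  have "(\<lambda>n. \<integral>\<^sup>+x. ennreal ((\<eta> n x - (a * g x + b * k x + c))\<^sup>2) \<partial>dS) \<longlonglongrightarrow> 0"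
  proof -
    let ?p = "\<lambda>n. \<integral>\<^sup>+x. ennreal ((\<phi> n x - g x)\<^sup>2) \<partial>dS" and ?q = "\<lambda>n. \<integral>\<^sup>+x. ennreal ((\<psi> n x - k x)\<^sup>2) \<partial>dS"
    have up: "(\<integral>\<^sup>+x. ennreal ((\<eta> n x - (a * g x + b * k x + c))\<^sup>2) \<partial>dS)
        \<le> ennreal (2 * a\<^sup>2) * ?p n + ennreal (2 * b\<^sup>2) * ?q n" for n
    proof -
      have m: "(\<lambda>x. ennreal ((\<phi> n x - g x)\<^sup>2)) \<in> borel_measurable dS"
        "(\<lambda>x. ennreal ((\<psi> n x - k x)\<^sup>2)) \<in> borel_measurable dS"
        using L2_surface_measurable[OF C1_with_grad_D(4)[OF \<phi>(1)[of n]]] L2_D(1)[OF gk(1)]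
          L2_surface_measurable[OF C1_with_grad_D(4)[OF \<psi>(1)[of n]]] L2_D(1)[OF gk(2)] by measurable
      have "(\<integral>\<^sup>+x. ennreal ((\<eta> n x - (a * g x + b * k x + c))\<^sup>2) \<partial>dS)
          \<le> (\<integral>\<^sup>+x. ennreal (2 * a\<^sup>2) * ennreal ((\<phi> n x - g x)\<^sup>2) + ennreal (2 * b\<^sup>2) * ennreal ((\<psi> n x - k x)\<^sup>2) \<partial>dS)"
      proof (rule nn_integral_mono)
        fix x
        have "(\<eta> n x - (a * g x + b * k x + c))\<^sup>2 = (a * (\<phi> n x - g x) + b * (\<psi> n x - k x))\<^sup>2"
          by (simp add: \<eta>_def algebra_simps)
        also have "\<dots> \<le> 2 * a\<^sup>2 * (\<phi> n x - g x)\<^sup>2 + 2 * b\<^sup>2 * (\<psi> n x - k x)\<^sup>2"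
          using sum_squares_bound[of "a * (\<phi> n x - g x)" "b * (\<psi> n x - k x)"]
          by (simp add: power2_sum power_mult_distrib)
        finally have "ennreal ((\<eta> n x - (a * g x + b * k x + c))\<^sup>2)
            \<le> ennreal (2 * a\<^sup>2 * (\<phi> n x - g x)\<^sup>2 + 2 * b\<^sup>2 * (\<psi> n x - k x)\<^sup>2)" by (rule ennreal_leI)
        also have "\<dots> = ennreal (2 * a\<^sup>2 * (\<phi> n x - g x)\<^sup>2) + ennreal (2 * b\<^sup>2 * (\<psi> n x - k x)\<^sup>2)"
          by (rule ennreal_plus) simp_all
        also have "ennreal (2 * a\<^sup>2 * (\<phi> n x - g x)\<^sup>2) = ennreal (2 * a\<^sup>2) * ennreal ((\<phi> n x - g x)\<^sup>2)"
          by (rule ennreal_mult) simp_all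
        also have "ennreal (2 * b\<^sup>2 * (\<psi> n x - k x)\<^sup>2) = ennreal (2 * b\<^sup>2) * ennreal ((\<psi> n x - k x)\<^sup>2)"
          by (rule ennreal_mult) simp_all
        finally show "ennreal ((\<eta> n x - (a * g x + b * k x + c))\<^sup>2)
            \<le> ennreal (2 * a\<^sup>2) * ennreal ((\<phi> n x - g x)\<^sup>2) + ennreal (2 * b\<^sup>2) * ennreal ((\<psi> n x - k x)\<^sup>2)" .
      qed
      also have "\<dots> = ennreal (2 * a\<^sup>2) * ?p n + ennreal (2 * b\<^sup>2) * ?q n"
        using m by (simp add: nn_integral_add nn_integral_cmult)
      finally show ?thesis .
    qed
    have "(\<lambda>n. ennreal (2 * a\<^sup>2) * ?p n + ennreal (2 * b\<^sup>2) * ?q n) \<longlonglongrightarrow> ennreal (2 * a\<^sup>2) * 0 + ennreal (2 * b\<^sup>2) * 0"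
      using \<phi>(3) \<psi>(3) by (intro tendsto_add ennreal_tendsto_cmult) auto
    then have lim0: "(\<lambda>n. ennreal (2 * a\<^sup>2) * ?p n + ennreal (2 * b\<^sup>2) * ?q n) \<longlonglongrightarrow> 0" by simp
    show ?thesis
      by (rule tendsto_sandwich[OF _ always_eventually tendsto_const lim0]) (use up in auto)
  qed
  with lim show ?thesis by (rule that)
qed

lemma trace_lincomb_H1_0:
  assumes "has_trace \<Omega> w g" "has_trace \<Omega> v k" "\<And>x. a * g x + b * k x + c = 0"
  shows "(\<lambda>x. a * w x + b * v x + c) \<in> H1_0 \<Omega>"
proof -
  have H1: "w \<in> H1 \<Omega>" "v \<in> H1 \<Omega>" using assms(1,2) by (auto simp: has_trace_def)
  obtain \<phi> D where "C1_limit \<phi> D (\<lambda>x. a * w x + b * v x + c) (grad (\<lambda>x. a * w x + b * v x + c))"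
    "(\<lambda>n. \<integral>\<^sup>+x. ennreal ((\<phi> n x - (a * g x + b * k x + c))\<^sup>2) \<partial>dS) \<longlonglongrightarrow> 0"
    by (rule trace_lincomb[OF assms(1,2)])
  then show ?thesis
    by (intro zero_trace_imp_H1_0[OF charts H1_lincomb(1)[OF H1]]) (auto simp: surface_null_def assms(3))
qed

lemma has_trace_lincomb:
  assumes "has_trace \<Omega> w g" "has_trace \<Omega> v k"
  shows "has_trace \<Omega> (\<lambda>x. a * w x + b * v x) (\<lambda>x. a * g x + b * k x)"
proof -
  have H1: "w \<in> H1 \<Omega>" "v \<in> H1 \<Omega>" and gk: "g \<in> L2 dS" "k \<in> L2 dS"
    using assms by (auto simp: has_trace_def)
  obtain \<phi> D where *: "C1_limit \<phi> D (\<lambda>x. a * w x + b * v x + 0) (grad (\<lambda>x. a * w x + b * v x + 0))"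
    "(\<lambda>n. \<integral>\<^sup>+x. ennreal ((\<phi> n x - (a * g x + b * k x + 0))\<^sup>2) \<partial>dS) \<longlonglongrightarrow> 0"
    by (rule trace_lincomb[OF assms])
  have "(\<lambda>x. a * g x + b * k x) \<in> L2 dS"
    using L2_add[OF L2_scaleR[OF gk(1), of a] L2_scaleR[OF gk(2), of b]] by simp
  moreover have "(\<lambda>x. a * w x + b * v x) \<in> H1 \<Omega>" using H1_lincomb(1)[OF H1, of a b 0] by simp
  ultimately show ?thesis
    unfolding has_trace_def H1_approx_def using * unfolding C1_limit_def by auto
qed

lemma test_in_H1_0:
  assumes "test_with_grad \<Omega> \<phi> D"
  shows "\<phi> \<in> H1_0 \<Omega>" "AE x in dx. grad \<phi> x = D x"
proof -
  have C1: "C1_with_grad \<phi> D" using assms by (simp add: test_with_grad_def)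
  note 1 = H1_I[OF C1_L2(1)[OF C1] C1_is_weak_grad[OF C1]]
  show "AE x in dx. grad \<phi> x = D x" by (rule 1(2))
  have "L2_norm dx (\<lambda>x. D x - grad \<phi> x) = L2_norm dx (\<lambda>x. 0 :: real^3)"
  proof (rule L2_norm_cong_AE)
    show "(\<lambda>x. D x - grad \<phi> x) \<in> L2 dx"
      by (rule L2_diff[OF C1_L2(2)[OF C1] H1_D(3)[OF 1(1)]])
    show "(\<lambda>x. 0 :: real^3) \<in> L2 dx" by (rule L2_continuous) simp
    show "AE x in dx. norm (D x - grad \<phi> x) = norm (0 :: real^3)"
      using 1(2) by eventually_elim simp
  qed
  then show "\<phi> \<in> H1_0 \<Omega>"
    unfolding H1_0_def H1_approx_def using 1(1) assms
    by (auto intro!: exI[of _ "\<lambda>_. \<phi>"] exI[of _ "\<lambda>_. D"])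
qed

lemma Poincare_H1_0:
  assumes "w \<in> H1_0 \<Omega>" "\<Omega> \<subseteq> cball 0 R" "0 \<le> R"
  shows "L2_norm dx w \<le> 2 * R * L2_norm dx (grad w)"
proof -
  have w: "w \<in> H1 \<Omega>" using assms(1) by (simp add: H1_0_def)
  obtain \<phi> D where t: "\<And>n. test_with_grad \<Omega> (\<phi> n) (D n)" and lim: "H1_approx \<Omega> \<phi> D w"
    using assms(1) unfolding H1_0_def by blast
  have C1: "C1_with_grad (\<phi> n) (D n)" for n using t[of n] by (simp add: test_with_grad_def)
  have le: "L2_norm dx w \<le> L2_norm dx (\<lambda>x. \<phi> n x - w x)
      + 2 * R * (L2_norm dx (\<lambda>x. D n x - grad w x) + L2_norm dx (grad w))" for n
  proof -
    have zero: "(\<lambda>x. 0) \<in> L2 dx" "(\<lambda>x. 0 :: real^3) \<in> L2 dx" by (auto intro: L2_continuous)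
    have "L2_norm dx w \<le> L2_norm dx (\<lambda>x. w x - \<phi> n x) + L2_norm dx (\<phi> n)"
      using L2_norm_triangle_diff[OF H1_D(1)[OF w] C1_L2(1)[OF C1[of n]] zero(1)] by simp
    also have "L2_norm dx (\<phi> n) \<le> 2 * R * L2_norm dx (D n)" by (rule Poincare_test[OF t assms(2,3)])
    also have "L2_norm dx (D n) \<le> L2_norm dx (\<lambda>x. D n x - grad w x) + L2_norm dx (grad w)"
      using L2_norm_triangle_diff[OF C1_L2(2)[OF C1[of n]] H1_D(3)[OF w] zero(2)] by simp
    finally show ?thesis using assms(3) by (simp add: L2_norm_minus[of _ w] mult_left_mono)
  qed
  have "(\<lambda>n. L2_norm dx (\<lambda>x. \<phi> n x - w x)
      + 2 * R * (L2_norm dx (\<lambda>x. D n x - grad w x) + L2_norm dx (grad w)))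
      \<longlonglongrightarrow> 0 + 2 * R * (0 + L2_norm dx (grad w))"
    using lim unfolding H1_approx_def by (intro tendsto_intros) auto
  then show ?thesis using LIMSEQ_le_const[of _ _ "L2_norm dx w"] le by auto
qed

text \<open>Fluxes of weak solutions have this property by definition. Testing with \<open>H\<^sup>1\<^sub>0\<close> includes testing with \<open>C\<^sup>1\<^sub>c\<close>
  functions, so the weak divergence vanishes (\<open>solenoidal_weak_div\<close>).\<close>

definition solenoidal :: "(real^3 \<Rightarrow> real^3) \<Rightarrow> bool" where
  "solenoidal X \<longleftrightarrow> X \<in> L2 dx \<and>
     (\<forall>\<psi>\<in>H1_0 \<Omega>. (\<integral>x. X x \<bullet> grad \<psi> x \<partial>dx) = 0)"

lemma solenoidal_weak_div:
  assumes "solenoidal X"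
  shows "weak_div \<Omega> X \<in> L2 dx" "AE x in dx. weak_div \<Omega> X x = 0"
proof -
  have X: "X \<in> L2 dx" using assms by (simp add: solenoidal_def)
  have zero: "(\<integral>x. X x \<bullet> D x \<partial>dx) = 0" if t: "test_with_grad \<Omega> \<phi> D" for \<phi> D
  proof -
    have C1: "C1_with_grad \<phi> D" using t by (simp add: test_with_grad_def)
    have "\<phi> \<in> H1 \<Omega>" using test_in_H1_0(1)[OF t] by (simp add: H1_0_def)
    then have "(\<integral>x. X x \<bullet> D x \<partial>dx) = (\<integral>x. X x \<bullet> grad \<phi> x \<partial>dx)"
      using test_in_H1_0(2)[OF t] L2_integrable_inner[OF X C1_L2(2)[OF C1]]
        L2_integrable_inner[OF X H1_D(3)]
      by (intro integral_cong_AE) (auto elim!: eventually_mono)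
    then show ?thesis using assms test_in_H1_0(1)[OF t] by (simp add: solenoidal_def)
  qed
  have "is_weak_div \<Omega> X (\<lambda>x. 0)"
    unfolding is_weak_div_def using zero L2_continuous[of "\<lambda>_. 0::real"] by auto
  then have d: "is_weak_div \<Omega> X (weak_div \<Omega> X)" unfolding weak_div_def by (rule someI[where P = "is_weak_div \<Omega> X"])
  then show L2: "weak_div \<Omega> X \<in> L2 dx" by (simp add: is_weak_div_def)
  show "AE x in dx. weak_div \<Omega> X x = 0"
  proof (rule test_integral_0_imp_AE_0[OF L2])
    fix \<phi> D assume t: "test_with_grad \<Omega> \<phi> D"
    then have "(\<integral>x. X x \<bullet> D x \<partial>dx) = - (\<integral>x. weak_div \<Omega> X x * \<phi> x \<partial>dx)"
      using d by (simp add: is_weak_div_def)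
    then show "(\<integral>x. \<phi> x *\<^sub>R weak_div \<Omega> X x \<partial>dx) = 0" using zero[OF t] by (simp add: mult.commute)
  qed
qed

text \<open>The difference of two extensions of \<open>g\<close> has trace zero and is therefore in \<open>H\<^sup>1\<^sub>0\<close>.\<close>

lemma solenoidal_trace_independent:
  assumes X: "solenoidal X" and G: "has_trace \<Omega> G g" "has_trace \<Omega> G' g"
  shows "(\<integral>x. X x \<bullet> grad G x \<partial>dx) = (\<integral>x. X x \<bullet> grad G' x \<partial>dx)"
proof -
  have XL2: "X \<in> L2 dx" using X by (simp add: solenoidal_def)
  have H1: "G \<in> H1 \<Omega>" "G' \<in> H1 \<Omega>" using G by (auto simp: has_trace_def)
  let ?W = "\<lambda>x. 1 * G x + (-1) * G' x + 0"
  have "?W \<in> H1_0 \<Omega>" by (rule trace_lincomb_H1_0[OF G]) simp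
  then have "(\<integral>x. X x \<bullet> grad ?W x \<partial>dx) = 0" using X unfolding solenoidal_def by blast
  moreover have "(\<integral>x. X x \<bullet> grad ?W x \<partial>dx)
      = (\<integral>x. X x \<bullet> grad G x - X x \<bullet> grad G' x \<partial>dx)"
  proof (rule integral_cong_AE)
    show "(\<lambda>x. X x \<bullet> grad ?W x) \<in> borel_measurable dx"
      using L2_integrable_inner[OF XL2 H1_D(3)[OF H1_lincomb(1)[OF H1, of 1 "-1" 0]]] by simp
    show "(\<lambda>x. X x \<bullet> grad G x - X x \<bullet> grad G' x) \<in> borel_measurable dx"
      using L2_integrable_inner[OF XL2 H1_D(3)[OF H1(1)]] L2_integrable_inner[OF XL2 H1_D(3)[OF H1(2)]] by simp
    show "AE x in dx. X x \<bullet> grad ?W x = X x \<bullet> grad G x - X x \<bullet> grad G' x"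
      using H1_lincomb(2)[OF H1, of 1 "-1" 0] by eventually_elim (simp add: inner_diff_right)
  qed
  ultimately show ?thesis
    using L2_integrable_inner[OF XL2 H1_D(3)[OF H1(1)]] L2_integrable_inner[OF XL2 H1_D(3)[OF H1(2)]] by simp
qed

text \<open>The definition refers to some extension of \<open>g\<close> and some weak divergence of \<open>X\<close>. The latter is zero
  almost everywhere, and then the value is the same for every extension.\<close>

lemma normal_trace_eq:
  assumes X: "solenoidal X" and G: "has_trace \<Omega> G g"
  shows "normal_trace \<Omega> X g = (\<integral>x. X x \<bullet> grad G x \<partial>dx)"
proof -
  have XL2: "X \<in> L2 dx" using X by (simp add: solenoidal_def)
  define G' where "G' = (SOME G. has_trace \<Omega> G g)"
  have G': "has_trace \<Omega> G' g" unfolding G'_def using G by (rule someI[where P = "\<lambda>G. has_trace \<Omega> G g"])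
  then have H1: "G' \<in> H1 \<Omega>" by (simp add: has_trace_def)
  have "normal_trace \<Omega> X g = (\<integral>x. X x \<bullet> grad G' x + weak_div \<Omega> X x * G' x \<partial>dx)"
    by (simp add: normal_trace_def G'_def Let_def)
  also have "\<dots> = (\<integral>x. X x \<bullet> grad G' x \<partial>dx)"
  proof (rule integral_cong_AE)
    have int: "integrable dx (\<lambda>x. X x \<bullet> grad G' x)" by (rule L2_integrable_inner[OF XL2 H1_D(3)[OF H1]])
    then show "(\<lambda>x. X x \<bullet> grad G' x) \<in> borel_measurable dx" by simp
    have "weak_div \<Omega> X \<in> L2 dx" by (rule solenoidal_weak_div(1)[OF X])
    then have "weak_div \<Omega> X \<in> borel_measurable dx" by (rule L2_D)
    then show "(\<lambda>x. X x \<bullet> grad G' x + weak_div \<Omega> X x * G' x) \<in> borel_measurable dx"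
      using int L2_D(1)[OF H1_D(1)[OF H1]] by measurable
    show "AE x in dx. X x \<bullet> grad G' x + weak_div \<Omega> X x * G' x = X x \<bullet> grad G' x"
      using solenoidal_weak_div(2)[OF X] by eventually_elim simp
  qed
  also have "\<dots> = (\<integral>x. X x \<bullet> grad G x \<partial>dx)" by (rule solenoidal_trace_independent[OF X G' G])
  finally show ?thesis .
qed

text \<open>Since every extension of \<open>g\<close> may be used in Green's formula, the Cauchy-Schwarz inequality gives
  the bound with the norm of each extension, hence with the infimum.\<close>

lemma normal_trace_bound:
  assumes X: "solenoidal X" and g: "g \<in> W_half \<Omega>"
  shows "\<bar>normal_trace \<Omega> X g\<bar> \<le> L2_norm dx X * W_half_norm \<Omega> g"
proof -
  have XL2: "X \<in> L2 dx" using X by (simp add: solenoidal_def)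
  have le: "\<bar>normal_trace \<Omega> X g\<bar> \<le> L2_norm dx X * H1_norm \<Omega> G" if G: "has_trace \<Omega> G g" for G
  proof -
    have H1: "G \<in> H1 \<Omega>" using G by (simp add: has_trace_def)
    have "\<bar>normal_trace \<Omega> X g\<bar> \<le> L2_norm dx X * L2_norm dx (grad G)"
      unfolding normal_trace_eq[OF X G] by (rule L2_Cauchy_Schwarz[OF XL2 H1_D(3)[OF H1]])
    also have "\<dots> \<le> L2_norm dx X * H1_norm \<Omega> G"
    proof (rule mult_left_mono)
      show "L2_norm dx (grad G) \<le> H1_norm \<Omega> G"
        unfolding H1_norm_def by (rule real_le_rsqrt) simp
    qed simp
    finally show ?thesis .
  qed
  obtain G where G: "has_trace \<Omega> G g" using g by (auto simp: W_half_def)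
  show ?thesis
  proof (cases "L2_norm dx X = 0")
    case True
    then show ?thesis using le[OF G] by simp
  next
    case False
    then have pos: "0 < L2_norm dx X" using L2_norm_nonneg[of dx X] by linarith
    have "\<bar>normal_trace \<Omega> X g\<bar> / L2_norm dx X \<le> W_half_norm \<Omega> g"
      unfolding W_half_norm_def
    proof (rule cINF_greatest)
      show "{G. has_trace \<Omega> G g} \<noteq> {}" using G by blast
      show "\<bar>normal_trace \<Omega> X g\<bar> / L2_norm dx X \<le> H1_norm \<Omega> G" if "G \<in> {G. has_trace \<Omega> G g}" for G
        using le[of G] that pos by (simp add: divide_le_eq mult.commute)
    qed
    then show ?thesis using pos by (simp add: divide_le_eq mult.commute)
  qed
qed

lemma normal_trace_lincomb:
  assumes X: "solenoidal X" and g: "g \<in> W_half \<Omega>" "h \<in> W_half \<Omega>"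
  shows "normal_trace \<Omega> X (\<lambda>x. a * g x + b * h x) = a * normal_trace \<Omega> X g + b * normal_trace \<Omega> X h"
proof -
  have XL2: "X \<in> L2 dx" using X by (simp add: solenoidal_def)
  obtain G H where G: "has_trace \<Omega> G g" "has_trace \<Omega> H h" using g by (auto simp: W_half_def)
  then have H1: "G \<in> H1 \<Omega>" "H \<in> H1 \<Omega>" by (auto simp: has_trace_def)
  let ?W = "\<lambda>x. a * G x + b * H x"
  have W: "?W \<in> H1 \<Omega>" "AE x in dx. grad ?W x = a *\<^sub>R grad G x + b *\<^sub>R grad H x"
    using H1_lincomb[OF H1, of a b 0] by simp_all
  have int: "integrable dx (\<lambda>x. X x \<bullet> grad G x)" "integrable dx (\<lambda>x. X x \<bullet> grad H x)"
    by (rule L2_integrable_inner[OF XL2 H1_D(3)[OF H1(1)]], rule L2_integrable_inner[OF XL2 H1_D(3)[OF H1(2)]])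
  have "normal_trace \<Omega> X (\<lambda>x. a * g x + b * h x) = (\<integral>x. X x \<bullet> grad ?W x \<partial>dx)"
    by (rule normal_trace_eq[OF X has_trace_lincomb[OF G]])
  also have "\<dots> = (\<integral>x. a * (X x \<bullet> grad G x) + b * (X x \<bullet> grad H x) \<partial>dx)"
  proof (rule integral_cong_AE)
    show "(\<lambda>x. X x \<bullet> grad ?W x) \<in> borel_measurable dx"
      using L2_integrable_inner[OF XL2 H1_D(3)[OF W(1)]] by simp
    show "(\<lambda>x. a * (X x \<bullet> grad G x) + b * (X x \<bullet> grad H x)) \<in> borel_measurable dx"
      using int by measurable
    show "AE x in dx. X x \<bullet> grad ?W x = a * (X x \<bullet> grad G x) + b * (X x \<bullet> grad H x)"
      using W(2) by eventually_elim (simp add: inner_add_right)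
  qed
  also have "\<dots> = a * normal_trace \<Omega> X g + b * normal_trace \<Omega> X h"
    using int by (simp add: normal_trace_eq[OF X G(1)] normal_trace_eq[OF X G(2)])
  finally show ?thesis .
qed

lemma normal_trace_in_W_minus_half:
  assumes X: "solenoidal X"
  shows "(\<lambda>g. c * normal_trace \<Omega> X g) \<in> W_minus_half \<Omega>"
  unfolding W_minus_half_def
proof (intro CollectI conjI ballI allI)
  fix g h assume gh: "g \<in> W_half \<Omega>" "h \<in> W_half \<Omega>"
  show "c * normal_trace \<Omega> X (\<lambda>x. g x + h x) = c * normal_trace \<Omega> X g + c * normal_trace \<Omega> X h"
    using normal_trace_lincomb[OF X gh, of 1 1] by (simp add: algebra_simps)
next
  fix k g assume g: "g \<in> W_half \<Omega>"
  show "c * normal_trace \<Omega> X (\<lambda>x. k * g x) = k * (c * normal_trace \<Omega> X g)"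
    using normal_trace_lincomb[OF X g g, of k 0] by simp
next
  show "\<exists>C. \<forall>g\<in>W_half \<Omega>. \<bar>c * normal_trace \<Omega> X g\<bar> \<le> C * W_half_norm \<Omega> g"
  proof (intro exI ballI)
    fix g assume g: "g \<in> W_half \<Omega>"
    show "\<bar>c * normal_trace \<Omega> X g\<bar> \<le> (\<bar>c\<bar> * L2_norm dx X) * W_half_norm \<Omega> g"
      using mult_left_mono[OF normal_trace_bound[OF X g], of "\<bar>c\<bar>"] by (simp add: abs_mult mult.assoc)
  qed
qed

text \<open>The difference is the normal trace of \<open>c X - Y\<close>, which is again divergence-free.\<close>

lemma normal_trace_diff_norm:
  assumes X: "solenoidal X" and Y: "solenoidal Y"
  shows "W_minus_half_norm \<Omega> (\<lambda>g. c * normal_trace \<Omega> X g - normal_trace \<Omega> Y g)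
    \<le> ennreal (L2_norm dx (\<lambda>x. c *\<^sub>R X x - Y x))"
proof -
  let ?Z = "\<lambda>x. c *\<^sub>R X x - Y x"
  have L2: "X \<in> L2 dx" "Y \<in> L2 dx" using X Y by (auto simp: solenoidal_def)
  have int: "(\<integral>x. ?Z x \<bullet> G x \<partial>dx) = c * (\<integral>x. X x \<bullet> G x \<partial>dx) - (\<integral>x. Y x \<bullet> G x \<partial>dx)" if "G \<in> L2 dx" for G
    using L2_integrable_inner[OF L2(1) that] L2_integrable_inner[OF L2(2) that]
    by (simp add: inner_diff_left)
  have Z: "solenoidal ?Z"
    unfolding solenoidal_def
  proof (intro conjI ballI L2_diff L2_scaleR L2)
    fix \<psi> assume \<psi>: "\<psi> \<in> H1_0 \<Omega>"
    then have "\<psi> \<in> H1 \<Omega>" by (simp add: H1_0_def)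
    from int[OF H1_D(3)[OF this]] show "(\<integral>x. ?Z x \<bullet> grad \<psi> x \<partial>dx) = 0"
      using X Y \<psi> by (simp add: solenoidal_def)
  qed
  show ?thesis
    unfolding W_minus_half_norm_def
  proof (rule SUP_least)
    fix g assume "g \<in> {g \<in> W_half \<Omega>. W_half_norm \<Omega> g \<le> 1}"
    then have g: "g \<in> W_half \<Omega>" "W_half_norm \<Omega> g \<le> 1" by auto
    obtain G where G: "has_trace \<Omega> G g" using g(1) by (auto simp: W_half_def)
    then have "G \<in> H1 \<Omega>" by (simp add: has_trace_def)
    from int[OF H1_D(3)[OF this]]
    have "c * normal_trace \<Omega> X g - normal_trace \<Omega> Y g = normal_trace \<Omega> ?Z g"
      unfolding normal_trace_eq[OF X G] normal_trace_eq[OF Y G] normal_trace_eq[OF Z G] by simp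
    also have "\<bar>\<dots>\<bar> \<le> L2_norm dx ?Z * W_half_norm \<Omega> g" by (rule normal_trace_bound[OF Z g(1)])
    also have "\<dots> \<le> L2_norm dx ?Z" using g(2) by (intro mult_left_le) simp_all
    finally show "ennreal \<bar>c * normal_trace \<Omega> X g - normal_trace \<Omega> Y g\<bar> \<le> ennreal (L2_norm dx ?Z)"
      by (rule ennreal_leI)
  qed
qed

end

section \<open>Stability of the flux\<close>

context bounded_open
begin

lemma level_truncation_L2_null:
  fixes G :: "real^3 \<Rightarrow> 'b::euclidean_space"
  assumes "G \<in> L2 dx" "0 < \<eta>"
  obtains R where "0 < R" "L2_norm dx (\<lambda>x. indicator {x. R < norm (G x)} x *\<^sub>R G x) < \<eta>"
proof -
  have Gm: "G \<in> borel_measurable dx" by (rule L2_D(1)[OF assms(1)])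
  have "(\<lambda>n. \<integral>x. (norm (indicator {x. real n < norm (G x)} x *\<^sub>R G x))\<^sup>2 \<partial>dx) \<longlonglongrightarrow> (\<integral>x. 0 \<partial>dx)"
  proof (rule integral_dominated_convergence)
    show "integrable dx (\<lambda>x. (norm (G x))\<^sup>2)" by (rule L2_D(2)[OF assms(1)])
    have eq: "(\<lambda>x. (norm (indicator {x. real n < norm (G x)} x *\<^sub>R G x))\<^sup>2)
        = (\<lambda>x. if real n < norm (G x) then (norm (G x))\<^sup>2 else 0)" for n
      by (auto simp: indicator_def)
    show "(\<lambda>x. (norm (indicator {x. real n < norm (G x)} x *\<^sub>R G x))\<^sup>2) \<in> borel_measurable dx" for n
      unfolding eq using Gm by measurable
    show "AE x in dx. norm ((norm (indicator {x. real n < norm (G x)} x *\<^sub>R G x))\<^sup>2) \<le> (norm (G x))\<^sup>2" for n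
      by (intro AE_I2) (simp add: indicator_def)
    show "AE x in dx. (\<lambda>n. (norm (indicator {x. real n < norm (G x)} x *\<^sub>R G x))\<^sup>2) \<longlonglongrightarrow> 0"
    proof (intro AE_I2)
      fix x
      obtain N where "norm (G x) < real N" using reals_Archimedean2 by blast
      then have "\<forall>\<^sub>F n in sequentially. (norm (indicator {x. real n < norm (G x)} x *\<^sub>R G x))\<^sup>2 = 0"
        unfolding eventually_sequentially by (intro exI[of _ N]) (auto simp: indicator_def)
      then show "(\<lambda>n. (norm (indicator {x. real n < norm (G x)} x *\<^sub>R G x))\<^sup>2) \<longlonglongrightarrow> 0"
        by (rule tendsto_eventually)
    qed
  qed simp
  then have "(\<lambda>n. L2_norm dx (\<lambda>x. indicator {x. real n < norm (G x)} x *\<^sub>R G x)) \<longlonglongrightarrow> 0"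
    unfolding L2_norm_def using tendsto_real_sqrt by fastforce
  then have "\<forall>\<^sub>F n in sequentially. L2_norm dx (\<lambda>x. indicator {x. real n < norm (G x)} x *\<^sub>R G x) < \<eta> \<and> 0 < n"
    by (intro eventually_conj order_tendstoD(2)[OF _ assms(2)] eventually_gt_at_top)
  then obtain n where "L2_norm dx (\<lambda>x. indicator {x. real n < norm (G x)} x *\<^sub>R G x) < \<eta>" "0 < n"
    unfolding eventually_sequentially by blast
  then show ?thesis by (intro that[of "real n"]) auto
qed

text \<open>Only the smallness of \<open>a t\<close> in \<open>L\<^sup>2\<close> is known, so \<open>c t\<close> is small in the mean but not uniformly.
  Where \<open>\<bar>G\<bar> \<le> R\<close> the product is at most \<open>R \<bar>c t\<bar>\<close>, which is small in \<open>L\<^sup>2\<close>; elsewhere it is at most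
  \<open>K \<bar>G\<bar>\<close>, which is small in \<open>L\<^sup>2\<close> for large \<open>R\<close>.\<close>

lemma bounded_Hoelder_multiplier_tendsto_0:
  fixes G :: "real^3 \<Rightarrow> 'b::euclidean_space" and a :: "real \<Rightarrow> real^3 \<Rightarrow> 'c::euclidean_space"
    and c :: "real \<Rightarrow> real^3 \<Rightarrow> real"
  assumes G: "G \<in> L2 dx" and \<alpha>: "0 < \<alpha>" and K: "0 \<le> K" and C: "0 \<le> C"
    and c: "\<And>t. 0 < t \<Longrightarrow> c t \<in> borel_measurable dx"
      "\<And>t x. 0 < t \<Longrightarrow> x \<in> \<Omega> \<Longrightarrow> \<bar>c t x\<bar> \<le> K"
      "\<And>t x. 0 < t \<Longrightarrow> x \<in> \<Omega> \<Longrightarrow> \<bar>c t x\<bar> \<le> C * norm (a t x) powr \<alpha>"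
    and a: "\<And>t. 0 < t \<Longrightarrow> a t \<in> L2 dx"
      "((\<lambda>t. L2_norm dx (a t)) \<longlongrightarrow> 0) (at_right 0)"
  shows "((\<lambda>t. L2_norm dx (\<lambda>x. c t x *\<^sub>R G x)) \<longlongrightarrow> 0) (at_right 0)"
proof -
  let ?one = "L2_norm dx (\<lambda>x. 1::real)"
  have one: "(\<lambda>x. 1::real) \<in> L2 dx" by (rule L2_continuous) simp
  have Gm: "G \<in> borel_measurable dx" by (rule L2_D(1)[OF G])
  have main: "\<forall>\<^sub>F t in at_right 0. L2_norm dx (\<lambda>x. c t x *\<^sub>R G x) < \<eta>" if \<eta>: "0 < \<eta>" for \<eta>
  proof -
    define k where "k = K + 1"
    have k: "0 < k" "K \<le> k" using K by (simp_all add: k_def)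
    have "0 < \<eta> / (2 * k)" using \<eta> k by simp
    then obtain R where R: "0 < R"
      "L2_norm dx (\<lambda>x. indicator {x. R < norm (G x)} x *\<^sub>R G x) < \<eta> / (2 * k)"
      by (rule level_truncation_L2_null[OF G])
    let ?tail = "\<lambda>x. indicator {x. R < norm (G x)} x *\<^sub>R G x"
    have tail: "?tail \<in> L2 dx"
    proof (rule L2_bound[OF G, of _ 1])
      have "?tail = (\<lambda>x. if R < norm (G x) then G x else 0)" by (auto simp: indicator_def)
      then show "?tail \<in> borel_measurable dx" using Gm by simp
    qed (auto simp: indicator_def)
    have Ktail: "K * L2_norm dx ?tail < \<eta> / 2"
    proof -
      have "K * L2_norm dx ?tail \<le> k * L2_norm dx ?tail" by (rule mult_right_mono[OF k(2)]) simp
      also have "\<dots> < k * (\<eta> / (2 * k))" by (rule mult_strict_left_mono[OF R(2) k(1)])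
      also have "\<dots> = \<eta> / 2" using k(1) by simp
      finally show ?thesis .
    qed
    have "((\<lambda>\<delta>. R * (C * \<delta> powr \<alpha> * ?one)) \<longlongrightarrow> R * (C * 0 * ?one)) (at_right 0)"
    proof (intro tendsto_mult tendsto_const)
      show "((\<lambda>\<delta>::real. \<delta> powr \<alpha>) \<longlongrightarrow> 0) (at_right 0)"
        by (rule tendsto_zero_powrI[OF tendsto_ident_at tendsto_const _ \<alpha>])
           (simp add: eventually_at_filter)
    qed
    then have "\<forall>\<^sub>F \<delta> in at_right 0. R * (C * \<delta> powr \<alpha> * ?one) < \<eta> / 4"
      by (rule order_tendstoD(2)) (use \<eta> in simp)
    then have "\<forall>\<^sub>F \<delta> in at_right 0. R * (C * \<delta> powr \<alpha> * ?one) < \<eta> / 4 \<and> 0 < \<delta>"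
      by (intro eventually_conj eventually_at_right_less)
    then obtain \<delta> where \<delta>: "R * (C * \<delta> powr \<alpha> * ?one) < \<eta> / 4" "0 < \<delta>"
      using eventually_happens'[OF trivial_limit_at_right_real] by blast
    have "((\<lambda>t. R * (K / \<delta> * L2_norm dx (a t))) \<longlongrightarrow> R * (K / \<delta> * 0)) (at_right 0)"
      by (intro tendsto_mult tendsto_const a(2))
    then have "\<forall>\<^sub>F t in at_right 0. R * (K / \<delta> * L2_norm dx (a t)) < \<eta> / 4"
      by (rule order_tendstoD(2)) (use \<eta> in simp)
    then show ?thesis
      using eventually_at_right_less[of "0::real"]
    proof eventually_elim
      case (elim t)
      have t: "0 < t" by (rule elim(2))
      have cL2: "(\<lambda>x. c t x *\<^sub>R f x) \<in> L2 dx" if "f \<in> L2 dx" for f :: "real^3 \<Rightarrow> 'd::euclidean_space"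
        by (rule L2_mult_bounded[OF that c(1)[OF t], of K]) (use c(2)[OF t] space_lebesgue_on_\<Omega> in blast)
      have c1: "c t \<in> L2 dx" using cL2[OF one] by simp
      have cn: "(\<lambda>x. norm (c t x)) \<in> L2 dx" by (rule L2_norm_fun[OF c1])
      have an: "(\<lambda>x. norm (a t x)) \<in> L2 dx" by (rule L2_norm_fun[OF a(1)[OF t]])
      \<comment> \<open>Where \<open>a\<close> is at most \<open>\<delta>\<close> the Hoelder bound is small; elsewhere \<open>K\<close> is at most \<open>K * \<bar>a\<bar> / \<delta>\<close>.\<close>
      have "L2_norm dx (c t) \<le> 1 * L2_norm dx (\<lambda>x. (C * \<delta> powr \<alpha>) *\<^sub>R 1 + (K / \<delta>) *\<^sub>R norm (a t x))"
      proof (rule L2_norm_mono_dx[OF c1 L2_add[OF L2_scaleR[OF one] L2_scaleR[OF an]]])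
        fix x assume x: "x \<in> \<Omega>"
        have nonneg: "0 \<le> C * \<delta> powr \<alpha>" "0 \<le> K / \<delta> * norm (a t x)" using C K \<delta>(2) by simp_all
        have "\<bar>c t x\<bar> \<le> C * \<delta> powr \<alpha> + K / \<delta> * norm (a t x)"
        proof (cases "norm (a t x) \<le> \<delta>")
          case True
          have "\<bar>c t x\<bar> \<le> C * norm (a t x) powr \<alpha>" by (rule c(3)[OF t x])
          also have "\<dots> \<le> C * \<delta> powr \<alpha>"
            using True C \<alpha> by (intro mult_left_mono powr_mono2) auto
          finally show ?thesis using nonneg by linarith
        next
          case False
          have "\<bar>c t x\<bar> \<le> K" by (rule c(2)[OF t x])
          also have "K = K / \<delta> * \<delta>" using \<delta>(2) by simp
          also have "\<dots> \<le> K / \<delta> * norm (a t x)"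
            using False K \<delta>(2) by (intro mult_left_mono) auto
          finally show ?thesis using nonneg by linarith
        qed
        then show "norm (c t x) \<le> 1 * norm ((C * \<delta> powr \<alpha>) *\<^sub>R 1 + (K / \<delta>) *\<^sub>R norm (a t x))"
          using nonneg by simp
      qed simp
      also have "\<dots> \<le> \<bar>C * \<delta> powr \<alpha>\<bar> * ?one + \<bar>K / \<delta>\<bar> * L2_norm dx (\<lambda>x. norm (a t x))"
        using L2_norm_lincomb_le[OF one an, of "C * \<delta> powr \<alpha>" "K / \<delta>"] by simp
      also have "L2_norm dx (\<lambda>x. norm (a t x)) = L2_norm dx (a t)" by (simp add: L2_norm_def)
      also have "\<bar>C * \<delta> powr \<alpha>\<bar> * ?one + \<bar>K / \<delta>\<bar> * L2_norm dx (a t)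
          = C * \<delta> powr \<alpha> * ?one + K / \<delta> * L2_norm dx (a t)" using C K \<delta>(2) by simp
      finally have "R * L2_norm dx (c t) \<le> R * (C * \<delta> powr \<alpha> * ?one + K / \<delta> * L2_norm dx (a t))"
        using R(1) by (intro mult_left_mono) auto
      then have Rc: "R * L2_norm dx (c t) < \<eta> / 2"
        using \<delta>(1) elim(1) unfolding distrib_left by linarith
      have ctail: "(\<lambda>x. norm (?tail x)) \<in> L2 dx" by (rule L2_norm_fun[OF tail])
      have "L2_norm dx (\<lambda>x. c t x *\<^sub>R G x) \<le> 1 * L2_norm dx (\<lambda>x. R *\<^sub>R norm (c t x) + K *\<^sub>R norm (?tail x))"
      proof (rule L2_norm_mono_dx[OF cL2[OF G] L2_add[OF L2_scaleR[OF cn] L2_scaleR[OF ctail]]])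
        fix x assume x: "x \<in> \<Omega>"
        have nonneg: "0 \<le> R * \<bar>c t x\<bar>" "0 \<le> K * norm (?tail x)" using R(1) K by simp_all
        have "\<bar>c t x\<bar> * norm (G x) \<le> R * \<bar>c t x\<bar> + K * norm (?tail x)"
        proof (cases "R < norm (G x)")
          case True
          then have "K * norm (G x) = K * norm (?tail x)" by simp
          moreover have "\<bar>c t x\<bar> * norm (G x) \<le> K * norm (G x)"
            using c(2)[OF t x] by (rule mult_right_mono) simp
          ultimately show ?thesis using nonneg by linarith
        next
          case False
          then have "\<bar>c t x\<bar> * norm (G x) \<le> \<bar>c t x\<bar> * R" by (intro mult_left_mono) auto
          then show ?thesis using nonneg by (simp add: mult.commute)
        qed
        then show "norm (c t x *\<^sub>R G x) \<le> 1 * norm (R *\<^sub>R norm (c t x) + K *\<^sub>R norm (?tail x))"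
          using nonneg by simp
      qed simp
      also have "\<dots> \<le> \<bar>R\<bar> * L2_norm dx (\<lambda>x. norm (c t x)) + \<bar>K\<bar> * L2_norm dx (\<lambda>x. norm (?tail x))"
        using L2_norm_lincomb_le[OF cn ctail, of R K] by simp
      also have "L2_norm dx (\<lambda>x. norm (c t x)) = L2_norm dx (c t)" by (simp add: L2_norm_def)
      also have "L2_norm dx (\<lambda>x. norm (?tail x)) = L2_norm dx ?tail" by (simp only: L2_norm_def real_norm_def abs_norm_cancel)
      finally show ?case using Rc Ktail R(1) K by simp
    qed
  qed
  show ?thesis
  proof (rule order_tendstoI)
    show "\<forall>\<^sub>F t in at_right 0. L2_norm dx (\<lambda>x. c t x *\<^sub>R G x) < \<eta>" if "0 < \<eta>" for \<eta> by (rule main[OF that])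
    show "\<forall>\<^sub>F t in at_right 0. y < L2_norm dx (\<lambda>x. c t x *\<^sub>R G x)" if "y < 0" for y
      using that less_le_trans[OF that L2_norm_nonneg] by (intro always_eventually) blast
  qed
qed

lemma measurable_composite_coefficient:
  fixes a :: "real^3 \<Rightarrow> 'a::euclidean_space" and \<nu> :: "'a \<times> (real^3) \<Rightarrow> 'b::euclidean_space"
  assumes "\<nu> \<in> bounded_holder (UNIV \<times> closure \<Omega>) \<alpha>" "0 < \<alpha>" "a \<in> borel_measurable dx"
  shows "(\<lambda>x. \<nu> (a x, x)) \<in> borel_measurable dx"
proof -
  have "continuous_on (UNIV \<times> closure \<Omega>) \<nu>" by (rule bounded_holder_continuous_on[OF assms(1,2)])
  then have \<nu>: "\<nu> \<in> borel_measurable (restrict_space borel (UNIV \<times> closure \<Omega>))"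
    by (rule borel_measurable_continuous_on_restrict)
  have "(\<lambda>x. (a x, x)) \<in> borel_measurable dx"
    by (intro borel_measurable_Pair[OF assms(3)] borel_measurable_lebesgue_on) simp
  then have "(\<lambda>x. (a x, x)) \<in> dx \<rightarrow>\<^sub>M restrict_space borel (UNIV \<times> closure \<Omega>)"
    using closure_subset space_lebesgue_on_\<Omega> by (intro measurable_restrict_space2) auto
  then show ?thesis using \<nu> by (rule measurable_compose)
qed

end

context chart_domain
begin

lemma weak_solution_solenoidal:
  assumes "weak_solution \<Omega> a w" "a \<in> borel_measurable dx" "\<And>x. x \<in> \<Omega> \<Longrightarrow> \<bar>a x\<bar> \<le> K"
  shows "solenoidal (\<lambda>x. a x *\<^sub>R grad w x)"
proof -
  have "w \<in> H1 \<Omega>" using assms(1) by (simp add: weak_solution_def)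
  then have "(\<lambda>x. a x *\<^sub>R grad w x) \<in> L2 dx"
    by (intro L2_mult_bounded[OF H1_D(3) assms(2), of _ K]) (auto intro: assms(3) space_lebesgue_on_\<Omega>)
  then show ?thesis using assms(1) by (simp add: solenoidal_def weak_solution_def)
qed

text \<open>The function \<open>W = F - t u - m\<close> has trace zero. Tested with \<open>W\<close>, the two equations give
  \<open>\<integral> a \<bar>\<nabla>W\<bar>\<^sup>2 = - t \<integral> (a - a0) \<nabla>u \<bullet> \<nabla>W\<close> and thus \<open>\<nu>\<^sub>0 \<parallel>\<nabla>W\<parallel> \<le> t d\<close>. The flux estimate follows from
  \<open>a \<nabla>F / t - a0 \<nabla>u = a \<nabla>W / t + (a - a0) \<nabla>u\<close>, the second estimate from the Poincare inequality for
  \<open>W\<close>. The third one bounds \<open>d\<close> without any information on how \<open>a\<close> depends on \<open>t\<close>; it is what makes the second one a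
  rate of convergence.\<close>

lemma energy_estimate:
  assumes F: "weak_solution \<Omega> a F" "has_trace \<Omega> F (\<lambda>x. m + t * f x)"
    and u: "weak_solution \<Omega> a0 u" "has_trace \<Omega> u f"
    and a: "a \<in> borel_measurable dx" "\<And>x. x \<in> \<Omega> \<Longrightarrow> \<nu>\<^sub>0 \<le> a x" "\<And>x. x \<in> \<Omega> \<Longrightarrow> \<bar>a x\<bar> \<le> K"
    and a0: "a0 \<in> borel_measurable dx" "\<And>x. x \<in> \<Omega> \<Longrightarrow> \<bar>a0 x\<bar> \<le> K"
    and pos: "0 < \<nu>\<^sub>0" "0 < t" "0 \<le> K"
    and R: "\<Omega> \<subseteq> cball 0 R" "0 \<le> R"
  defines "d \<equiv> L2_norm dx (\<lambda>x. (a x - a0 x) *\<^sub>R grad u x)"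
  shows "L2_norm dx (\<lambda>x. inverse t *\<^sub>R (a x *\<^sub>R grad F x) - a0 x *\<^sub>R grad u x)
      \<le> (K / \<nu>\<^sub>0 + 1) * d" (is ?flux)
    and "L2_norm dx (\<lambda>x. F x - m)
      \<le> t * (L2_norm dx u + 2 * R * d / \<nu>\<^sub>0)" (is ?state)
    and "d \<le> 2 * K * L2_norm dx (grad u)" (is ?coefficient)
proof -
  have H1: "F \<in> H1 \<Omega>" "u \<in> H1 \<Omega>" using F(1) u(1) by (auto simp: weak_solution_def)
  define W where "W x = 1 * F x + (- t) * u x + (- m)" for x
  define E where "E = grad W"
  have W0: "W \<in> H1_0 \<Omega>"
    unfolding W_def by (rule trace_lincomb_H1_0[OF F(2) u(2)]) simp
  have WH1: "W \<in> H1 \<Omega>" unfolding W_def by (rule H1_lincomb(1)[OF H1])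
  have Egrad: "AE x in dx. E x = grad F x - t *\<^sub>R grad u x"
    using H1_lincomb(2)[OF H1, of 1 "-t" "-m"] unfolding E_def W_def[abs_def]
    by eventually_elim simp
  have gF: "grad F \<in> L2 dx" and gu: "grad u \<in> L2 dx" and EL2: "E \<in> L2 dx"
    using H1_D(3)[OF H1(1)] H1_D(3)[OF H1(2)] H1_D(3)[OF WH1] by (auto simp: E_def)
  have aL2: "(\<lambda>x. a x *\<^sub>R g x) \<in> L2 dx" if "g \<in> L2 dx" for g :: "real^3 \<Rightarrow> real^3"
    by (rule L2_mult_bounded[OF that a(1), of K]) (use a(3) space_lebesgue_on_\<Omega> in blast)
  have a0L2: "(\<lambda>x. a0 x *\<^sub>R g x) \<in> L2 dx" if "g \<in> L2 dx" for g :: "real^3 \<Rightarrow> real^3"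
    by (rule L2_mult_bounded[OF that a0(1), of K]) (use a0(2) space_lebesgue_on_\<Omega> in blast)
  have dif: "(\<lambda>x. (a x - a0 x) *\<^sub>R grad u x) \<in> L2 dx"
    using L2_diff[OF aL2[OF gu] a0L2[OF gu]] by (simp add: scaleR_left_diff_distrib)
  have d0: "0 \<le> d" by (simp add: d_def)
  have int: "integrable dx (\<lambda>x. (a x *\<^sub>R grad F x) \<bullet> E x)"
    "integrable dx (\<lambda>x. (a0 x *\<^sub>R grad u x) \<bullet> E x)"
    "integrable dx (\<lambda>x. ((a x - a0 x) *\<^sub>R grad u x) \<bullet> E x)"
    by (rule L2_integrable_inner[OF aL2[OF gF] EL2], rule L2_integrable_inner[OF a0L2[OF gu] EL2],
        rule L2_integrable_inner[OF dif EL2])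
  have zero: "(\<integral>x. (a x *\<^sub>R grad F x) \<bullet> E x \<partial>dx) = 0" "(\<integral>x. (a0 x *\<^sub>R grad u x) \<bullet> E x \<partial>dx) = 0"
    using F(1) u(1) W0 by (auto simp: weak_solution_def E_def)
  have "(\<integral>x. (a x *\<^sub>R E x) \<bullet> E x \<partial>dx) = (\<integral>x. (a x *\<^sub>R grad F x) \<bullet> E x
      - t * ((a0 x *\<^sub>R grad u x) \<bullet> E x) - t * (((a x - a0 x) *\<^sub>R grad u x) \<bullet> E x) \<partial>dx)"
  proof (rule integral_cong_AE)
    show "(\<lambda>x. (a x *\<^sub>R E x) \<bullet> E x) \<in> borel_measurable dx"
      using L2_integrable_inner[OF aL2[OF EL2] EL2] by simp
    show "(\<lambda>x. (a x *\<^sub>R grad F x) \<bullet> E x - t * ((a0 x *\<^sub>R grad u x) \<bullet> E x)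
        - t * (((a x - a0 x) *\<^sub>R grad u x) \<bullet> E x)) \<in> borel_measurable dx"
      by (intro borel_measurable_diff borel_measurable_times borel_measurable_const
            borel_measurable_integrable int)
    show "AE x in dx. (a x *\<^sub>R E x) \<bullet> E x = (a x *\<^sub>R grad F x) \<bullet> E x
        - t * ((a0 x *\<^sub>R grad u x) \<bullet> E x) - t * (((a x - a0 x) *\<^sub>R grad u x) \<bullet> E x)"
      using Egrad
    proof eventually_elim
      case (elim x)
      have "E x \<bullet> E x = (grad F x - t *\<^sub>R grad u x) \<bullet> E x" using elim by simp
      also have "\<dots> = grad F x \<bullet> E x - t * (grad u x \<bullet> E x)"
        by (simp add: inner_diff_left)
      finally have "a x * (E x \<bullet> E x) = a x * (grad F x \<bullet> E x - t * (grad u x \<bullet> E x))"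
        by simp
      then show ?case by (simp add: algebra_simps)
    qed
  qed
  also have "\<dots> = t * (- (\<integral>x. ((a x - a0 x) *\<^sub>R grad u x) \<bullet> E x \<partial>dx))"
    using int zero by (simp del: inner_scaleR_left)
  also have "\<dots> \<le> t * (d * L2_norm dx E)"
  proof -
    have "\<bar>\<integral>x. ((a x - a0 x) *\<^sub>R grad u x) \<bullet> E x \<partial>dx\<bar> \<le> d * L2_norm dx E"
      unfolding d_def by (rule L2_Cauchy_Schwarz[OF dif EL2])
    then show ?thesis using pos(2) by (intro mult_left_mono) (simp_all only: abs_le_iff less_imp_le)
  qed
  finally have up: "(\<integral>x. (a x *\<^sub>R E x) \<bullet> E x \<partial>dx) \<le> t * (d * L2_norm dx E)" .
  have "\<nu>\<^sub>0 * (L2_norm dx E)\<^sup>2 = (\<integral>x. \<nu>\<^sub>0 * (norm (E x))\<^sup>2 \<partial>dx)" by (simp add: L2_norm_sq)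
  also have "\<dots> \<le> (\<integral>x. (a x *\<^sub>R E x) \<bullet> E x \<partial>dx)"
  proof (rule integral_mono)
    show "integrable dx (\<lambda>x. \<nu>\<^sub>0 * (norm (E x))\<^sup>2)" using L2_D(2)[OF EL2] by simp
    show "integrable dx (\<lambda>x. (a x *\<^sub>R E x) \<bullet> E x)" by (rule L2_integrable_inner[OF aL2[OF EL2] EL2])
    show "\<nu>\<^sub>0 * (norm (E x))\<^sup>2 \<le> (a x *\<^sub>R E x) \<bullet> E x" if "x \<in> space dx" for x
      using mult_right_mono[OF a(2)[OF space_lebesgue_on_\<Omega>[OF that]], of "(norm (E x))\<^sup>2"]
      by (simp add: power2_norm_eq_inner)
  qed
  also note up
  finally have "L2_norm dx E * (\<nu>\<^sub>0 * L2_norm dx E) \<le> L2_norm dx E * (t * d)"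
    by (simp add: power2_eq_square mult_ac)
  then have "\<nu>\<^sub>0 * L2_norm dx E \<le> t * d"
  proof (cases "L2_norm dx E = 0")
    case True
    then show ?thesis using pos(2) d0 by simp
  next
    case False
    then have "0 < L2_norm dx E" using L2_norm_nonneg[of dx E] by linarith
    then show "L2_norm dx E * (\<nu>\<^sub>0 * L2_norm dx E) \<le> L2_norm dx E * (t * d) \<Longrightarrow> ?thesis"
      by (rule mult_left_le_imp_le[rotated])
  qed
  then have E: "L2_norm dx E \<le> t * d / \<nu>\<^sub>0" using pos(1) by (simp add: le_divide_eq mult.commute)
  have "L2_norm dx (\<lambda>x. inverse t *\<^sub>R (a x *\<^sub>R grad F x) - a0 x *\<^sub>R grad u x)
      = L2_norm dx (\<lambda>x. inverse t *\<^sub>R (a x *\<^sub>R E x) + 1 *\<^sub>R ((a x - a0 x) *\<^sub>R grad u x))"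
  proof (rule L2_norm_cong_AE)
    show "(\<lambda>x. inverse t *\<^sub>R (a x *\<^sub>R grad F x) - a0 x *\<^sub>R grad u x) \<in> L2 dx"
      by (rule L2_diff[OF L2_scaleR[OF aL2[OF gF]] a0L2[OF gu]])
    show "(\<lambda>x. inverse t *\<^sub>R (a x *\<^sub>R E x) + 1 *\<^sub>R ((a x - a0 x) *\<^sub>R grad u x)) \<in> L2 dx"
      by (rule L2_add[OF L2_scaleR[OF aL2[OF EL2]] L2_scaleR[OF dif]])
    show "AE x in dx. norm (inverse t *\<^sub>R (a x *\<^sub>R grad F x) - a0 x *\<^sub>R grad u x)
        = norm (inverse t *\<^sub>R (a x *\<^sub>R E x) + 1 *\<^sub>R ((a x - a0 x) *\<^sub>R grad u x))"
      using Egrad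
    proof eventually_elim
      case (elim x)
      have "inverse t *\<^sub>R (a x *\<^sub>R E x) = inverse t *\<^sub>R (a x *\<^sub>R grad F x) - a x *\<^sub>R grad u x"
        using pos(2) elim by (simp add: scaleR_right_diff_distrib)
      then show ?case by (simp add: scaleR_left_diff_distrib)
    qed
  qed
  also have "\<dots> \<le> \<bar>inverse t\<bar> * L2_norm dx (\<lambda>x. a x *\<^sub>R E x) + \<bar>1\<bar> * d"
    unfolding d_def by (rule L2_norm_lincomb_le[OF aL2[OF EL2] dif])
  also have "\<dots> \<le> inverse t * (K * (t * d / \<nu>\<^sub>0)) + d"
  proof -
    have "L2_norm dx (\<lambda>x. a x *\<^sub>R E x) \<le> K * L2_norm dx E"
    proof (rule L2_norm_mono_AE[OF aL2[OF EL2] EL2 _ pos(3)])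
      show "AE x in dx. norm (a x *\<^sub>R E x) \<le> K * norm (E x)"
        using a(3)[OF space_lebesgue_on_\<Omega>] by (intro AE_I2) (simp add: mult_right_mono)
    qed
    also have "\<dots> \<le> K * (t * d / \<nu>\<^sub>0)" by (rule mult_left_mono[OF E pos(3)])
    finally have "\<bar>inverse t\<bar> * L2_norm dx (\<lambda>x. a x *\<^sub>R E x) \<le> \<bar>inverse t\<bar> * (K * (t * d / \<nu>\<^sub>0))"
      by (rule mult_left_mono) simp
    moreover have "\<bar>inverse t\<bar> = inverse t" using pos(2) by simp
    ultimately show ?thesis by simp
  qed
  also have "\<dots> = (K / \<nu>\<^sub>0 + 1) * d" using pos(2) by (simp add: field_simps)
  finally show ?flux .
  have uL2: "u \<in> L2 dx" and WL2: "W \<in> L2 dx" using H1_D(1)[OF H1(2)] H1_D(1)[OF WH1] .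
  have "L2_norm dx (\<lambda>x. F x - m) = L2_norm dx (\<lambda>x. 1 *\<^sub>R W x + t *\<^sub>R u x)"
    by (simp add: W_def algebra_simps)
  also have "\<dots> \<le> \<bar>1\<bar> * L2_norm dx W + \<bar>t\<bar> * L2_norm dx u" by (rule L2_norm_lincomb_le[OF WL2 uL2])
  also have "L2_norm dx W \<le> 2 * R * L2_norm dx E" unfolding E_def by (rule Poincare_H1_0[OF W0 R])
  also have "2 * R * L2_norm dx E \<le> 2 * R * (t * d / \<nu>\<^sub>0)" by (rule mult_left_mono[OF E]) (use R in simp)
  finally show ?state using pos(2) by (simp add: algebra_simps)
  show ?coefficient
    unfolding d_def
  proof (rule L2_norm_mono_dx[OF dif gu])
    fix x assume x: "x \<in> \<Omega>"
    then have "\<bar>a x - a0 x\<bar> \<le> 2 * K" using a(3)[of x] a0(2)[of x] by linarith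
    then show "norm ((a x - a0 x) *\<^sub>R grad u x) \<le> 2 * K * norm (grad u x)"
      by (simp add: mult_right_mono)
  qed (use pos(3) in simp)
qed

end

section \<open>Convergence of the difference quotients\<close>

theorem lemma4p6:
  fixes \<Omega> :: "(real^3) set"
    and \<alpha> \<beta> \<nu>\<^sub>0 :: real
    and \<nu> :: "(real^'n::finite) \<times> (real^3) \<Rightarrow> real^'m::finite"
    and A :: "(real^3 \<Rightarrow> real^'m) \<Rightarrow> (real^3 \<Rightarrow> real^'n)"
    and f :: "real^3 \<Rightarrow> real^'m"
    and \<mu> :: "real^'m"
    and F :: "real \<Rightarrow> real^3 \<Rightarrow> real^'m"
    and u :: "real^3 \<Rightarrow> real^'m"
  assumes "0 < \<beta>" "\<beta> \<le> 1" "bounded_C1_holder_domain \<beta> \<Omega>"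
    and "0 < \<alpha>" "\<alpha> \<le> 1" "\<nu> \<in> bounded_holder (UNIV \<times> closure \<Omega>) \<alpha>"
    and "0 < \<nu>\<^sub>0" "\<forall>i. \<forall>y. \<forall>x\<in>closure \<Omega>. \<nu>\<^sub>0 \<le> \<nu> (y, x) $ i"
    and "\<forall>v\<in>L2 (lebesgue_on \<Omega>). A v \<in> L2 (lebesgue_on \<Omega>)"
    and "continuous_on_L2 (lebesgue_on \<Omega>) A"
    and "\<forall>m. \<exists>\<alpha>'. 0 < \<alpha>' \<and> \<alpha>' \<le> 1 \<and>
           (\<exists>h \<in> bounded_holder (closure \<Omega>) \<alpha>'. AE x in lebesgue_on \<Omega>. A (\<lambda>_. m) x = h x)"
    and "\<forall>m. \<exists>L>0. \<forall>v\<in>L2 (lebesgue_on \<Omega>).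
           L2_norm (lebesgue_on \<Omega>) (\<lambda>x. A (\<lambda>y. m + v y) x - A (\<lambda>_. m) x)
             \<le> L * L2_norm (lebesgue_on \<Omega>) v"
    and "\<forall>i. (\<lambda>x. f x $ i) \<in> C1_holder_boundary \<Omega> \<beta>"
    and "\<forall>t>0. \<forall>i. weak_solution \<Omega> (\<lambda>x. \<nu> (A (F t) x, x) $ i) (\<lambda>x. F t x $ i) \<and>
           has_trace \<Omega> (\<lambda>x. F t x $ i) (\<lambda>x. \<mu> $ i + t * f x $ i)"
    and "\<forall>i. weak_solution \<Omega> (\<lambda>x. \<nu> (A (\<lambda>_. \<mu>) x, x) $ i) (\<lambda>x. u x $ i) \<and>
           has_trace \<Omega> (\<lambda>x. u x $ i) (\<lambda>x. f x $ i)"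
  shows "\<forall>i.
    (let T = (\<lambda>t g. normal_trace \<Omega>
               (\<lambda>x. \<nu> (A (F t) x, x) $ i *\<^sub>R weak_grad \<Omega> (\<lambda>y. F t y $ i) x) g / t);
         T\<^sub>0 = normal_trace \<Omega>
               (\<lambda>x. \<nu> (A (\<lambda>_. \<mu>) x, x) $ i *\<^sub>R weak_grad \<Omega> (\<lambda>y. u y $ i) x)
     in (\<forall>t>0. T t \<in> W_minus_half \<Omega>) \<and> T\<^sub>0 \<in> W_minus_half \<Omega> \<and>
        ((\<lambda>t. W_minus_half_norm \<Omega> (\<lambda>g. T t g - T\<^sub>0 g)) \<longlongrightarrow> 0) (at_right 0))"
proof -
  let ?M = "lebesgue_on \<Omega>" and ?A0 = "A (\<lambda>_. \<mu>)"
  let ?aF = "\<lambda>t i x. \<nu> (A (F t) x, x) $ i" and ?a0 = "\<lambda>i x. \<nu> (A (\<lambda>_. \<mu>) x, x) $ i"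
  let ?gF = "\<lambda>t i. weak_grad \<Omega> (\<lambda>y. F t y $ i)" and ?gu = "\<lambda>i. weak_grad \<Omega> (\<lambda>y. u y $ i)"
  have dom: "open \<Omega>" "bounded \<Omega>" and gch: "\<And>p. p \<in> frontier \<Omega> \<Longrightarrow> \<exists>Q r \<gamma>. graph_chart \<Omega> \<beta> p Q r \<gamma>"
    using assms(3) by (auto simp: bounded_C1_holder_domain_def)
  interpret chart_domain \<Omega>
  proof
    show "open \<Omega>" "bounded \<Omega>" by (rule dom)+
    fix p assume "p \<in> frontier \<Omega>"
    then obtain Q r \<gamma> where "graph_chart \<Omega> \<beta> p Q r \<gamma>" using gch by blast
    then show "\<exists>r e \<rho> D\<rho>. straight_chart \<Omega> p r e \<rho> D\<rho>"
      using graph_chart_imp_straight_chart[OF _ assms(1)] by metis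
  qed
  have "bounded (\<nu> ` (UNIV \<times> closure \<Omega>))" using assms(6) by (simp add: bounded_holder_def)
  then obtain K where K: "0 < K" "\<forall>y\<in>\<nu> ` (UNIV \<times> closure \<Omega>). norm y \<le> K"
    unfolding bounded_pos by blast
  have \<nu>K: "\<bar>\<nu> (y, x) $ i\<bar> \<le> K" if "x \<in> \<Omega>" for x y i
  proof -
    have "(y, x) \<in> UNIV \<times> closure \<Omega>" using that closure_subset by blast
    then have "norm (\<nu> (y, x)) \<le> K" using K(2) by blast
    then show ?thesis using component_le_norm_cart[of "\<nu> (y, x)" i] by linarith
  qed
  obtain C where C: "\<And>p q. p \<in> UNIV \<times> closure \<Omega> \<Longrightarrow> q \<in> UNIV \<times> closure \<Omega> \<Longrightarrow>
      norm (\<nu> p - \<nu> q) \<le> C * dist p q powr \<alpha>"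
    using assms(6) unfolding bounded_holder_def by blast
  have \<nu>C: "\<bar>\<nu> (y, x) $ i - \<nu> (z, x) $ i\<bar> \<le> \<bar>C\<bar> * norm (y - z) powr \<alpha>" if "x \<in> \<Omega>" for x y z i
  proof -
    have "(y, x) \<in> UNIV \<times> closure \<Omega>" "(z, x) \<in> UNIV \<times> closure \<Omega>" using that closure_subset by blast+
    from C[OF this] have "norm (\<nu> (y, x) - \<nu> (z, x)) \<le> C * norm (y - z) powr \<alpha>"
      by (simp add: dist_Pair_Pair dist_norm)
    also have "\<dots> \<le> \<bar>C\<bar> * norm (y - z) powr \<alpha>" by (intro mult_right_mono) auto
    finally show ?thesis
      using component_le_norm_cart[of "\<nu> (y, x) - \<nu> (z, x)" i] by (simp add: vector_minus_component)
  qed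
  have \<nu>0: "\<nu>\<^sub>0 \<le> \<nu> (y, x) $ i" if "x \<in> \<Omega>" for x y i using assms(8) that closure_subset by blast
  obtain R where R: "0 < R" "\<Omega> \<subseteq> cball 0 R"
    using dom(2) unfolding bounded_pos subset_iff mem_cball dist_0_norm by blast
  have sol: "weak_solution \<Omega> (\<lambda>x. ?aF t i x) (\<lambda>x. F t x $ i)"
    "has_trace \<Omega> (\<lambda>x. F t x $ i) (\<lambda>x. \<mu> $ i + t * f x $ i)" if "0 < t" for t i
    using assms(14) that by blast+
  have sol0: "weak_solution \<Omega> (\<lambda>x. ?a0 i x) (\<lambda>x. u x $ i)"
    "has_trace \<Omega> (\<lambda>x. u x $ i) (\<lambda>x. f x $ i)" for i
    using assms(15) by blast+
  have const: "(\<lambda>_. \<mu>) \<in> L2 ?M" by (rule L2_continuous) simp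
  have A\<mu>: "?A0 \<in> L2 ?M" using assms(9) const by blast
  have FL2: "F t \<in> L2 ?M" if "0 < t" for t
    by (rule L2_vec(1)) (use sol(1)[OF that] in \<open>auto simp: weak_solution_def intro: H1_D(1)\<close>)
  have AF: "A (F t) \<in> L2 ?M" if "0 < t" for t using assms(9) FL2[OF that] by blast
  have meas: "(\<lambda>x. \<nu> (v x, x) $ i) \<in> borel_measurable ?M" if "v \<in> L2 ?M" for v i
    by (rule measurable_compose[OF measurable_composite_coefficient[OF assms(6,4) L2_D(1)[OF that]]])
       (intro borel_measurable_continuous_onI continuous_intros)
  define d where "d i t = L2_norm ?M (\<lambda>x. (?aF t i x - ?a0 i x)
      *\<^sub>R ?gu i x)" for i t
  have energy:
    "L2_norm ?M (\<lambda>x. inverse t *\<^sub>R (?aF t i x *\<^sub>R ?gF t i x)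
        - ?a0 i x *\<^sub>R ?gu i x) \<le> (K / \<nu>\<^sub>0 + 1) * d i t"
    "L2_norm ?M (\<lambda>x. F t x $ i - \<mu> $ i) \<le> t * (L2_norm ?M (\<lambda>x. u x $ i) + 2 * R * d i t / \<nu>\<^sub>0)"
    "d i t \<le> 2 * K * L2_norm ?M (?gu i)"
    if t: "0 < t" for t i
    unfolding d_def
    by (rule energy_estimate[OF sol[OF t] sol0 meas[OF AF[OF t]] \<nu>0 \<nu>K meas[OF A\<mu>] \<nu>K assms(7) t
          less_imp_le[OF K(1)] R(2) less_imp_le[OF R(1)]]; assumption)+
  \<comment> \<open>The boundary data of \<open>F\<^sup>t\<close> differ from \<open>\<mu>\<close> by \<open>t f\<close>, so \<open>F\<^sup>t\<close> tends to \<open>\<mu>\<close> at rate \<open>t\<close>.\<close>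
  define B where "B = (\<Sum>i\<in>UNIV. L2_norm ?M (\<lambda>x. u x $ i)
      + 2 * R * (2 * K * L2_norm ?M (?gu i)) / \<nu>\<^sub>0)"
  have vL2: "(\<lambda>x. F t x - \<mu>) \<in> L2 ?M" if "0 < t" for t by (rule L2_diff[OF FL2[OF that] const])
  have state: "L2_norm ?M (\<lambda>x. F t x - \<mu>) \<le> t * B" if t: "0 < t" for t
  proof -
    have comp: "(\<lambda>x. (F t x - \<mu>) $ i) \<in> L2 ?M" for i
    proof -
      have "(\<lambda>x. F t x $ i) \<in> L2 ?M" using sol(1)[OF t] by (auto simp: weak_solution_def intro: H1_D(1))
      from L2_diff[OF this L2_continuous[OF continuous_on_const]] show ?thesis by simp
    qed
    have "L2_norm ?M (\<lambda>x. F t x - \<mu>) \<le> (\<Sum>i\<in>UNIV. L2_norm ?M (\<lambda>x. (F t x - \<mu>) $ i))"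
      by (rule L2_vec(2)[OF comp])
    also have "\<dots> \<le> (\<Sum>i\<in>UNIV. t * (L2_norm ?M (\<lambda>x. u x $ i)
        + 2 * R * (2 * K * L2_norm ?M (?gu i)) / \<nu>\<^sub>0))"
    proof (rule sum_mono)
      fix i
      have "2 * R * d i t / \<nu>\<^sub>0 \<le> 2 * R * (2 * K * L2_norm ?M (?gu i)) / \<nu>\<^sub>0"
        using energy(3)[OF t, of i] R(1) assms(7) by (intro divide_right_mono mult_left_mono) auto
      then have "t * (L2_norm ?M (\<lambda>x. u x $ i) + 2 * R * d i t / \<nu>\<^sub>0)
          \<le> t * (L2_norm ?M (\<lambda>x. u x $ i) + 2 * R * (2 * K * L2_norm ?M (?gu i)) / \<nu>\<^sub>0)"
        using t by (intro mult_left_mono add_left_mono) auto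
      then show "L2_norm ?M (\<lambda>x. (F t x - \<mu>) $ i) \<le> t * (L2_norm ?M (\<lambda>x. u x $ i)
          + 2 * R * (2 * K * L2_norm ?M (?gu i)) / \<nu>\<^sub>0)"
        using energy(2)[OF t, of i] by simp
    qed
    finally show ?thesis by (simp add: B_def sum_distrib_left)
  qed
  obtain L where L: "0 < L" "\<forall>v\<in>L2 ?M. L2_norm ?M (\<lambda>x. A (\<lambda>y. \<mu> + v y) x - ?A0 x) \<le> L * L2_norm ?M v"
    using assms(12) by blast
  have AL2: "(\<lambda>x. A (F t) x - ?A0 x) \<in> L2 ?M" if "0 < t" for t by (rule L2_diff[OF AF[OF that] A\<mu>])
  have A0: "((\<lambda>t. L2_norm ?M (\<lambda>x. A (F t) x - ?A0 x)) \<longlongrightarrow> 0) (at_right 0)"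
  proof (rule Lim_null_comparison)
    show "\<forall>\<^sub>F t in at_right 0. norm (L2_norm ?M (\<lambda>x. A (F t) x - ?A0 x)) \<le> L * (t * B)"
      using eventually_at_right_less[of "0::real"]
    proof eventually_elim
      case (elim t)
      have "L2_norm ?M (\<lambda>x. A (\<lambda>y. \<mu> + (F t y - \<mu>)) x - ?A0 x) \<le> L * L2_norm ?M (\<lambda>x. F t x - \<mu>)"
        by (rule bspec[OF L(2) vL2[OF elim]])
      also have "\<dots> \<le> L * (t * B)" using state[OF elim] L(1) by (intro mult_left_mono) auto
      finally show ?case by simp
    qed
    have "((\<lambda>t. L * (t * B)) \<longlongrightarrow> L * (0 * B)) (at_right 0)" by (intro tendsto_intros)
    then show "((\<lambda>t. L * (t * B)) \<longlongrightarrow> 0) (at_right 0)" by simp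
  qed
  have d0: "((\<lambda>t. d i t) \<longlongrightarrow> 0) (at_right 0)" for i
    unfolding d_def
  proof (rule bounded_Hoelder_multiplier_tendsto_0[of _ \<alpha> "2 * K" "\<bar>C\<bar>" _ "\<lambda>t x. A (F t) x - ?A0 x"])
    show "?gu i \<in> L2 ?M" using sol0(1)[of i] by (auto simp: weak_solution_def intro: H1_D(3))
    show "(\<lambda>x. ?aF t i x - ?a0 i x) \<in> borel_measurable ?M" if "0 < t" for t
      by (intro borel_measurable_diff meas AF that A\<mu>)
    show "\<bar>?aF t i x - ?a0 i x\<bar> \<le> 2 * K" if "0 < t" "x \<in> \<Omega>" for t x
      using \<nu>K[OF that(2), of "A (F t) x" i] \<nu>K[OF that(2), of "?A0 x" i] by linarith
    show "\<bar>?aF t i x - ?a0 i x\<bar> \<le> \<bar>C\<bar> * norm (A (F t) x - ?A0 x) powr \<alpha>"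
      if "0 < t" "x \<in> \<Omega>" for t x by (rule \<nu>C[OF that(2)])
  qed (use AL2 A0 assms(4) K(1) in auto)
  have solX: "solenoidal (\<lambda>x. ?aF t i x *\<^sub>R ?gF t i x)" if "0 < t" for t i
    by (rule weak_solution_solenoidal[OF sol(1)[OF that] meas[OF AF[OF that]] \<nu>K])
  have solY: "solenoidal (\<lambda>x. ?a0 i x *\<^sub>R ?gu i x)" for i
    by (rule weak_solution_solenoidal[OF sol0(1) meas[OF A\<mu>] \<nu>K])
  show ?thesis
    unfolding Let_def
  proof (intro allI conjI impI)
    fix i and t :: real assume t: "0 < t"
    show "(\<lambda>g. normal_trace \<Omega> (\<lambda>x. ?aF t i x *\<^sub>R ?gF t i x) g / t) \<in> W_minus_half \<Omega>"
      using normal_trace_in_W_minus_half[OF solX[OF t], of "inverse t" i] by (simp add: divide_inverse mult.commute)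
  next
    fix i
    show "normal_trace \<Omega> (\<lambda>x. ?a0 i x *\<^sub>R ?gu i x) \<in> W_minus_half \<Omega>"
      using normal_trace_in_W_minus_half[OF solY, of 1 i] by simp
    have lim: "((\<lambda>t. ennreal ((K / \<nu>\<^sub>0 + 1) * d i t)) \<longlongrightarrow> 0) (at_right 0)"
    proof -
      have "((\<lambda>t. (K / \<nu>\<^sub>0 + 1) * d i t) \<longlongrightarrow> (K / \<nu>\<^sub>0 + 1) * 0) (at_right 0)"
        by (intro tendsto_mult tendsto_const d0)
      then have "((\<lambda>t. ennreal ((K / \<nu>\<^sub>0 + 1) * d i t)) \<longlongrightarrow> ennreal ((K / \<nu>\<^sub>0 + 1) * 0)) (at_right 0)"
        by (rule tendsto_ennrealI)
      then show ?thesis by simp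
    qed
    show "((\<lambda>t. W_minus_half_norm \<Omega> (\<lambda>g.
        normal_trace \<Omega> (\<lambda>x. ?aF t i x *\<^sub>R ?gF t i x) g / t
        - normal_trace \<Omega> (\<lambda>x. ?a0 i x *\<^sub>R ?gu i x) g)) \<longlongrightarrow> 0) (at_right 0)"
    proof (rule tendsto_sandwich[OF _ _ tendsto_const lim])
      show "\<forall>\<^sub>F t in at_right 0. W_minus_half_norm \<Omega> (\<lambda>g.
          normal_trace \<Omega> (\<lambda>x. ?aF t i x *\<^sub>R ?gF t i x) g / t
          - normal_trace \<Omega> (\<lambda>x. ?a0 i x *\<^sub>R ?gu i x) g)
          \<le> ennreal ((K / \<nu>\<^sub>0 + 1) * d i t)"
        using eventually_at_right_less[of "0::real"]
      proof eventually_elim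
        case (elim t)
        show ?case
          using order_trans[OF normal_trace_diff_norm[OF solX[OF elim] solY] ennreal_leI[OF energy(1)[OF elim]], of i]
          by (simp add: divide_inverse mult.commute)
      qed
    qed simp
  qed
qed

end
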